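(* Let $\theta\in\mathbb{R}\setminus\{0\}$. For any $X=\alpha H+\beta E+\gamma F\in\mathfrak{g}$ and any $t\in\mathbb{R}$, the function on $\mathbb{M}\simeq\mathbb{R}^2$ $$E_{\star_{\theta}}(tX)(a,\ell)=\sqrt{\cosh(\alpha t)}\;\exp\Big(\frac{i}{\theta}\sinh(\alpha t)\Big(2\ell+\frac{\beta}{\alpha}e^{-2a}-\frac{\gamma}{\alpha}e^{2a}\Big)\Big)$$ (where $\frac{\sinh(\alpha t)}{\alpha}:=t$ if $\alpha=0$) lies in the multiplier algebra $\mathcal{M}_{\star_\theta}(\mathbb{M})$.
   Context: $\mathfrak{g}$ is the Lie algebra of the Poincaré group $ISO(1,1)$, with basis $H,E,F$ and brackets $[H,E]=2E$, $[H,F]=-2F$, $[E,F]=0$; $\alpha,\beta,\gamma\in\mathbb{R}$. $\mathbb{M}\simeq\mathbb{R}^2$, with global coordinates $(a,\ell)$, is the coadjoint orbit of $E^*-F^*$, the point $(a,\ell)$ corresponding to $2\ell H^*+e^{-2a}E^*-e^{2a}F^*$ (with $\{H^*,E^*,F^*\}$ the dual basis). Schwartz space: $\mathcal{S}(\mathbb{M})$ is the space of $f\in C^\infty(\mathbb{M})$ such that for all $\alpha=(k,p,q,n)\in\mathbb{N}^4$, $$\|f\|_{\alpha}:=\sup_{(a,\ell)}\Big|\frac{\sinh(2a)^k}{\cosh(2a)^p}\,\ell^q\,\partial_a^p\partial_\ell^n f(a,\ell)\Big|<\infty .$$ With these seminorms it is a nuclear Fréchet space; it is the usual Schwartz space in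 the coordinates $(r,\ell)$ with $r=\sinh(2a)$. $\mathcal{S}'(\mathbb{M})$ denotes its topological dual and $\langle\cdot,\cdot\rangle$ the duality bracket; a function $T$ is identified with the functional $f\mapsto\int T(a,\ell)f(a,\ell)\,da\,d\ell$ (when this defines an element of $\mathcal{S}'(\mathbb{M})$). Star-product: for $f,h\in\mathcal{S}(\mathbb{M})$, with $\mathcal{P}_\theta(a)=\sqrt{\cosh(a\theta/2)}$, $$(f\star_{\theta}h)(a,\ell)=\frac{4}{(\pi\theta)^{2}}\int_{\mathbb{R}^4} \cosh(2(a_1-a_2))\,\frac{\mathcal{P}_\theta(\frac{4}{\theta}(a_1-a))\,\mathcal{P}_\theta(\frac{4}{\theta}(a-a_2))}{\mathcal{P}_\theta(\frac{4}{\theta}(a_1-a_2))\,\mathcal{P}_\theta(0)}\; e^{\frac{2i}{\theta}\left(\sinh(2(a_1-a_2))\ell+\sinh(2(a_2-a))\ell_1+\sinh(2(a-a_1))\ell_2\right)}f(a_1,\ell_1)\,h(a_2,\ell_2)\,da_1\,da_2\,d\ell_1\,d\ell_2 .$$ Known facts: $(\mathcal{S}(\mathbb{M}),\star_\theta)$ is an associative Fréchet algebra, and $\int (f\star_\theta h)\,da\,d\ell=\int f h\,da\,d\ell$ for $f,h\in\mathcal{S}(\mathbb{M})$. Extension to distributions: for $T\in\mathcal{S}'(\mathbb{M})$ and $f\in\mathcal{S}(\mathbb{M})$, the elements $T\star_\theta f$ and $f\star_\theta T$ of $\mathcal{S}'(\mathbb{M})$ are defined by $\langle T\star_\theta f,h\rangle:=\langle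 T,f\star_\theta h\rangle$ and $\langle f\star_\theta T,h\rangle:=\langle T,h\star_\theta f\rangle$ for all $h\in\mathcal{S}(\mathbb{M})$. Multiplier algebra: $\mathcal{M}_{\star_\theta}(\mathbb{M})$ is the set of $T\in\mathcal{S}'(\mathbb{M})$ such that the maps $f\mapsto T\star_\theta f$ and $f\mapsto f\star_\theta T$ are continuous from $\mathcal{S}(\mathbb{M})$ into itself (in particular take values in $\mathcal{S}(\mathbb{M})$). *)

theory Defs
  imports "HOL-Analysis.Analysis"
begin

section \<open>The Poincare Lie algebra\<close>

text \<open>
  The triple \<open>(\<alpha>, \<beta>, \<gamma>)\<close> stands for \<open>\<alpha> H + \<beta> E + \<gamma> F\<close>; the vector space structure
  is the one of the product type.
\<close>

type_synonym poincare_lie = "real \<times> real \<times> real"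

definition lie_H :: poincare_lie where "lie_H = (1, 0, 0)"
definition lie_E :: poincare_lie where "lie_E = (0, 1, 0)"
definition lie_F :: poincare_lie where "lie_F = (0, 0, 1)"

definition lie_bracket :: "poincare_lie \<Rightarrow> poincare_lie \<Rightarrow> poincare_lie" where
  "lie_bracket = (\<lambda>(x, y, z) (x', y', z'). (0, 2 * (x * y' - x' * y), - 2 * (x * z' - x' * z)))"

lemma lie_bracket_basis:
  "lie_bracket lie_H lie_E = 2 *\<^sub>R lie_E"
  "lie_bracket lie_H lie_F = - (2 *\<^sub>R lie_F)"
  "lie_bracket lie_E lie_F = 0"
  by (simp_all add: lie_bracket_def lie_H_def lie_E_def lie_F_def zero_prod_def)


section \<open>The Schwartz space\<close>

text \<open>Functions on the orbit are functions of the global coordinates \<open>(a, l)\<close>.\<close>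

type_synonym orbit_fun = "real \<times> real \<Rightarrow> complex"

definition partial_a :: "orbit_fun \<Rightarrow> orbit_fun" where
  "partial_a f = (\<lambda>(a, l). vector_derivative (\<lambda>s. f (s, l)) (at a))"

definition partial_l :: "orbit_fun \<Rightarrow> orbit_fun" where
  "partial_l f = (\<lambda>(a, l). vector_derivative (\<lambda>s. f (a, s)) (at l))"

primrec C_k :: "nat \<Rightarrow> orbit_fun \<Rightarrow> bool" where
  "C_k 0 f \<longleftrightarrow> continuous_on UNIV f"
| "C_k (Suc k) f \<longleftrightarrow> f differentiable_on UNIV \<and> C_k k (partial_a f) \<and> C_k k (partial_l f)"

definition C_infinity :: "orbit_fun \<Rightarrow> bool" where
  "C_infinity f \<longleftrightarrow> (\<forall>k. C_k k f)"

definition schwartz_term :: "nat \<times> nat \<times> nat \<times> nat \<Rightarrow> orbit_fun \<Rightarrow> real \<times> real \<Rightarrow> real" where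
  "schwartz_term = (\<lambda>(k, p, q, n) f (a, l).
     cmod (complex_of_real (sinh (2 * a) ^ k / cosh (2 * a) ^ p * l ^ q)
           * (partial_a ^^ p) ((partial_l ^^ n) f) (a, l)))"

text \<open>
  The supremum is only meaningful when it is finite, as it is on the Schwartz space.
\<close>

definition schwartz_seminorm :: "nat \<times> nat \<times> nat \<times> nat \<Rightarrow> orbit_fun \<Rightarrow> real" where
  "schwartz_seminorm i f = (SUP x. schwartz_term i f x)"

definition schwartz_space :: "orbit_fun set" where
  "schwartz_space = {f. C_infinity f \<and> (\<forall>i. bdd_above (range (schwartz_term i f)))}"

text \<open>The locally convex topology of the seminorms, with all balls as a subbase.\<close>

definition schwartz_topology :: "orbit_fun topology" where
  "schwartz_topology = topology_generated_by
     {{g \<in> schwartz_space. schwartz_seminorm i (\<lambda>x. g x - f x) < e} | i f e.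
        f \<in> schwartz_space \<and> e > 0}"


section \<open>Distributions\<close>

text \<open>
  A functional on the Schwartz space is a function that is \<open>undefined\<close> off the Schwartz space,
  so that equality of functionals is equality on the Schwartz space.
\<close>

definition schwartz_dual :: "(orbit_fun \<Rightarrow> complex) set" where
  "schwartz_dual = {T \<in> extensional schwartz_space.
     (\<forall>f\<in>schwartz_space. \<forall>g\<in>schwartz_space. T (\<lambda>x. f x + g x) = T f + T g) \<and>
     (\<forall>c. \<forall>f\<in>schwartz_space. T (\<lambda>x. c * f x) = c * T f) \<and>
     continuous_map schwartz_topology euclidean T}"

definition distribution_of :: "orbit_fun \<Rightarrow> orbit_fun \<Rightarrow> complex" where
  "distribution_of u = (\<lambda>h\<in>schwartz_space. LINT x|lborel. u x * h x)"

text \<open>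
  Integrability has to be demanded separately, because the integral of a non-integrable function
  is \<open>0\<close> by convention.
\<close>

definition defines_distribution :: "orbit_fun \<Rightarrow> bool" where
  "defines_distribution u \<longleftrightarrow>
     (\<forall>h\<in>schwartz_space. integrable lborel (\<lambda>x. u x * h x)) \<and> distribution_of u \<in> schwartz_dual"


section \<open>The star product and its multipliers\<close>

definition P_fun :: "real \<Rightarrow> real \<Rightarrow> real" where
  "P_fun \<theta> a = sqrt (cosh (a * \<theta> / 2))"

definition star_product :: "real \<Rightarrow> orbit_fun \<Rightarrow> orbit_fun \<Rightarrow> orbit_fun" where
  "star_product \<theta> f h = (\<lambda>(a, l). complex_of_real (4 / (pi * \<theta>)\<^sup>2) *
     (LINT (a1, a2, l1, l2)|(lborel :: (real \<times> real \<times> real \<times> real) measure).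
        complex_of_real (cosh (2 * (a1 - a2)) *
          (P_fun \<theta> (4 / \<theta> * (a1 - a)) * P_fun \<theta> (4 / \<theta> * (a - a2)) /
           (P_fun \<theta> (4 / \<theta> * (a1 - a2)) * P_fun \<theta> 0))) *
        exp (2 * \<i> / complex_of_real \<theta> *
          complex_of_real (sinh (2 * (a1 - a2)) * l + sinh (2 * (a2 - a)) * l1
                           + sinh (2 * (a - a1)) * l2)) *
        f (a1, l1) * h (a2, l2)))"

definition dist_star :: "real \<Rightarrow> (orbit_fun \<Rightarrow> complex) \<Rightarrow> orbit_fun \<Rightarrow> (orbit_fun \<Rightarrow> complex)" where
  "dist_star \<theta> T f = (\<lambda>h\<in>schwartz_space. T (star_product \<theta> f h))"

definition star_dist :: "real \<Rightarrow> orbit_fun \<Rightarrow> (orbit_fun \<Rightarrow> complex) \<Rightarrow> (orbit_fun \<Rightarrow> complex)" where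
  "star_dist \<theta> f T = (\<lambda>h\<in>schwartz_space. T (star_product \<theta> h f))"

text \<open>
  The maps \<open>L\<close> and \<open>R\<close> are left and right multiplication by \<open>T\<close>, their values being regarded as
  Schwartz functions through the identification of a function with its distribution.
\<close>

definition multiplier_algebra :: "real \<Rightarrow> (orbit_fun \<Rightarrow> complex) set" where
  "multiplier_algebra \<theta> = {T \<in> schwartz_dual.
     (\<exists>L. continuous_map schwartz_topology schwartz_topology L \<and>
        (\<forall>f\<in>schwartz_space. dist_star \<theta> T f = distribution_of (L f))) \<and>
     (\<exists>R. continuous_map schwartz_topology schwartz_topology R \<and>
        (\<forall>f\<in>schwartz_space. star_dist \<theta> f T = distribution_of (R f)))}"


section \<open>The star exponential\<close>

text \<open>\<open>sinh_quot \<alpha> t\<close> is \<open>sinh (\<alpha> t) / \<alpha>\<close>, extended by \<open>t\<close> to \<open>\<alpha> = 0\<close>.\<close>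

definition sinh_quot :: "real \<Rightarrow> real \<Rightarrow> real" where
  "sinh_quot \<alpha> t = (if \<alpha> = 0 then t else sinh (\<alpha> * t) / \<alpha>)"

text \<open>
  The factor \<open>sinh (\<alpha> t)\<close> of the exponent is distributed over the sum, so that \<open>1 / \<alpha>\<close> only
  occurs in \<open>sinh_quot\<close>.
\<close>

definition star_exponential :: "real \<Rightarrow> real \<Rightarrow> poincare_lie \<Rightarrow> orbit_fun" where
  "star_exponential \<theta> t = (\<lambda>(\<alpha>, \<beta>, \<gamma>) (a, l).
     complex_of_real (sqrt (cosh (\<alpha> * t))) *
     exp (\<i> / complex_of_real \<theta> *
       complex_of_real (2 * l * sinh (\<alpha> * t)
         + sinh_quot \<alpha> t * (\<beta> * exp (- 2 * a) - \<gamma> * exp (2 * a)))))"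

end

theory Submission
  imports Defs "HOL-Probability.Characteristic_Functions" "HOL-Probability.Sinc_Integral"
begin

text \<open>
  Put \<open>c = 2 / \<theta>\<close>. The partial Fourier transform
  \<open>\<Phi> f (a, b) = \<integral> exp (i c sinh (2 b) l) f (a, l) dl\<close>, whose frequency is written as a hyperbolic
  sine, maps Schwartz functions on the orbit to functions all of whose derivatives decay faster than
  every power of \<open>cosh (2 a) cosh (2 b)\<close> (\<open>rapid_fiber_fourier\<close>), and its transpose \<open>\<Psi>\<close>,
  which integrates over \<open>b\<close>, maps such functions to Schwartz functions (\<open>rapid_fiber_synthesis\<close>).
  In these coordinates the four-dimensional oscillating integral of the star product becomes
  absolutely convergent in one variable: \<open>f \<star> h\<close> is a constant times \<open>\<Psi> W\<close> with
  \<open>W (a, b) = r b \<integral> u (s + a + b, s) v (s + a, - s - b) ds\<close>, where \<open>r b\<close> is the square root of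
  \<open>cosh (2 b)\<close>, \<open>u = r b \<Phi> f\<close> and \<open>v = r b \<Phi> h\<close> (\<open>star_product_synthesis\<close>). Hence \<open>f \<star> h\<close> is
  a Schwartz function.

  With \<open>\<tau> = \<alpha> t / 2\<close> the star exponential is \<open>r \<tau> exp (i \<phi> a) exp (i c sinh (2 \<tau>) l)\<close>, a plane wave
  along each fibre. Its integral against \<open>\<Psi> W\<close> over a fibre is a Fourier inversion, which evaluates
  \<open>W\<close> at \<open>b = - \<tau>\<close> (\<open>fourier_inversion_sinh\<close>). Translations in the remaining double integral
  turn it into the pairing of \<open>h\<close> with the function \<open>\<Psi> (exp (i \<phi> (a + b - \<tau>)) r b u (a - \<tau>, \<tau> - b))\<close>,
  up to a constant (\<open>exponential_pairing\<close>). So left multiplication by the star exponential is composed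
  of \<open>\<Phi>\<close>, a translation and reflection, multiplication by a function whose derivatives grow at most
  exponentially, and \<open>\<Psi>\<close>; each of these respects rapid decay.

  Right multiplication reduces to left multiplication: the kernel of the star product is symmetric up to
  a reversal of its phase, so exchanging the factors amounts to \<open>\<theta> \<mapsto> - \<theta>\<close>, and the star
  exponential is unchanged under \<open>(\<theta>, t) \<mapsto> (- \<theta>, - t)\<close>.

  Continuity comes from boundedness: the Schwartz topology is given by countably many seminorms, so a
  linear map that sends bounded sequences to bounded sequences is continuous
  (\<open>bounded_imp_seminorm_estimate\<close>). For this reason all estimates are made for sequences of functions,
  uniformly in the index; the constant sequences give the statements on single functions.
\<close>

section \<open>Sequences of smooth functions with uniform bounds\<close>

type_synonym fun_family = "nat \<Rightarrow> real \<Rightarrow> real \<Rightarrow> complex"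

definition partials :: "fun_family \<Rightarrow> fun_family \<Rightarrow> fun_family \<Rightarrow> bool" where
  "partials u ux uy \<longleftrightarrow>
     (\<forall>n x y. ((\<lambda>s. u n s y) has_vector_derivative ux n x y) (at x)) \<and>
     (\<forall>n x y. ((\<lambda>s. u n x s) has_vector_derivative uy n x y) (at y))"

text \<open>
  All derivatives up to order \<open>k\<close>, in every order of differentiation, exist and satisfy \<open>P\<close>. Here \<open>P\<close>
  is a bound on the whole sequence; for rapidly decaying sequences, continuity of the derivatives follows from
  the boundedness of the next ones (\<open>rapid_continuous\<close>).
\<close>

primrec smooth :: "(fun_family \<Rightarrow> bool) \<Rightarrow> nat \<Rightarrow> fun_family \<Rightarrow> bool" where
  "smooth P 0 u \<longleftrightarrow> P u"
| "smooth P (Suc k) u \<longleftrightarrow> P u \<and> (\<exists>ux uy. partials u ux uy \<and> smooth P k ux \<and> smooth P k uy)"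

lemma partials_unique:
  assumes "partials u ux uy" "partials u ux' uy'"
  shows "ux = ux'" "uy = uy'"
  using assms unfolding partials_def fun_eq_iff by (meson vector_derivative_unique_at)+

lemma smooth_SucD: "smooth P (Suc k) u \<Longrightarrow> smooth P k u"
  by (induction k arbitrary: u) (simp, metis smooth.simps(2))

lemma smooth_base: "smooth P k u \<Longrightarrow> P u"
  by (cases k) auto

lemma smooth_all_partials:
  assumes "\<forall>k. smooth P k u"
  obtains ux uy where "partials u ux uy" "\<forall>k. smooth P k ux" "\<forall>k. smooth P k uy"
proof -
  have "smooth P (Suc 0) u" using assms by blast
  then obtain ux uy where 1: "partials u ux uy" by auto
  have "smooth P k ux \<and> smooth P k uy" for k
  proof -
    have "smooth P (Suc k) u" using assms by blast
    then obtain vx vy where "partials u vx vy" "smooth P k vx" "smooth P k vy" by auto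
    then show ?thesis using partials_unique[OF 1] by metis
  qed
  then show thesis using that 1 by blast
qed

lemma partials_add:
  "partials u ux uy \<Longrightarrow> partials v vx vy \<Longrightarrow>
   partials (\<lambda>n x y. u n x y + v n x y) (\<lambda>n x y. ux n x y + vx n x y) (\<lambda>n x y. uy n x y + vy n x y)"
  by (auto simp: partials_def intro!: has_vector_derivative_add)

lemma partials_mult:
  "partials u ux uy \<Longrightarrow> partials v vx vy \<Longrightarrow>
   partials (\<lambda>n x y. u n x y * v n x y) (\<lambda>n x y. u n x y * vx n x y + ux n x y * v n x y)
     (\<lambda>n x y. u n x y * vy n x y + uy n x y * v n x y)"
  by (auto simp: partials_def intro!: has_vector_derivative_mult)

lemma smooth_add:
  assumes "\<And>u v. P u \<Longrightarrow> P v \<Longrightarrow> P (\<lambda>n x y. u n x y + v n x y)"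
  shows "smooth P k u \<Longrightarrow> smooth P k v \<Longrightarrow> smooth P k (\<lambda>n x y. u n x y + v n x y)"
proof (induction k arbitrary: u v)
  case 0
  then show ?case using assms by simp
next
  case (Suc k)
  from Suc.prems obtain ux uy vx vy where
    "partials u ux uy" "smooth P k ux" "smooth P k uy" "partials v vx vy" "smooth P k vx" "smooth P k vy"
    by auto
  then show ?case
    using Suc.prems Suc.IH[of ux vx] Suc.IH[of uy vy] partials_add[of u ux uy v vx vy] assms
    by auto
qed

text \<open>The Leibniz rule; \<open>R\<close> has to absorb the two summands of the derivative.\<close>

lemma smooth_mult:
  assumes PQ: "\<And>u v. P u \<Longrightarrow> Q v \<Longrightarrow> R (\<lambda>n x y. u n x y * v n x y)"
    and R: "\<And>u v. R u \<Longrightarrow> R v \<Longrightarrow> R (\<lambda>n x y. u n x y + v n x y)"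
  shows "smooth P k u \<Longrightarrow> smooth Q k v \<Longrightarrow> smooth R k (\<lambda>n x y. u n x y * v n x y)"
proof (induction k arbitrary: u v)
  case 0
  then show ?case using PQ by simp
next
  case (Suc k)
  from Suc.prems obtain ux uy vx vy where *:
    "partials u ux uy" "smooth P k ux" "smooth P k uy" "partials v vx vy" "smooth Q k vx" "smooth Q k vy"
    by auto
  moreover have "smooth P k u" "smooth Q k v" using Suc.prems smooth_SucD by blast+
  ultimately have
    "smooth R k (\<lambda>n x y. u n x y * vx n x y + ux n x y * v n x y)"
    "smooth R k (\<lambda>n x y. u n x y * vy n x y + uy n x y * v n x y)"
    using R Suc.IH by (auto intro!: smooth_add)
  moreover have "R (\<lambda>n x y. u n x y * v n x y)" using Suc.prems PQ by simp
  ultimately show ?case using partials_mult[OF *(1) *(4)] by auto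
qed

definition decays :: "(real \<Rightarrow> real \<Rightarrow> real) \<Rightarrow> fun_family \<Rightarrow> bool" where
  "decays w u \<longleftrightarrow> (\<forall>N. \<exists>C. \<forall>n x y. w x y ^ N * cmod (u n x y) \<le> C)"

definition grows :: "(real \<Rightarrow> real \<Rightarrow> real) \<Rightarrow> fun_family \<Rightarrow> bool" where
  "grows w u \<longleftrightarrow> (\<exists>N C. \<forall>n x y. cmod (u n x y) \<le> C * w x y ^ N)"

definition rapid :: "(real \<Rightarrow> real \<Rightarrow> real) \<Rightarrow> fun_family \<Rightarrow> bool" where
  "rapid w u \<longleftrightarrow> (\<forall>k. smooth (decays w) k u)"

definition slow :: "(real \<Rightarrow> real \<Rightarrow> real) \<Rightarrow> fun_family \<Rightarrow> bool" where
  "slow w u \<longleftrightarrow> (\<forall>k. smooth (grows w) k u)"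

lemma decaysE:
  assumes "decays w u"
  obtains C where "C > 0" "\<And>n x y. w x y ^ N * cmod (u n x y) \<le> C"
proof -
  obtain C where "\<And>n x y. w x y ^ N * cmod (u n x y) \<le> C"
    using assms unfolding decays_def by blast
  then show thesis by (intro that[of "max C 1"]) (auto simp: le_max_iff_disj)
qed

lemma decays_add:
  assumes "decays w u" "decays w v" and w: "\<And>x y. 1 \<le> w x y"
  shows "decays w (\<lambda>n x y. u n x y + v n x y)"
  unfolding decays_def
proof
  fix N
  obtain C where C: "\<And>n x y. w x y ^ N * cmod (u n x y) \<le> C" using assms(1) decaysE by metis
  obtain D where D: "\<And>n x y. w x y ^ N * cmod (v n x y) \<le> D" using assms(2) decaysE by metis
  have "w x y ^ N * cmod (u n x y + v n x y) \<le> C + D" for n x y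
  proof -
    have "w x y ^ N * cmod (u n x y + v n x y) \<le> w x y ^ N * (cmod (u n x y) + cmod (v n x y))"
      using w[of x y] by (intro mult_left_mono norm_triangle_ineq) auto
    also have "\<dots> \<le> C + D" using C[of x y n] D[of x y n] by (simp add: algebra_simps)
    finally show ?thesis .
  qed
  then show "\<exists>C. \<forall>n x y. w x y ^ N * cmod (u n x y + v n x y) \<le> C" by blast
qed

lemma growsE:
  assumes "grows w u" and w: "\<And>x y. 1 \<le> w x y"
  obtains C N where "C > 0" "\<And>n x y. cmod (u n x y) \<le> C * w x y ^ N"
proof -
  obtain C N where *: "\<And>n x y. cmod (u n x y) \<le> C * w x y ^ N"
    using assms unfolding grows_def by blast
  have "C * w x y ^ N \<le> max C 1 * w x y ^ N" for x y
    using w[of x y] by (intro mult_right_mono) auto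
  with * have "cmod (u n x y) \<le> max C 1 * w x y ^ N" for n x y by (meson order_trans)
  then show thesis by (intro that[of "max C 1" N]) auto
qed

lemma grows_add:
  assumes "grows w u" "grows w v" and w: "\<And>x y. 1 \<le> w x y"
  shows "grows w (\<lambda>n x y. u n x y + v n x y)"
proof -
  obtain C N where C: "C > 0" "\<And>n x y. cmod (u n x y) \<le> C * w x y ^ N"
    using growsE[OF assms(1) w] by metis
  obtain D M where D: "D > 0" "\<And>n x y. cmod (v n x y) \<le> D * w x y ^ M"
    using growsE[OF assms(2) w] by metis
  have "cmod (u n x y + v n x y) \<le> (C + D) * w x y ^ (N + M)" for n x y
  proof -
    have "cmod (u n x y + v n x y) \<le> C * w x y ^ N + D * w x y ^ M"
      using C(2)[of n x y] D(2)[of n x y] norm_triangle_ineq[of "u n x y" "v n x y"] by linarith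
    also have "\<dots> \<le> C * w x y ^ (N + M) + D * w x y ^ (N + M)"
      using C(1) D(1) w[of x y] by (intro add_mono mult_left_mono power_increasing) auto
    finally show ?thesis by (simp add: algebra_simps)
  qed
  then show ?thesis unfolding grows_def by blast
qed

lemma grows_mult:
  assumes "grows w u" "grows w v" and w: "\<And>x y. 1 \<le> w x y"
  shows "grows w (\<lambda>n x y. u n x y * v n x y)"
proof -
  obtain C N where C: "C > 0" "\<And>n x y. cmod (u n x y) \<le> C * w x y ^ N"
    using growsE[OF assms(1) w] by metis
  obtain D M where D: "D > 0" "\<And>n x y. cmod (v n x y) \<le> D * w x y ^ M"
    using growsE[OF assms(2) w] by metis
  have "cmod (u n x y * v n x y) \<le> (C * w x y ^ N) * (D * w x y ^ M)" for n x y
    unfolding norm_mult using C D w[of x y] by (intro mult_mono) auto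
  then have "cmod (u n x y * v n x y) \<le> (C * D) * w x y ^ (N + M)" for n x y
    by (simp add: algebra_simps power_add)
  then show ?thesis unfolding grows_def by blast
qed

lemma decays_mult:
  assumes "grows w u" "decays w v" and w: "\<And>x y. 1 \<le> w x y"
  shows "decays w (\<lambda>n x y. u n x y * v n x y)"
  unfolding decays_def
proof
  fix K
  obtain C N where C: "C > 0" "\<And>n x y. cmod (u n x y) \<le> C * w x y ^ N"
    using growsE[OF assms(1) w] by metis
  obtain D where D: "D > 0" "\<And>n x y. w x y ^ (K + N) * cmod (v n x y) \<le> D"
    using decaysE[OF assms(2)] by metis
  have "w x y ^ K * cmod (u n x y * v n x y) \<le> C * D" for n x y
  proof -
    have "w x y ^ K * cmod (u n x y * v n x y) \<le> w x y ^ K * (C * w x y ^ N * cmod (v n x y))"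
      unfolding norm_mult using C w[of x y] by (intro mult_left_mono mult_right_mono) auto
    also have "\<dots> = C * (w x y ^ (K + N) * cmod (v n x y))" by (simp add: power_add)
    also have "\<dots> \<le> C * D" using C D by (intro mult_left_mono) auto
    finally show ?thesis .
  qed
  then show "\<exists>C. \<forall>n x y. w x y ^ K * cmod (u n x y * v n x y) \<le> C" by blast
qed

locale weight =
  fixes w :: "real \<Rightarrow> real \<Rightarrow> real"
  assumes weight_ge_1: "1 \<le> w x y"
begin

lemma rapid_add: "rapid w u \<Longrightarrow> rapid w v \<Longrightarrow> rapid w (\<lambda>n x y. u n x y + v n x y)"
  unfolding rapid_def using decays_add[of w] weight_ge_1 smooth_add[of "decays w"] by auto

lemma slow_add: "slow w u \<Longrightarrow> slow w v \<Longrightarrow> slow w (\<lambda>n x y. u n x y + v n x y)"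
  unfolding slow_def using grows_add[of w] weight_ge_1 smooth_add[of "grows w"] by auto

lemma slow_mult: "slow w u \<Longrightarrow> slow w v \<Longrightarrow> slow w (\<lambda>n x y. u n x y * v n x y)"
  unfolding slow_def
  using grows_add[of w] grows_mult[of w] weight_ge_1 smooth_mult[of "grows w" "grows w" "grows w"]
  by auto

lemma rapid_mult_smooth:
  "smooth (grows w) k u \<Longrightarrow> smooth (decays w) k v \<Longrightarrow> smooth (decays w) k (\<lambda>n x y. u n x y * v n x y)"
  using decays_add[of w] decays_mult[of w] weight_ge_1
    smooth_mult[of "grows w" "decays w" "decays w"]
  by auto

lemma rapid_mult: "slow w u \<Longrightarrow> rapid w v \<Longrightarrow> rapid w (\<lambda>n x y. u n x y * v n x y)"
  unfolding rapid_def slow_def using rapid_mult_smooth by auto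

text \<open>
  If the logarithmic derivatives of \<open>u\<close> are slowly growing, a bound on \<open>u\<close> itself is enough: every
  derivative of \<open>u\<close> is again a slowly growing multiple of \<open>u\<close>.
\<close>

lemma slow_log_derivative:
  assumes "slow w p" "slow w q" "grows w u"
    and u: "partials u (\<lambda>n x y. p n x y * u n x y) (\<lambda>n x y. q n x y * u n x y)"
  shows "slow w u"
proof -
  have "smooth (grows w) k u" for k
  proof (induction k)
    case (Suc k)
    have "smooth (grows w) k (\<lambda>n x y. p n x y * u n x y)"
         "smooth (grows w) k (\<lambda>n x y. q n x y * u n x y)"
      using assms(1,2) Suc grows_add[of w] grows_mult[of w] weight_ge_1
      by (auto simp: slow_def intro!: smooth_mult[of "grows w" "grows w" "grows w"])
    then show ?case using u assms(3) by auto
  qed (use assms in simp)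
  then show ?thesis by (simp add: slow_def)
qed

lemma slow_const: "slow w (\<lambda>n x y. c)"
proof -
  have 0: "smooth (grows w) k (\<lambda>n x y. 0)" for k
  proof (induction k)
    case (Suc k)
    have "partials (\<lambda>n x y. 0) (\<lambda>n x y. 0) (\<lambda>n x y. 0)" by (simp add: partials_def)
    then show ?case using Suc by (auto simp: grows_def intro!: exI[of _ 0])
  qed (auto simp: grows_def intro!: exI[of _ 0])
  have "grows w (\<lambda>n x y. c)" unfolding grows_def by (intro exI[of _ 0] exI[of _ "cmod c"]) simp
  moreover have "partials (\<lambda>n x y. c) (\<lambda>n x y. 0) (\<lambda>n x y. 0)" by (simp add: partials_def)
  ultimately have "smooth (grows w) (Suc k) (\<lambda>n x y. c)" for k using 0 by auto
  then show ?thesis unfolding slow_def using smooth_SucD by blast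
qed

lemma rapid_cmult: "rapid w u \<Longrightarrow> rapid w (\<lambda>n x y. c * u n x y)"
  using rapid_mult[OF slow_const] .

lemma rapid_partials:
  assumes "rapid w u"
  obtains ux uy where "partials u ux uy" "rapid w ux" "rapid w uy"
  using smooth_all_partials[of "decays w" u] assms unfolding rapid_def by metis

lemma rapid_decays: "rapid w u \<Longrightarrow> decays w u"
  unfolding rapid_def using smooth_base by blast

lemma rapid_bounded:
  assumes "rapid w u" obtains C where "C > 0" "\<And>n x y. cmod (u n x y) \<le> C"
proof -
  obtain C where "C > 0" "\<And>n x y. w x y ^ 0 * cmod (u n x y) \<le> C"
    using decaysE[OF rapid_decays[OF assms]] by metis
  then show thesis using that by auto
qed

end

lemma vector_derivative_lipschitz:
  fixes f :: "real \<Rightarrow> complex"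
  assumes "\<And>x. (f has_vector_derivative f' x) (at x)" "\<And>x. cmod (f' x) \<le> C"
  shows "cmod (f x - f y) \<le> C * \<bar>x - y\<bar>"
proof -
  have "onorm (\<lambda>h. h *\<^sub>R f' x) \<le> C" for x
    using assms(2)[of x] by (intro onorm_bound) (auto simp: order_trans[OF norm_ge_zero assms(2)[of x]] mult.commute[of C] intro: mult_left_mono)
  then have "norm (f x - f y) \<le> C * norm (x - y)"
    using assms(1)
    by (intro differentiable_bound[of UNIV f "\<lambda>x h. h *\<^sub>R f' x"]) (auto simp: has_vector_derivative_def)
  then show ?thesis by simp
qed

text \<open>Bounded partial derivatives make each function of the sequence Lipschitz in both variables together.\<close>

lemma (in weight) rapid_continuous:
  assumes "rapid w u"
  shows "continuous_on UNIV (\<lambda>p. u n (fst p) (snd p))"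
proof -
  obtain ux uy where p: "partials u ux uy" "rapid w ux" "rapid w uy"
    using rapid_partials[OF assms] .
  obtain C where C: "C > 0" "\<And>n x y. cmod (ux n x y) \<le> C" using rapid_bounded[OF p(2)] by metis
  obtain D where D: "D > 0" "\<And>n x y. cmod (uy n x y) \<le> D" using rapid_bounded[OF p(3)] by metis
  have "cmod (u n x y - u n x' y') \<le> C * \<bar>x - x'\<bar> + D * \<bar>y - y'\<bar>" for x y x' y'
  proof -
    have "cmod (u n x y - u n x' y) \<le> C * \<bar>x - x'\<bar>"
      by (rule vector_derivative_lipschitz[where f="\<lambda>s. u n s y" and f'="\<lambda>s. ux n s y"]) (use p C in \<open>auto simp: partials_def\<close>)
    moreover have "cmod (u n x' y - u n x' y') \<le> D * \<bar>y - y'\<bar>"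
      by (rule vector_derivative_lipschitz[where f="\<lambda>s. u n x' s" and f'="\<lambda>s. uy n x' s"]) (use p D in \<open>auto simp: partials_def\<close>)
    ultimately show ?thesis
      using norm_triangle_ineq[of "u n x y - u n x' y" "u n x' y - u n x' y'"] by simp
  qed
  then have b: "cmod (u n (fst p) (snd p) - u n (fst q) (snd q)) \<le> C * \<bar>fst p - fst q\<bar> + D * \<bar>snd p - snd q\<bar>"
    for p q by blast
  have "((\<lambda>p. u n (fst p) (snd p)) \<longlongrightarrow> u n (fst q) (snd q)) (at q)" for q
  proof (rule Lim_transform2[where f="\<lambda>p. u n (fst q) (snd q)"])
    show "((\<lambda>p. u n (fst q) (snd q) - u n (fst p) (snd p)) \<longlongrightarrow> 0) (at q)"
    proof (rule Lim_null_comparison[where g="\<lambda>p. C * \<bar>fst p - fst q\<bar> + D * \<bar>snd p - snd q\<bar>"])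
      show "((\<lambda>p. C * \<bar>fst p - fst q\<bar> + D * \<bar>snd p - snd q\<bar>) \<longlongrightarrow> 0) (at q)"
        by (auto intro!: tendsto_eq_intros)
    qed (use b[of q] b in \<open>auto simp: norm_minus_commute\<close>)
  qed simp
  then show ?thesis by (simp add: continuous_on_def)
qed

section \<open>Dominated integrals\<close>

text \<open>
  One integrable function dominates both quadratic decay in \<open>l\<close> and, by \<open>inverse_cosh_le_bump\<close>,
  exponential decay in \<open>b\<close>.
\<close>

definition bump :: "real \<Rightarrow> real" where "bump s = 1 / (1 + s\<^sup>2)"

lemma bump_pos: "bump s > 0" by (simp add: bump_def add_pos_nonneg)

lemma bump_integrable: "integrable lborel bump"
proof -
  have "bump = (\<lambda>x. inverse (1 + x\<^sup>2))" by (simp add: bump_def fun_eq_iff inverse_eq_divide)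
  then show ?thesis using integrable_inverse_1_plus_square by (simp add: set_integrable_def)
qed

lemma integrable_bump_bound:
  fixes f :: "real \<Rightarrow> complex"
  assumes "f \<in> borel_measurable borel" "\<And>s. cmod (f s) \<le> C * bump s"
  shows "integrable lborel f"
proof (rule Bochner_Integration.integrable_bound[where f="\<lambda>s. C * bump s"])
  show "integrable lborel (\<lambda>s. C * bump s)" using bump_integrable by simp
qed (use assms in \<open>auto intro!: order_trans[OF assms(2)]\<close>)

lemma integral_bump_bound:
  fixes f :: "real \<Rightarrow> complex"
  assumes "\<And>s. cmod (f s) \<le> C * bump s"
  shows "cmod (LINT s|lborel. f s) \<le> C * (LINT s|lborel. bump s)"
proof -
  have "0 \<le> C * bump 0" using assms[of 0] norm_ge_zero order_trans by blast
  then have "0 \<le> C" using bump_pos[of 0] by (simp add: zero_le_mult_iff)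
  then have "0 \<le> C * (LINT s|lborel. bump s)"
    using bump_pos by (intro mult_nonneg_nonneg integral_nonneg_AE) (auto intro: less_imp_le)
  moreover have "cmod (LINT s|lborel. f s) \<le> (LINT s|lborel. C * bump s)" if "integrable lborel f"
    using that assms bump_integrable by (intro order_trans[OF integral_norm_bound] integral_mono) auto
  ultimately show ?thesis by (cases "integrable lborel f") (auto simp: not_integrable_integral_eq)
qed

text \<open>
  Differentiation under the integral. By the mean value theorem the remainders of the difference quotients are
  dominated by the bound on \<open>g'\<close>, so that they tend to \<open>0\<close> in the mean.
\<close>

lemma has_vector_derivative_integral:
  fixes g :: "real \<Rightarrow> real \<Rightarrow> complex"
  assumes deriv: "\<And>x s. ((\<lambda>x. g x s) has_vector_derivative g' x s) (at x)"
    and meas: "\<And>x. g x \<in> borel_measurable borel" "\<And>x. g' x \<in> borel_measurable borel"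
    and C: "\<And>x s. cmod (g x s) \<le> C * bump s" and D: "\<And>x s. cmod (g' x s) \<le> D * bump s"
  shows "((\<lambda>x. LINT s|lborel. g x s) has_vector_derivative (LINT s|lborel. g' x s)) (at x)"
proof -
  note [measurable] = meas
  have int: "integrable lborel (g x)" "integrable lborel (g' x)" for x
    using integrable_bump_bound[OF meas(1) C] integrable_bump_bound[OF meas(2) D] by auto
  define R where "R y s = (1 / norm (y - x)) *\<^sub>R (g y s - (g x s + (y - x) *\<^sub>R g' x s))" for y s
  have R0: "((\<lambda>y. R y s) \<longlongrightarrow> 0) (at x)" for s
    using deriv[of s x] unfolding R_def has_vector_derivative_def has_derivative_within by auto
  have Rb: "norm (R y s) \<le> 2 * D * bump s" if "y \<noteq> x" for y s
  proof -
    have "norm (g y s - g x s) \<le> D * bump s * \<bar>y - x\<bar>"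
      using vector_derivative_lipschitz[of "\<lambda>x. g x s" "\<lambda>x. g' x s"] deriv D by blast
    moreover have "norm ((y - x) *\<^sub>R g' x s) \<le> D * bump s * \<bar>y - x\<bar>"
      using D[of x s] by (simp add: mult.commute[of "D * bump s"] mult_left_mono)
    ultimately have "norm (g y s - (g x s + (y - x) *\<^sub>R g' x s)) \<le> 2 * D * bump s * \<bar>y - x\<bar>"
      using norm_triangle_ineq4[of "g y s - g x s" "(y - x) *\<^sub>R g' x s"] by (simp add: algebra_simps)
    moreover have "norm (R y s) = norm (g y s - (g x s + (y - x) *\<^sub>R g' x s)) / \<bar>y - x\<bar>"
      unfolding R_def by simp
    ultimately show ?thesis using that by (simp add: pos_divide_le_eq)
  qed
  have [measurable]: "R y \<in> borel_measurable borel" for y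
    unfolding R_def by measurable
  have Rint: "(LINT s|lborel. R y s) = (1 / norm (y - x)) *\<^sub>R
      ((LINT s|lborel. g y s) - ((LINT s|lborel. g x s) + (y - x) *\<^sub>R (LINT s|lborel. g' x s)))" for y
    unfolding R_def using int by simp
  have "((\<lambda>y. LINT s|lborel. R y s) \<longlongrightarrow> 0) (at x)"
    unfolding tendsto_at_iff_sequentially
  proof (intro allI impI)
    fix X :: "nat \<Rightarrow> real"
    assume X: "\<forall>i. X i \<in> UNIV - {x}" "X \<longlonglongrightarrow> x"
    have "(\<lambda>i. LINT s|lborel. R (X i) s) \<longlonglongrightarrow> (LINT s|(lborel :: real measure). 0)"
    proof (rule integral_dominated_convergence[where w="\<lambda>s. 2 * D * bump s" and s="\<lambda>i. R (X i)"])
      show "integrable lborel (\<lambda>s. 2 * D * bump s)" using bump_integrable by simp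
      show "AE s in lborel. (\<lambda>i. R (X i) s) \<longlonglongrightarrow> 0"
        using R0 X unfolding tendsto_at_iff_sequentially by (auto simp: comp_def)
      show "AE s in lborel. norm (R (X i) s) \<le> 2 * D * bump s" for i
        using Rb X by auto
    qed auto
    then show "((\<lambda>y. LINT s|lborel. R y s) \<circ> X) \<longlonglongrightarrow> 0" by (simp add: comp_def)
  qed
  then show ?thesis
    unfolding Rint has_vector_derivative_def has_derivative_within by (simp add: bounded_linear_scaleR_left)
qed

text \<open>The boundary terms vanish; this is the form in which integration by parts is used.\<close>

lemma integral_derivative_eq_0:
  fixes F :: "real \<Rightarrow> complex"
  assumes F: "\<And>s. (F has_vector_derivative f s) (at s)" and f: "\<And>s. isCont f s"
    and C: "\<And>s. cmod (F s) \<le> C * bump s" and D: "\<And>s. cmod (f s) \<le> D * bump s"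
  shows "(LINT s|lborel. f s) = 0"
proof -
  have b: "(bump \<longlongrightarrow> 0) at_top" "(bump \<longlongrightarrow> 0) at_bot"
    unfolding bump_def by real_asymp+
  have lim: "(F \<longlongrightarrow> 0) at_top" "(F \<longlongrightarrow> 0) at_bot"
    using C b by (auto intro!: Lim_null_comparison[where g="\<lambda>s. C * bump s"] tendsto_mult_right_zero)
  have "integrable lborel f"
    using f D by (intro integrable_bump_bound[where C=D] borel_measurable_continuous_onI) (auto simp: continuous_on_eq_continuous_at)
  then have "(LBINT s=-\<infinity>..\<infinity>. f s) = 0 - 0"
    using F f lim
    by (intro interval_integral_FTC_integrable) (auto simp: set_integrable_def ereal_tendsto_simps)
  then show ?thesis by (simp add: interval_integral_to_infinity_eq interval_lebesgue_integral_def set_lebesgue_integral_def)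
qed

section \<open>The two weights\<close>

lemma cosh_add_le: "cosh (x + y) \<le> 2 * cosh x * cosh (y::real)"
proof -
  have "sinh x * sinh y \<le> \<bar>sinh x\<bar> * \<bar>sinh y\<bar>" by (simp flip: abs_mult)
  also have "\<dots> \<le> cosh x * cosh y"
    using sinh_le_cosh_real[of "\<bar>x\<bar>"] sinh_le_cosh_real[of "\<bar>y\<bar>"]
    by (intro mult_mono) auto
  finally show ?thesis by (simp add: cosh_add)
qed

lemma cosh_le_split: "z = x + y \<or> z = x - y \<or> z = y - x \<Longrightarrow> cosh z \<le> 2 * cosh x * cosh (y::real)"
  using cosh_add_le[of x y] cosh_add_le[of x "-y"] cosh_add_le[of "-x" y] by auto

lemma inverse_cosh_le_bump: "1 / cosh (2 * s) \<le> bump s"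
proof -
  have "\<bar>s\<bar> \<le> \<bar>sinh s\<bar>" using real_le_abs_sinh[of s] by (simp add: sinh_def exp_minus abs_mult)
  then have "s\<^sup>2 \<le> (sinh s)\<^sup>2" by (rule abs_le_square_iff[THEN iffD1])
  moreover have "cosh (2 * s) = 1 + 2 * (sinh s)\<^sup>2" by (simp add: cosh_double cosh_square_eq)
  moreover have "0 \<le> (sinh s)\<^sup>2" by simp
  ultimately have "1 + s\<^sup>2 \<le> cosh (2 * s)" by linarith
  then show ?thesis unfolding bump_def by (intro divide_left_mono) (auto intro!: add_pos_nonneg mult_pos_pos)
qed

lemma cosh_le_1_sinh: "cosh x \<le> 1 + \<bar>sinh (x::real)\<bar>"
proof -
  have "(cosh x)\<^sup>2 \<le> (1 + \<bar>sinh x\<bar>)\<^sup>2" by (simp add: cosh_square_eq power2_sum)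
  then show ?thesis by (rule power2_le_imp_le) simp
qed

abbreviation root_cosh :: "real \<Rightarrow> real" where "root_cosh x \<equiv> sqrt (cosh (2 * x))"

lemma root_cosh_le: "root_cosh x \<le> cosh (2 * x)"
proof -
  have "root_cosh x \<le> sqrt ((cosh (2 * x))\<^sup>2)"
    using cosh_real_ge_1[of "2 * x"] by (intro real_sqrt_le_mono self_le_power) auto
  then show ?thesis by simp
qed

text \<open>
  Decay faster than every power of the first weight, for all derivatives, characterises Schwartz
  functions on the orbit. The second weight plays this role after the Fourier transform.
\<close>

definition orbit_weight :: "real \<Rightarrow> real \<Rightarrow> real" where
  "orbit_weight a l = cosh (2 * a) * (1 + l\<^sup>2)"

definition cosh_weight :: "real \<Rightarrow> real \<Rightarrow> real" where
  "cosh_weight a b = cosh (2 * a) * cosh (2 * b)"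

interpretation orbit: weight orbit_weight
  by standard (use mult_mono[OF cosh_real_ge_1, of 1] in \<open>simp add: orbit_weight_def\<close>)

interpretation cosh2: weight cosh_weight
  by standard (use mult_mono[OF cosh_real_ge_1 cosh_real_ge_1] in \<open>simp add: cosh_weight_def\<close>)

lemma decays_product:
  assumes "decays w u" "\<And>x y. w x y = p x * q y" "\<And>x. (1::real) \<le> p x" "\<And>y. (1::real) \<le> q y"
  obtains C where "C > 0" "\<And>n x y. p x ^ N * q y ^ M * cmod (u n x y) \<le> C"
proof -
  obtain C where C: "C > 0" "\<And>n x y. w x y ^ (N + M) * cmod (u n x y) \<le> C"
    using decaysE[OF assms(1)] by metis
  have "p x ^ N * q y ^ M * cmod (u n x y) \<le> C" for n x y
  proof -
    have "p x ^ N * q y ^ M \<le> p x ^ (N + M) * q y ^ (N + M)"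
      using assms(3)[of x] assms(4)[of y] by (intro mult_mono power_increasing) auto
    then have "p x ^ N * q y ^ M * cmod (u n x y) \<le> w x y ^ (N + M) * cmod (u n x y)"
      unfolding assms(2) power_mult_distrib by (intro mult_right_mono) auto
    then show ?thesis using C(2)[of x y n] by linarith
  qed
  then show thesis using that C by blast
qed

lemma orbit_decaysE:
  assumes "rapid orbit_weight f"
  obtains C where "C > 0" "\<And>n a l. cosh (2 * a) ^ N * (1 + l\<^sup>2) ^ M * cmod (f n a l) \<le> C"
  using decays_product[OF orbit.rapid_decays[OF assms], of "\<lambda>a. cosh (2 * a)" "\<lambda>l. 1 + l\<^sup>2" N M]
  by (auto simp: orbit_weight_def cosh_real_ge_1)

lemma cosh_decaysE:
  assumes "rapid cosh_weight f"
  obtains C where "C > 0" "\<And>n a b. cosh (2 * a) ^ N * cosh (2 * b) ^ M * cmod (f n a b) \<le> C"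
  using decays_product[OF cosh2.rapid_decays[OF assms], of "\<lambda>a. cosh (2 * a)" "\<lambda>b. cosh (2 * b)" N M]
  by (auto simp: cosh_weight_def cosh_real_ge_1)

lemma orbit_bump_bound:
  assumes "rapid orbit_weight f"
  obtains C where "C > 0" "\<And>n a l. cosh (2 * a) ^ N * cmod (f n a l) \<le> C * bump l"
proof -
  obtain C where C: "C > 0" "\<And>n a l. cosh (2 * a) ^ N * (1 + l\<^sup>2) ^ 1 * cmod (f n a l) \<le> C"
    using orbit_decaysE[OF assms] by metis
  have "cosh (2 * a) ^ N * cmod (f n a l) \<le> C * bump l" for n a l
    using C(2)[of a l n] by (simp add: bump_def pos_le_divide_eq add_pos_nonneg algebra_simps)
  then show thesis using that C by blast
qed

lemma cosh_bump_bound: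
  assumes "rapid cosh_weight u"
  obtains C where "C > 0" "\<And>n a b. cosh (2 * a) ^ N * cmod (u n a b) \<le> C * bump b"
proof -
  obtain C where C: "C > 0" "\<And>n a b. cosh (2 * a) ^ N * cosh (2 * b) ^ 1 * cmod (u n a b) \<le> C"
    using cosh_decaysE[OF assms] by metis
  have "cosh (2 * a) ^ N * cmod (u n a b) \<le> C * bump b" for n a b
  proof -
    have "cosh (2 * a) ^ N * cmod (u n a b) \<le> C * (1 / cosh (2 * b))"
      using C(2)[of a b n] by (simp add: pos_le_divide_eq algebra_simps)
    also have "\<dots> \<le> C * bump b" using C(1) inverse_cosh_le_bump by (intro mult_left_mono) auto
    finally show ?thesis .
  qed
  then show thesis using that C by blast
qed

section \<open>Slowly growing functions\<close>

lemma (in weight) slowI: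
  assumes "grows w u" "partials u ux uy" "slow w ux" "slow w uy"
  shows "slow w u"
proof -
  have "smooth (grows w) (Suc k) u" for k using assms by (auto simp: slow_def)
  then show ?thesis unfolding slow_def using smooth_SucD by blast
qed

lemma (in weight) grows_boundI:
  assumes "\<And>n x y. cmod (u n x y) \<le> C * w x y ^ N"
  shows "grows w u"
  using assms unfolding grows_def by blast

lemma has_vector_derivative_of_real_compose:
  "(g has_real_derivative g') (at x) \<Longrightarrow>
   ((\<lambda>s. complex_of_real (g s)) has_vector_derivative complex_of_real g') (at x)"
  by (metis has_real_derivative_iff_has_vector_derivative has_vector_derivative_of_real)

lemma slow_orbit_snd: "slow orbit_weight (\<lambda>n a l. complex_of_real l)"
proof (rule orbit.slowI)
  show "partials (\<lambda>n a l. complex_of_real l) (\<lambda>n a l. 0) (\<lambda>n a l. 1)"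
    unfolding partials_def by (auto intro!: has_vector_derivative_of_real_compose[of "\<lambda>s. s" 1, simplified])
  show "grows orbit_weight (\<lambda>n a l. complex_of_real l)"
  proof (rule orbit.grows_boundI[where C=1 and N=1])
    fix n :: nat and a l :: real
    have "0 \<le> (\<bar>l\<bar> - 1)\<^sup>2" by simp
    then have "\<bar>l\<bar> \<le> 1 * (1 + l\<^sup>2)" by (simp add: power2_diff)
    also have "\<dots> \<le> cosh (2 * a) * (1 + l\<^sup>2)" by (intro mult_right_mono cosh_real_ge_1) auto
    finally show "cmod (complex_of_real l) \<le> 1 * orbit_weight a l ^ 1" by (simp add: orbit_weight_def)
  qed
qed (rule orbit.slow_const)+

lemma cosh_weight_ge:
  "cosh (2 * a) \<le> cosh_weight a b" "cosh (2 * b) \<le> cosh_weight a b" "1 \<le> cosh_weight a b"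
  using mult_mono[of 1 "cosh (2 * a)" "cosh (2 * b)" "cosh (2 * b)"]
    mult_mono[of "cosh (2 * a)" "cosh (2 * a)" 1 "cosh (2 * b)"] cosh2.weight_ge_1
  by (auto simp: cosh_weight_def cosh_real_ge_1)

lemma exp_le_cosh: "\<bar>r\<bar> = 1 \<Longrightarrow> exp (2 * r * x) \<le> 2 * cosh (2 * x :: real)"
  by (auto simp: cosh_def abs_if split: if_splits)

lemma slow_snd_log_derivative:
  assumes der: "\<And>b. (g has_real_derivative r b * g b) (at b)"
    and r: "slow cosh_weight (\<lambda>n a b. complex_of_real (r b))"
    and C: "\<And>b. \<bar>g b\<bar> \<le> C * cosh (2 * b) ^ N"
  shows "slow cosh_weight (\<lambda>n a b. complex_of_real (g b))"
proof (rule cosh2.slow_log_derivative[OF cosh2.slow_const r])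
  show "partials (\<lambda>n a b. complex_of_real (g b)) (\<lambda>n a b. 0 * complex_of_real (g b))
      (\<lambda>n a b. complex_of_real (r b) * complex_of_real (g b))"
    using has_vector_derivative_of_real_compose[OF der] by (simp add: partials_def)
  have "0 \<le> C" using C[of 0] by (simp add: order_trans[OF abs_ge_zero])
  then have "C * cosh (2 * b) ^ N \<le> C * cosh_weight a b ^ N" for a b
    using cosh_weight_ge(2)[of b a] by (intro mult_left_mono power_mono) auto
  then show "grows cosh_weight (\<lambda>n a b. complex_of_real (g b))"
    by (intro cosh2.grows_boundI[of _ C N]) (auto intro: order_trans[OF C])
qed

lemma slow_exp:
  assumes "\<bar>r\<bar> = 1"
  shows "slow cosh_weight (\<lambda>n a b. complex_of_real (exp (2 * r * a)))"
    and "slow cosh_weight (\<lambda>n a b. complex_of_real (exp (2 * r * b)))"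
proof -
  have der: "((\<lambda>b. exp (2 * r * b)) has_real_derivative 2 * r * exp (2 * r * b)) (at b)" for b
    by (auto intro!: derivative_eq_intros)
  show "slow cosh_weight (\<lambda>n a b. complex_of_real (exp (2 * r * b)))"
    by (rule slow_snd_log_derivative[OF der cosh2.slow_const, of 2 1]) (use exp_le_cosh[OF assms] in simp)
  show "slow cosh_weight (\<lambda>n a b. complex_of_real (exp (2 * r * a)))"
  proof (rule cosh2.slow_log_derivative)
    show "partials (\<lambda>n a b. complex_of_real (exp (2 * r * a)))
       (\<lambda>n a b. complex_of_real (2 * r) * complex_of_real (exp (2 * r * a)))
       (\<lambda>n a b. 0 * complex_of_real (exp (2 * r * a)))"
      using has_vector_derivative_of_real_compose[OF der] by (simp add: partials_def)
    show "grows cosh_weight (\<lambda>n a b. complex_of_real (exp (2 * r * a)))"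
    proof (rule cosh2.grows_boundI[where C=2 and N=1])
      show "cmod (complex_of_real (exp (2 * r * a))) \<le> 2 * cosh_weight a b ^ 1" for a b
        using exp_le_cosh[OF assms, of a] cosh_weight_ge(1)[of a b] by simp
    qed
  qed (rule cosh2.slow_const)+
qed

lemma slow_cosh: "slow cosh_weight (\<lambda>n a b. complex_of_real (cosh (2 * b)))"
proof -
  have "slow cosh_weight (\<lambda>n a b. (1/2) * (complex_of_real (exp (2 * 1 * b)) + complex_of_real (exp (2 * (-1) * b))))"
    by (intro cosh2.slow_mult cosh2.slow_const cosh2.slow_add slow_exp) auto
  moreover have "(1/2) * (complex_of_real (exp (2 * 1 * b)) + complex_of_real (exp (2 * (-1) * b)))
     = complex_of_real (cosh (2 * b))" for b by (simp add: cosh_def scaleR_conv_of_real)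
  ultimately show ?thesis by simp
qed

lemma slow_sinh: "slow cosh_weight (\<lambda>n a b. complex_of_real (sinh (2 * b)))"
proof -
  have "slow cosh_weight (\<lambda>n a b. (1/2) * (complex_of_real (exp (2 * 1 * b)) + (-1) * complex_of_real (exp (2 * (-1) * b))))"
    by (intro cosh2.slow_mult cosh2.slow_const cosh2.slow_add slow_exp) auto
  moreover have "(1/2) * (complex_of_real (exp (2 * 1 * b)) + (-1) * complex_of_real (exp (2 * (-1) * b)))
     = complex_of_real (sinh (2 * b))" for b by (simp add: sinh_def scaleR_conv_of_real)
  ultimately show ?thesis by simp
qed

text \<open>The derivative of \<open>tanh\<close> is a polynomial in \<open>tanh\<close>, so the order of smoothness propagates by induction.\<close>

lemma slow_tanh: "slow cosh_weight (\<lambda>n a b. complex_of_real (tanh (2 * b)))"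
proof -
  let ?t = "\<lambda>(n::nat) (a::real) b. complex_of_real (tanh (2 * b))"
  have p: "partials ?t (\<lambda>n a b. 0) (\<lambda>n a b. 2 + (- 2) * (?t n a b * ?t n a b))"
  proof -
    have "((\<lambda>b. tanh (2 * b)) has_real_derivative 2 + (-2) * (tanh (2 * b) * tanh (2 * b))) (at b)" for b :: real
      by (auto intro!: derivative_eq_intros simp: power2_eq_square algebra_simps)
    from has_vector_derivative_of_real_compose[OF this] show ?thesis by (simp add: partials_def)
  qed
  have g: "grows cosh_weight ?t"
  proof (rule cosh2.grows_boundI[where C=1 and N=0])
    show "cmod (?t n a b) \<le> 1 * cosh_weight a b ^ 0" for n a b
      using tanh_real_bounds[of "2 * b"] by (simp add: abs_le_iff)
  qed
  have "smooth (grows cosh_weight) k ?t" for k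
  proof (induction k)
    case (Suc k)
    have "smooth (grows cosh_weight) k (\<lambda>n a b. 2 + (- 2) * (?t n a b * ?t n a b))"
      using Suc cosh2.slow_const grows_add[of cosh_weight] grows_mult[of cosh_weight] cosh2.weight_ge_1
      by (intro smooth_add smooth_mult[of "grows cosh_weight" "grows cosh_weight" "grows cosh_weight"])
         (auto simp: slow_def)
    moreover have "smooth (grows cosh_weight) k (\<lambda>n a b. 0)"
      using cosh2.slow_const by (simp add: slow_def)
    ultimately show ?case using g p by auto
  qed (use g in simp)
  then show ?thesis by (simp add: slow_def)
qed

lemma slow_inverse_cosh: "slow cosh_weight (\<lambda>n a b. complex_of_real (1 / (2 * cosh (2 * b))))"
proof (rule slow_snd_log_derivative[where C=1 and N=0])
  show "((\<lambda>b. 1 / (2 * cosh (2 * b))) has_real_derivative (-2 * tanh (2 * b)) * (1 / (2 * cosh (2 * b)))) (at b)" for b :: real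
    by (auto intro!: derivative_eq_intros simp: tanh_def field_simps power2_eq_square)
  show "slow cosh_weight (\<lambda>n a b. complex_of_real (-2 * tanh (2 * b)))"
    unfolding of_real_mult by (intro cosh2.slow_mult cosh2.slow_const slow_tanh)
  show "\<bar>1 / (2 * cosh (2 * b))\<bar> \<le> 1 * cosh (2 * b) ^ 0" for b :: real
    using cosh_real_ge_1[of "2 * b"] by simp
qed

lemma slow_root_cosh: "slow cosh_weight (\<lambda>n a b. complex_of_real (root_cosh b))"
proof (rule slow_snd_log_derivative[OF _ slow_tanh, where C=1 and N=1])
  fix b :: real
  have "((\<lambda>b. cosh (2 * b)) has_real_derivative sinh (2 * b) * 2) (at b)"
    by (auto intro!: derivative_eq_intros)
  from DERIV_chain2[OF DERIV_real_sqrt[OF cosh_real_pos] this]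
  have "(root_cosh has_real_derivative inverse (root_cosh b) / 2 * (sinh (2 * b) * 2)) (at b)" .
  moreover have "inverse (root_cosh b) / 2 * (sinh (2 * b) * 2) = tanh (2 * b) * root_cosh b"
    using real_div_sqrt[of "cosh (2 * b)"] by (simp add: tanh_def divide_simps)
  ultimately show "(root_cosh has_real_derivative tanh (2 * b) * root_cosh b) (at b)" by simp
  show "\<bar>root_cosh b\<bar> \<le> 1 * cosh (2 * b) ^ 1" using root_cosh_le[of b] by simp
qed

section \<open>Partial Fourier transforms\<close>

lemma has_vector_derivative_cis:
  "(g has_real_derivative g') (at x) \<Longrightarrow>
   ((\<lambda>s. cis (g s)) has_vector_derivative \<i> * complex_of_real g' * cis (g x)) (at x)"
  unfolding has_vector_derivative_def has_field_derivative_def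
  by (auto intro!: derivative_eq_intros simp: scaleR_conv_of_real algebra_simps)

context weight
begin

lemma rapid_continuous_slice:
  assumes "rapid w u" "continuous_on UNIV f" "continuous_on UNIV g"
  shows "continuous_on UNIV (\<lambda>s. u n (f s) (g s))"
  using continuous_on_compose2[OF rapid_continuous[OF assms(1), of n], of UNIV "\<lambda>s. (f s, g s)"] assms(2,3)
  by (auto intro: continuous_intros)

end

text \<open>
  For the transforms below, multiplication of \<open>T u\<close> by the variable dual to the integration variable is, by
  integration by parts, \<open>T v\<close> for another \<open>v\<close> of the same kind. A bound that holds for all \<open>u\<close> thus
  improves by one power at a time. The exponent \<open>2\<close> in the comparison with \<open>w\<close> is needed for
  \<open>1 + l\<^sup>2\<close>, which is bounded by the square of \<open>1 + \<bar>l\<bar>\<close>.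
\<close>

lemma decay_bootstrap:
  fixes T :: "fun_family \<Rightarrow> fun_family" and p q :: "real \<Rightarrow> real"
  assumes base: "\<And>u N. X u \<Longrightarrow> \<exists>C. \<forall>n x y. p x ^ N * cmod (T u n x y) \<le> C"
    and step: "\<And>u. X u \<Longrightarrow> \<exists>v D. X v \<and> 0 \<le> D \<and> (\<forall>n x y. q y * cmod (T u n x y) \<le> D * cmod (T v n x y))"
    and p: "\<And>x. 0 \<le> p x" and q: "\<And>y. 0 \<le> q y"
    and w: "\<And>x y. 0 \<le> w x y" "\<And>x y. w x y \<le> p x * (1 + q y)\<^sup>2"
    and "X u"
  shows "decays w (T u)"
proof -
  have *: "X u \<Longrightarrow> \<exists>C. \<forall>n x y. p x ^ N * (1 + q y) ^ M * cmod (T u n x y) \<le> C" for N M u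
  proof (induction M arbitrary: u)
    case 0
    then show ?case using base by simp
  next
    case (Suc M)
    obtain v D where v: "X v" "0 \<le> D" "\<And>n x y. q y * cmod (T u n x y) \<le> D * cmod (T v n x y)"
      using step[OF Suc.prems] by blast
    obtain A where A: "\<And>n x y. p x ^ N * (1 + q y) ^ M * cmod (T u n x y) \<le> A"
      using Suc by blast
    obtain B where B: "\<And>n x y. p x ^ N * (1 + q y) ^ M * cmod (T v n x y) \<le> B"
      using Suc.IH[OF v(1)] by blast
    have "p x ^ N * (1 + q y) ^ Suc M * cmod (T u n x y) \<le> A + D * B" for n x y
    proof -
      have 0: "0 \<le> p x ^ N * (1 + q y) ^ M" using p q by simp
      have "p x ^ N * (1 + q y) ^ Suc M * cmod (T u n x y) =
          p x ^ N * (1 + q y) ^ M * (cmod (T u n x y) + q y * cmod (T u n x y))"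
        by (simp add: algebra_simps)
      also have "\<dots> \<le> p x ^ N * (1 + q y) ^ M * (cmod (T u n x y) + D * cmod (T v n x y))"
        using v(3) 0 by (intro mult_left_mono add_left_mono) auto
      also have "\<dots> = p x ^ N * (1 + q y) ^ M * cmod (T u n x y) + D * (p x ^ N * (1 + q y) ^ M * cmod (T v n x y))"
        by (simp add: algebra_simps)
      also have "\<dots> \<le> A + D * B" using A B v(2) by (intro add_mono mult_left_mono) auto
      finally show ?thesis .
    qed
    then show ?case by blast
  qed
  show ?thesis unfolding decays_def
  proof
    fix N
    obtain C where C: "\<And>n x y. p x ^ N * (1 + q y) ^ (2 * N) * cmod (T u n x y) \<le> C"
      using *[OF \<open>X u\<close>] by blast
    have "w x y ^ N * cmod (T u n x y) \<le> C" for n x y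
    proof -
      have "w x y ^ N \<le> (p x * (1 + q y)\<^sup>2) ^ N" using w by (intro power_mono) auto
      then have "w x y ^ N * cmod (T u n x y) \<le> p x ^ N * (1 + q y) ^ (2 * N) * cmod (T u n x y)"
        by (intro mult_right_mono) (auto simp: power_mult_distrib power_mult)
      then show ?thesis using C[of x y n] by linarith
    qed
    then show "\<exists>C. \<forall>n x y. w x y ^ N * cmod (T u n x y) \<le> C" by blast
  qed
qed

abbreviation wave :: "real \<Rightarrow> real \<Rightarrow> real \<Rightarrow> complex" where
  "wave c b l \<equiv> cis (c * sinh (2 * b) * l)"

text \<open>
  The Fourier transform along the fibres and its transpose. The star product evaluates the transforms of its
  factors at frequencies \<open>c sinh (2 (a2 - a))\<close>; written as \<open>c sinh (2 b)\<close>, these are differences of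
  coordinates, and polynomial decay in the frequency is exponential decay in \<open>b\<close>.
\<close>

definition fiber_fourier :: "real \<Rightarrow> fun_family \<Rightarrow> fun_family" where
  "fiber_fourier c f = (\<lambda>n a b. LINT l|lborel. wave c b l * f n a l)"

definition fiber_synthesis :: "real \<Rightarrow> fun_family \<Rightarrow> fun_family" where
  "fiber_synthesis c u = (\<lambda>n a l. LINT b|lborel. wave c b l * u n a b)"

lemma orbit_measurable:
  assumes "rapid orbit_weight f"
  shows "(\<lambda>l. cis (k * l) * f n a l) \<in> borel_measurable borel"
  by (intro borel_measurable_continuous_onI continuous_intros orbit.rapid_continuous_slice[OF assms])

lemma cosh_measurable:
  assumes "rapid cosh_weight u"
  shows "(\<lambda>b. wave c b l * u n a b) \<in> borel_measurable borel"
  by (intro borel_measurable_continuous_onI continuous_intros cosh2.rapid_continuous_slice[OF assms])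

lemma orbit_bump_bound0:
  assumes "rapid orbit_weight f"
  obtains C where "C > 0" "\<And>n a l. cmod (f n a l) \<le> C * bump l"
  using orbit_bump_bound[OF assms, of 0] by auto

lemma cosh_bump_bound0:
  assumes "rapid cosh_weight f"
  obtains C where "C > 0" "\<And>n a l. cmod (f n a l) \<le> C * bump l"
  using cosh_bump_bound[OF assms, of 0] by auto

lemma orbit_integrable:
  assumes "rapid orbit_weight f"
  shows "integrable lborel (\<lambda>l. cis (k * l) * f n a l)"
proof -
  obtain C where "\<And>n a l. cmod (f n a l) \<le> C * bump l" using orbit_bump_bound0[OF assms] by metis
  then show ?thesis
    by (intro integrable_bump_bound[where C=C] orbit_measurable[OF assms]) (auto simp: norm_mult)
qed

lemma cosh_integrable:
  assumes "rapid cosh_weight u"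
  shows "integrable lborel (\<lambda>b. wave c b l * u n a b)"
proof -
  obtain C where "\<And>n a l. cmod (u n a l) \<le> C * bump l" using cosh_bump_bound0[OF assms] by metis
  then show ?thesis
    by (intro integrable_bump_bound[where C=C] cosh_measurable[OF assms]) (auto simp: norm_mult)
qed

lemma integral_mult_linear:
  fixes f g e :: "real \<Rightarrow> complex"
  assumes "integrable lborel (\<lambda>x. e x * f x)" "integrable lborel (\<lambda>x. e x * g x)"
  shows "(LINT x|lborel. e x * (f x + k * g x)) = (LINT x|lborel. e x * f x) + k * (LINT x|lborel. e x * g x)"
proof -
  have "(\<lambda>x. e x * (f x + k * g x)) = (\<lambda>x. e x * f x + k * (e x * g x))" by (simp add: algebra_simps)
  then show ?thesis using assms by simp
qed

lemma fiber_fourier_add: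
  assumes "rapid orbit_weight f" "rapid orbit_weight g"
  shows "fiber_fourier c (\<lambda>n a l. f n a l + k * g n a l) =
    (\<lambda>n a b. fiber_fourier c f n a b + k * fiber_fourier c g n a b)"
  unfolding fiber_fourier_def by (intro ext integral_mult_linear orbit_integrable assms)

lemma fiber_synthesis_add:
  assumes "rapid cosh_weight f" "rapid cosh_weight g"
  shows "fiber_synthesis c (\<lambda>n a l. f n a l + k * g n a l) =
    (\<lambda>n a b. fiber_synthesis c f n a b + k * fiber_synthesis c g n a b)"
  unfolding fiber_synthesis_def by (intro ext integral_mult_linear cosh_integrable assms)

text \<open>
  The derivative in \<open>b\<close> is taken first with respect to the frequency and then by the chain rule, whose
  factor \<open>cosh (2 b)\<close> is unbounded but slowly growing.
\<close>

lemma partials_fiber_fourier: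
  assumes f: "rapid orbit_weight f" and p: "partials f fa fl" "rapid orbit_weight fa"
  shows "partials (fiber_fourier c f) (fiber_fourier c fa)
     (\<lambda>n a b. (\<i> * (2 * c) * complex_of_real (cosh (2 * b))) * fiber_fourier c (\<lambda>n a l. complex_of_real l * f n a l) n a b)"
proof -
  have lf: "rapid orbit_weight (\<lambda>n a l. complex_of_real l * f n a l)"
    by (rule orbit.rapid_mult[OF slow_orbit_snd f])
  obtain C where C: "\<And>n a l. cmod (f n a l) \<le> C * bump l" using orbit_bump_bound0[OF f] by metis
  obtain D where D: "\<And>n a l. cmod (fa n a l) \<le> D * bump l" using orbit_bump_bound0[OF p(2)] by metis
  obtain B where B: "\<And>n a l. cmod (complex_of_real l * f n a l) \<le> B * bump l" using orbit_bump_bound0[OF lf] by metis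
  have 1: "((\<lambda>s. fiber_fourier c f n s b) has_vector_derivative fiber_fourier c fa n a b) (at a)" for n a b
    unfolding fiber_fourier_def
    by (rule has_vector_derivative_integral[where C=C and D=D])
       (use p C D in \<open>auto simp: partials_def norm_mult intro!: has_vector_derivative_mult_right
           orbit_measurable[OF f] orbit_measurable[OF p(2)]\<close>)
  have 2: "((\<lambda>x. LINT l|lborel. cis (x * l) * f n a l) has_vector_derivative
     (LINT l|lborel. cis (x * l) * (\<i> * (complex_of_real l * f n a l)))) (at x)" for n a x
  proof (rule has_vector_derivative_integral[where C=C and D=B])
    fix x l
    have "((\<lambda>x. cis (x * l)) has_vector_derivative \<i> * complex_of_real l * cis (x * l)) (at x)"
      by (rule has_vector_derivative_cis) (auto intro!: derivative_eq_intros)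
    from has_vector_derivative_mult_left[OF this, of "f n a l"]
    show "((\<lambda>x. cis (x * l) * f n a l) has_vector_derivative cis (x * l) * (\<i> * (complex_of_real l * f n a l))) (at x)"
      by (simp add: mult_ac)
    show "cmod (cis (x * l) * f n a l) \<le> C * bump l" using C by (simp add: norm_mult)
    show "cmod (cis (x * l) * (\<i> * (complex_of_real l * f n a l))) \<le> B * bump l"
      using B[of l n a] by (simp add: norm_mult)
    show "(\<lambda>l. cis (x * l) * f n a l) \<in> borel_measurable borel" by (rule orbit_measurable[OF f])
    show "(\<lambda>l. cis (x * l) * (\<i> * (complex_of_real l * f n a l))) \<in> borel_measurable borel"
      using orbit_measurable[OF orbit.rapid_cmult[OF lf]] .
  qed
  have 3: "((\<lambda>b. fiber_fourier c f n a b) has_vector_derivative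
     (\<i> * (2 * c) * complex_of_real (cosh (2 * b))) * fiber_fourier c (\<lambda>n a l. complex_of_real l * f n a l) n a b) (at b)" for n a b
  proof -
    have "((\<lambda>b. c * sinh (2 * b)) has_vector_derivative (c * (cosh (2 * b) * 2))) (at b)"
      by (auto intro!: derivative_eq_intros simp flip: has_real_derivative_iff_has_vector_derivative)
    from vector_diff_chain_at[OF this 2[of n a "c * sinh (2 * b)"]]
    have "((\<lambda>b. fiber_fourier c f n a b) has_vector_derivative
       (c * (cosh (2 * b) * 2)) *\<^sub>R (LINT l|lborel. wave c b l * (\<i> * (complex_of_real l * f n a l)))) (at b)"
      by (simp add: comp_def fiber_fourier_def)
    moreover have "(LINT l|lborel. wave c b l * (\<i> * (complex_of_real l * f n a l)))
       = \<i> * fiber_fourier c (\<lambda>n a l. complex_of_real l * f n a l) n a b"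
      unfolding fiber_fourier_def by (subst integral_mult_right_zero[symmetric]) (simp add: mult_ac)
    ultimately show ?thesis by (simp add: scaleR_conv_of_real mult_ac)
  qed
  show ?thesis using 1 3 by (simp add: partials_def)
qed

lemma fiber_fourier_parts:
  assumes f: "rapid orbit_weight f" and p: "partials f fa fl" "rapid orbit_weight fl"
  shows "complex_of_real (c * sinh (2 * b)) * fiber_fourier c f n a b = \<i> * fiber_fourier c fl n a b"
proof -
  let ?k = "c * sinh (2 * b)"
  obtain C where C: "\<And>n a l. cmod (f n a l) \<le> C * bump l" using orbit_bump_bound0[OF f] by metis
  obtain D where D: "\<And>n a l. cmod (fl n a l) \<le> D * bump l" using orbit_bump_bound0[OF p(2)] by metis
  have "(LINT l|lborel. cis (?k * l) * fl n a l + (\<i> * ?k) * (cis (?k * l) * f n a l)) = 0"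
  proof (rule integral_derivative_eq_0[where C=C and D="D + \<bar>?k\<bar> * C"])
    fix l
    have "((\<lambda>l. cis (?k * l)) has_vector_derivative \<i> * complex_of_real ?k * cis (?k * l)) (at l)"
      by (rule has_vector_derivative_cis) (auto intro!: derivative_eq_intros)
    from has_vector_derivative_mult[OF this, of "f n a" "fl n a l"] p
    show "((\<lambda>l. cis (?k * l) * f n a l) has_vector_derivative
        cis (?k * l) * fl n a l + (\<i> * ?k) * (cis (?k * l) * f n a l)) (at l)"
      by (simp add: partials_def mult_ac)
    show "cmod (cis (?k * l) * f n a l) \<le> C * bump l" using C by (simp add: norm_mult)
    have "cmod (cis (?k * l) * fl n a l + (\<i> * ?k) * (cis (?k * l) * f n a l)) \<le> cmod (fl n a l) + \<bar>?k\<bar> * cmod (f n a l)"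
      by (rule order_trans[OF norm_triangle_ineq]) (simp add: norm_mult abs_mult)
    also have "\<dots> \<le> D * bump l + \<bar>?k\<bar> * (C * bump l)" using C D by (intro add_mono mult_left_mono) auto
    finally show "cmod (cis (?k * l) * fl n a l + (\<i> * ?k) * (cis (?k * l) * f n a l)) \<le> (D + \<bar>?k\<bar> * C) * bump l"
      by (simp add: algebra_simps)
    have "continuous_on UNIV (\<lambda>l. cis (?k * l) * fl n a l + (\<i> * ?k) * (cis (?k * l) * f n a l))"
      by (intro continuous_intros orbit.rapid_continuous_slice[OF f] orbit.rapid_continuous_slice[OF p(2)])
    then show "isCont (\<lambda>l. cis (?k * l) * fl n a l + (\<i> * ?k) * (cis (?k * l) * f n a l)) l"
      by (simp add: continuous_on_eq_continuous_at)
  qed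
  then have "fiber_fourier c fl n a b + (\<i> * ?k) * fiber_fourier c f n a b = 0"
    unfolding fiber_fourier_def using orbit_integrable[OF f] orbit_integrable[OF p(2)] by simp
  then have "fiber_fourier c fl n a b = - (\<i> * (?k * fiber_fourier c f n a b))"
    by (simp add: eq_neg_iff_add_eq_0 mult.assoc)
  then show ?thesis by simp
qed

lemma decays_fiber_fourier:
  assumes "c \<noteq> 0" "rapid orbit_weight f"
  shows "decays cosh_weight (fiber_fourier c f)"
proof (rule decay_bootstrap[where T="fiber_fourier c" and X="rapid orbit_weight" and p="\<lambda>a. cosh (2 * a)" and q="\<lambda>b. \<bar>sinh (2 * b)\<bar>"])
  fix f N assume f: "rapid orbit_weight f"
  obtain C where C: "\<And>n a l. cosh (2 * a) ^ N * cmod (f n a l) \<le> C * bump l"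
    using orbit_bump_bound[OF f] by metis
  have "cosh (2 * a) ^ N * cmod (fiber_fourier c f n a b) \<le> C * (LINT s|lborel. bump s)" for n a b
  proof -
    have "cmod (fiber_fourier c f n a b) \<le> (C / cosh (2 * a) ^ N) * (LINT s|lborel. bump s)"
      unfolding fiber_fourier_def
      by (rule integral_bump_bound) (use C in \<open>simp add: norm_mult pos_le_divide_eq mult_ac\<close>)
    then show ?thesis by (simp add: pos_le_divide_eq mult_ac)
  qed
  then show "\<exists>C. \<forall>n a b. cosh (2 * a) ^ N * cmod (fiber_fourier c f n a b) \<le> C" by blast
next
  fix f assume f: "rapid orbit_weight f"
  obtain fa fl where p: "partials f fa fl" "rapid orbit_weight fa" "rapid orbit_weight fl"
    using orbit.rapid_partials[OF f] .
  have "\<bar>sinh (2 * b)\<bar> * cmod (fiber_fourier c f n a b) \<le> 1 / \<bar>c\<bar> * cmod (fiber_fourier c fl n a b)" for n a b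
    using arg_cong[OF fiber_fourier_parts[OF f p(1,3), of c b n a], of cmod] \<open>c \<noteq> 0\<close>
    by (simp add: norm_mult field_simps)
  then show "\<exists>v D. rapid orbit_weight v \<and> 0 \<le> D \<and>
     (\<forall>n a b. \<bar>sinh (2 * b)\<bar> * cmod (fiber_fourier c f n a b) \<le> D * cmod (fiber_fourier c v n a b))"
    using p(3) by (intro exI[of _ fl] exI[of _ "1 / \<bar>c\<bar>"]) auto
next
  fix a b :: real
  have "cosh (2 * b) \<le> 1 + \<bar>sinh (2 * b)\<bar>" by (rule cosh_le_1_sinh)
  also have "\<dots> \<le> (1 + \<bar>sinh (2 * b)\<bar>)\<^sup>2" by (intro self_le_power) auto
  finally show "cosh_weight a b \<le> cosh (2 * a) * (1 + \<bar>sinh (2 * b)\<bar>)\<^sup>2"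
    unfolding cosh_weight_def by (intro mult_left_mono) auto
  show "0 \<le> cosh_weight a b" using cosh_weight_ge(3)[of a b] by linarith
qed (use assms in auto)

text \<open>
  The derivatives of a transform are transforms of other rapidly decaying sequences, times slowly growing factors; the
  induction on the order of smoothness therefore runs over all \<open>f\<close> at once.
\<close>

proposition rapid_fiber_fourier:
  assumes "c \<noteq> 0" "rapid orbit_weight f"
  shows "rapid cosh_weight (fiber_fourier c f)"
proof -
  have "rapid orbit_weight f \<Longrightarrow> smooth (decays cosh_weight) k (fiber_fourier c f)" for k f
  proof (induction k arbitrary: f)
    case 0
    then show ?case using decays_fiber_fourier[OF \<open>c \<noteq> 0\<close>] by simp
  next
    case (Suc k)
    obtain fa fl where p: "partials f fa fl" "rapid orbit_weight fa" "rapid orbit_weight fl"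
      using orbit.rapid_partials[OF Suc.prems] .
    have "slow cosh_weight (\<lambda>n a b. \<i> * (2 * c) * complex_of_real (cosh (2 * b)))"
      by (intro cosh2.slow_mult cosh2.slow_const slow_cosh)
    then have "smooth (decays cosh_weight) k (\<lambda>n a b. (\<i> * (2 * c) * complex_of_real (cosh (2 * b))) *
        fiber_fourier c (\<lambda>n a l. complex_of_real l * f n a l) n a b)"
      using Suc.IH[OF orbit.rapid_mult[OF slow_orbit_snd Suc.prems]]
      by (intro cosh2.rapid_mult_smooth) (auto simp: slow_def)
    then show ?case
      using partials_fiber_fourier[OF Suc.prems p(1,2), of c] Suc.IH[OF p(2)]
        decays_fiber_fourier[OF \<open>c \<noteq> 0\<close> Suc.prems] by auto
  qed
  then show ?thesis using assms(2) by (simp add: rapid_def)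
qed

lemma partials_fiber_synthesis:
  assumes u: "rapid cosh_weight u" and p: "partials u ua ub" "rapid cosh_weight ua"
  shows "partials (fiber_synthesis c u) (fiber_synthesis c ua)
     (fiber_synthesis c (\<lambda>n a b. (\<i> * c * complex_of_real (sinh (2 * b))) * u n a b))"
proof -
  have su: "rapid cosh_weight (\<lambda>n a b. (\<i> * c * complex_of_real (sinh (2 * b))) * u n a b)"
    by (intro cosh2.rapid_mult u cosh2.slow_mult cosh2.slow_const slow_sinh)
  obtain C where C: "\<And>n a l. cmod (u n a l) \<le> C * bump l" using cosh_bump_bound0[OF u] by metis
  obtain D where D: "\<And>n a l. cmod (ua n a l) \<le> D * bump l" using cosh_bump_bound0[OF p(2)] by metis
  obtain B where B: "\<And>n a b. cmod ((\<i> * c * complex_of_real (sinh (2 * b))) * u n a b) \<le> B * bump b"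
    using cosh_bump_bound0[OF su] by metis
  have 1: "((\<lambda>s. fiber_synthesis c u n s l) has_vector_derivative fiber_synthesis c ua n a l) (at a)" for n a l
    unfolding fiber_synthesis_def
    by (rule has_vector_derivative_integral[where C=C and D=D])
       (use p C D in \<open>auto simp: partials_def norm_mult intro!: has_vector_derivative_mult_right
           cosh_measurable[OF u] cosh_measurable[OF p(2)]\<close>)
  have 2: "((\<lambda>l. fiber_synthesis c u n a l) has_vector_derivative
     fiber_synthesis c (\<lambda>n a b. (\<i> * c * complex_of_real (sinh (2 * b))) * u n a b) n a l) (at l)" for n a l
    unfolding fiber_synthesis_def
  proof (rule has_vector_derivative_integral[where C=C and D=B])
    fix l b
    have "((\<lambda>l. wave c b l) has_vector_derivative
        \<i> * complex_of_real (c * sinh (2 * b)) * wave c b l) (at l)"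
      by (rule has_vector_derivative_cis) (auto intro!: derivative_eq_intros)
    from has_vector_derivative_mult_left[OF this, of "u n a b"]
    show "((\<lambda>l. wave c b l * u n a b) has_vector_derivative
        wave c b l * ((\<i> * c * complex_of_real (sinh (2 * b))) * u n a b)) (at l)"
      by (simp add: mult_ac)
    show "cmod (wave c b l * u n a b) \<le> C * bump b" using C by (simp add: norm_mult)
    show "cmod (wave c b l * ((\<i> * c * complex_of_real (sinh (2 * b))) * u n a b)) \<le> B * bump b"
      using B[of b n a] by (simp add: norm_mult)
    show "(\<lambda>b. wave c b l * u n a b) \<in> borel_measurable borel" by (rule cosh_measurable[OF u])
    show "(\<lambda>b. wave c b l * ((\<i> * c * complex_of_real (sinh (2 * b))) * u n a b)) \<in> borel_measurable borel"
      by (rule cosh_measurable[OF su])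
  qed
  show ?thesis using 1 2 by (simp add: partials_def)
qed

text \<open>
  The phase has derivative \<open>2 c l cosh (2 b)\<close> in \<open>b\<close>, so a power of \<open>l\<close> is gained at the price of
  dividing \<open>u\<close> by \<open>2 cosh (2 b)\<close>.
\<close>

lemma fiber_synthesis_parts:
  assumes v: "rapid cosh_weight v" and p: "partials v va vb" "rapid cosh_weight vb"
    and u: "u = (\<lambda>n a b. complex_of_real (2 * cosh (2 * b)) * v n a b)" "rapid cosh_weight u"
  shows "complex_of_real (c * l) * fiber_synthesis c u n a l = \<i> * fiber_synthesis c vb n a l"
proof -
  let ?e = "\<lambda>b. wave c b l"
  obtain C where C: "\<And>n a l. cmod (v n a l) \<le> C * bump l" using cosh_bump_bound0[OF v] by metis
  obtain D where D: "\<And>n a l. cmod (vb n a l) \<le> D * bump l" using cosh_bump_bound0[OF p(2)] by metis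
  obtain B where B: "\<And>n a l. cmod (u n a l) \<le> B * bump l" using cosh_bump_bound0[OF u(2)] by metis
  have "(LINT b|lborel. ?e b * vb n a b + (\<i> * (c * l)) * (?e b * u n a b)) = 0"
  proof (rule integral_derivative_eq_0[where C=C and D="D + \<bar>c * l\<bar> * B"])
    fix b
    have "(?e has_vector_derivative \<i> * complex_of_real (2 * c * cosh (2 * b) * l) * ?e b) (at b)"
      by (rule has_vector_derivative_cis) (auto intro!: derivative_eq_intros)
    from has_vector_derivative_mult[OF this, of "v n a" "vb n a b"] p
    show "((\<lambda>b. ?e b * v n a b) has_vector_derivative
        ?e b * vb n a b + (\<i> * (c * l)) * (?e b * u n a b)) (at b)"
      by (simp add: partials_def mult_ac u)
    show "cmod (?e b * v n a b) \<le> C * bump b" using C by (simp add: norm_mult)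
    have "cmod (?e b * vb n a b + (\<i> * (c * l)) * (?e b * u n a b)) \<le> cmod (vb n a b) + \<bar>c * l\<bar> * cmod (u n a b)"
      by (rule order_trans[OF norm_triangle_ineq]) (simp add: norm_mult abs_mult)
    also have "\<dots> \<le> D * bump b + \<bar>c * l\<bar> * (B * bump b)" using B D by (intro add_mono mult_left_mono) auto
    finally show "cmod (?e b * vb n a b + (\<i> * (c * l)) * (?e b * u n a b)) \<le> (D + \<bar>c * l\<bar> * B) * bump b"
      by (simp add: algebra_simps)
    have "continuous_on UNIV (\<lambda>b. ?e b * vb n a b + (\<i> * (c * l)) * (?e b * u n a b))"
      by (intro continuous_intros cosh2.rapid_continuous_slice[OF u(2)] cosh2.rapid_continuous_slice[OF p(2)])
    then show "isCont (\<lambda>b. ?e b * vb n a b + (\<i> * (c * l)) * (?e b * u n a b)) b"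
      by (simp add: continuous_on_eq_continuous_at)
  qed
  then have "fiber_synthesis c vb n a l + (\<i> * (c * l)) * fiber_synthesis c u n a l = 0"
    unfolding fiber_synthesis_def using cosh_integrable[OF u(2)] cosh_integrable[OF p(2)] by simp
  then have "fiber_synthesis c vb n a l = - (\<i> * (complex_of_real (c * l) * fiber_synthesis c u n a l))"
    by (simp add: eq_neg_iff_add_eq_0 mult.assoc)
  then show ?thesis by simp
qed

lemma decays_fiber_synthesis:
  assumes "c \<noteq> 0" "rapid cosh_weight u"
  shows "decays orbit_weight (fiber_synthesis c u)"
proof (rule decay_bootstrap[where T="fiber_synthesis c" and X="rapid cosh_weight" and p="\<lambda>a. cosh (2 * a)" and q="\<lambda>l. \<bar>l\<bar>"])
  fix u N assume u: "rapid cosh_weight u"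
  obtain C where C: "\<And>n a l. cosh (2 * a) ^ N * cmod (u n a l) \<le> C * bump l"
    using cosh_bump_bound[OF u] by metis
  have "cosh (2 * a) ^ N * cmod (fiber_synthesis c u n a b) \<le> C * (LINT s|lborel. bump s)" for n a b
  proof -
    have "cmod (fiber_synthesis c u n a b) \<le> (C / cosh (2 * a) ^ N) * (LINT s|lborel. bump s)"
      unfolding fiber_synthesis_def
      by (rule integral_bump_bound) (use C in \<open>simp add: norm_mult pos_le_divide_eq mult_ac\<close>)
    then show ?thesis by (simp add: pos_le_divide_eq mult_ac)
  qed
  then show "\<exists>C. \<forall>n a b. cosh (2 * a) ^ N * cmod (fiber_synthesis c u n a b) \<le> C" by blast
next
  fix u assume u: "rapid cosh_weight u"
  define v where "v = (\<lambda>n a b. complex_of_real (1 / (2 * cosh (2 * b))) * u n a b)"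
  have v: "rapid cosh_weight v" unfolding v_def by (rule cosh2.rapid_mult[OF slow_inverse_cosh u])
  have uv: "u = (\<lambda>n a b. complex_of_real (2 * cosh (2 * b)) * v n a b)"
    by (simp add: v_def fun_eq_iff)
  obtain va vb where p: "partials v va vb" "rapid cosh_weight va" "rapid cosh_weight vb"
    using cosh2.rapid_partials[OF v] .
  have "\<bar>l\<bar> * cmod (fiber_synthesis c u n a l) \<le> 1 / \<bar>c\<bar> * cmod (fiber_synthesis c vb n a l)" for n a l
    using arg_cong[OF fiber_synthesis_parts[OF v p(1,3) uv u, of c l n a], of cmod] \<open>c \<noteq> 0\<close>
    by (simp add: norm_mult field_simps)
  then show "\<exists>v D. rapid cosh_weight v \<and> 0 \<le> D \<and>
     (\<forall>n a l. \<bar>l\<bar> * cmod (fiber_synthesis c u n a l) \<le> D * cmod (fiber_synthesis c v n a l))"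
    using p(3) by (intro exI[of _ vb] exI[of _ "1 / \<bar>c\<bar>"]) auto
next
  fix a l :: real
  have "1 + l\<^sup>2 \<le> (1 + \<bar>l\<bar>)\<^sup>2" by (simp add: power2_sum)
  then show "orbit_weight a l \<le> cosh (2 * a) * (1 + \<bar>l\<bar>)\<^sup>2"
    unfolding orbit_weight_def by (intro mult_left_mono) auto
  show "0 \<le> orbit_weight a l" using orbit.weight_ge_1[of a l] by linarith
qed (use assms in auto)

proposition rapid_fiber_synthesis:
  assumes "c \<noteq> 0" "rapid cosh_weight u"
  shows "rapid orbit_weight (fiber_synthesis c u)"
proof -
  have "rapid cosh_weight u \<Longrightarrow> smooth (decays orbit_weight) k (fiber_synthesis c u)" for k u
  proof (induction k arbitrary: u)
    case 0
    then show ?case using decays_fiber_synthesis[OF \<open>c \<noteq> 0\<close>] by simp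
  next
    case (Suc k)
    obtain ua ub where p: "partials u ua ub" "rapid cosh_weight ua" "rapid cosh_weight ub"
      using cosh2.rapid_partials[OF Suc.prems] .
    have "rapid cosh_weight (\<lambda>n a b. (\<i> * c * complex_of_real (sinh (2 * b))) * u n a b)"
      by (intro cosh2.rapid_mult Suc.prems cosh2.slow_mult cosh2.slow_const slow_sinh)
    from Suc.IH[OF this] show ?case
      using partials_fiber_synthesis[OF Suc.prems p(1,2), of c] Suc.IH[OF p(2)]
        decays_fiber_synthesis[OF \<open>c \<noteq> 0\<close> Suc.prems] by auto
  qed
  then show ?thesis using assms(2) by (simp add: rapid_def)
qed

section \<open>The twisted convolution\<close>

text \<open>The star product in the variables \<open>(a, b)\<close>, up to the factor \<open>sqrt (cosh (2 b))\<close> and a constant.\<close>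

definition twisted_convolution :: "fun_family \<Rightarrow> fun_family \<Rightarrow> fun_family" where
  "twisted_convolution u v = (\<lambda>n a b. LINT s|lborel. u n (s + a + b) s * v n (s + a) (- s - b))"

lemma twisted_measurable:
  assumes "rapid cosh_weight u" "rapid cosh_weight v"
  shows "(\<lambda>s. u n (s + a + b) s * v n (s + a) (- s - b)) \<in> borel_measurable borel"
  by (intro borel_measurable_continuous_onI continuous_intros cosh2.rapid_continuous_slice[OF assms(1)]
      cosh2.rapid_continuous_slice[OF assms(2)])

text \<open>
  The arguments \<open>s\<close>, \<open>s + a\<close> and \<open>- s - b\<close> determine \<open>a\<close> and \<open>b\<close>, so decay of the two
  factors in them gives decay in \<open>a\<close> and \<open>b\<close>, by submultiplicativity of \<open>cosh\<close> up to the factor \<open>2\<close>.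
  Each power of the weight costs two powers of \<open>cosh (2 s)\<close>, one for \<open>a\<close> and one for \<open>b\<close>; one
  further power makes the integral converge.
\<close>

lemma twisted_bound:
  assumes u: "rapid cosh_weight u" and v: "rapid cosh_weight v"
  obtains C where "C > 0" "\<And>n a b s. cosh_weight a b ^ N * cmod (u n (s + a + b) s * v n (s + a) (- s - b)) \<le> C * bump s"
proof -
  obtain A where A: "A > 0" "\<And>n a b. cosh (2 * a) ^ 0 * cosh (2 * b) ^ Suc (2 * N) * cmod (u n a b) \<le> A"
    using cosh_decaysE[OF u, of 0] by metis
  obtain B where B: "B > 0" "\<And>n a b. cosh (2 * a) ^ N * cosh (2 * b) ^ N * cmod (v n a b) \<le> B"
    using cosh_decaysE[OF v] by metis
  have "cosh_weight a b ^ N * cmod (u n (s + a + b) s * v n (s + a) (- s - b)) \<le> (4 ^ N * A * B) * bump s" for n a b s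
  proof -
    define X Y S where XY: "X = cosh (2 * (s + a))" "Y = cosh (2 * (- s - b))" "S = cosh (2 * s)"
    define U V where UV: "U = cmod (u n (s + a + b) s)" "V = cmod (v n (s + a) (- s - b))"
    have pos: "0 < X" "0 < Y" "0 < S" by (simp_all add: XY)
    have "cosh (2 * a) \<le> 2 * X * S"
      unfolding XY by (rule cosh_le_split) simp
    moreover have "cosh (2 * b) \<le> 2 * Y * S"
      using cosh_add_le[of "2 * (- s - b)" "2 * s"] by (simp add: XY algebra_simps)
    ultimately have "cosh_weight a b \<le> (2 * X * S) * (2 * Y * S)"
      unfolding cosh_weight_def using pos by (intro mult_mono) auto
    then have "cosh_weight a b ^ N \<le> (4 * X * Y * S\<^sup>2) ^ N"
      using cosh2.weight_ge_1[of a b] by (intro power_mono) (auto simp: power2_eq_square algebra_simps)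
    then have "cosh_weight a b ^ N * (U * V) \<le> (4 * X * Y * S\<^sup>2) ^ N * (U * V)"
      by (intro mult_right_mono) (auto simp: UV)
    also have "\<dots> = 4 ^ N * (S ^ (2 * N) * U) * (X ^ N * Y ^ N * V)"
      by (simp add: power_mult_distrib power_mult[symmetric] algebra_simps)
    also have "\<dots> \<le> 4 ^ N * (A * (1 / S)) * B"
    proof (rule mult_mono, rule mult_left_mono)
      show "S ^ (2 * N) * U \<le> A * (1 / S)"
        using A(2)[of "s + a + b" s n] pos by (simp add: XY UV pos_le_divide_eq algebra_simps)
      show "X ^ N * Y ^ N * V \<le> B"
        using B(2)[of "s + a" "- s - b" n] by (simp add: XY UV)
    qed (use pos A B in \<open>auto simp: UV\<close>)
    also have "\<dots> = 4 ^ N * A * B * (1 / S)" by simp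
    also have "\<dots> \<le> 4 ^ N * A * B * bump s"
      using A(1) B(1) inverse_cosh_le_bump[of s] unfolding XY by (intro mult_left_mono) auto
    finally show ?thesis by (simp add: UV norm_mult)
  qed
  then show thesis using A(1) B(1) by (intro that[of "4 ^ N * A * B"]) auto
qed

lemma twisted_bound0:
  assumes "rapid cosh_weight u" "rapid cosh_weight v"
  obtains C where "C > 0" "\<And>n a b s. cmod (u n (s + a + b) s * v n (s + a) (- s - b)) \<le> C * bump s"
  using twisted_bound[OF assms, of 0] by auto

lemma decays_twisted_convolution:
  assumes "rapid cosh_weight u" "rapid cosh_weight v"
  shows "decays cosh_weight (twisted_convolution u v)"
  unfolding decays_def
proof
  fix N
  obtain C where C: "C > 0" "\<And>n a b s. cosh_weight a b ^ N * cmod (u n (s + a + b) s * v n (s + a) (- s - b)) \<le> C * bump s"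
    using twisted_bound[OF assms] by metis
  have "cosh_weight a b ^ N * cmod (twisted_convolution u v n a b) \<le> C * (LINT s|lborel. bump s)" for n a b
  proof -
    have pos: "0 < cosh_weight a b ^ N" using cosh2.weight_ge_1[of a b] by simp
    have "cmod (twisted_convolution u v n a b) \<le> (C / cosh_weight a b ^ N) * (LINT s|lborel. bump s)"
      unfolding twisted_convolution_def
      by (rule integral_bump_bound) (use C pos in \<open>simp add: pos_le_divide_eq mult_ac\<close>)
    then show ?thesis using pos by (simp add: pos_le_divide_eq mult_ac)
  qed
  then show "\<exists>C. \<forall>n a b. cosh_weight a b ^ N * cmod (twisted_convolution u v n a b) \<le> C" by blast
qed

lemma has_vector_derivative_shift:
  assumes "(f has_vector_derivative f') (at (s + x))"
  shows "((\<lambda>x. f (s + x)) has_vector_derivative f') (at x)"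
proof -
  have "((\<lambda>x. s + x) has_vector_derivative 1) (at x)" by (auto intro!: derivative_eq_intros)
  from vector_diff_chain_at[OF this assms] show ?thesis by (simp add: comp_def)
qed

lemma has_vector_derivative_reflect:
  assumes "(f has_vector_derivative f') (at (s - x))"
  shows "((\<lambda>x. f (s - x)) has_vector_derivative - f') (at x)"
proof -
  have "((\<lambda>x. s - x) has_vector_derivative -1) (at x)" by (auto intro!: derivative_eq_intros)
  from vector_diff_chain_at[OF this assms] show ?thesis by (simp add: comp_def)
qed

lemma partials_twisted_convolution:
  assumes u: "rapid cosh_weight u" "partials u ux uy" "rapid cosh_weight ux"
    and v: "rapid cosh_weight v" "partials v vx vy" "rapid cosh_weight vx" "rapid cosh_weight vy"
  shows "partials (twisted_convolution u v)
    (\<lambda>n a b. twisted_convolution u vx n a b + twisted_convolution ux v n a b)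
    (\<lambda>n a b. (-1) * twisted_convolution u vy n a b + twisted_convolution ux v n a b)"
proof -
  obtain C where C: "\<And>n a b s. cmod (u n (s + a + b) s * v n (s + a) (- s - b)) \<le> C * bump s"
    using twisted_bound0[OF u(1) v(1)] by metis
  obtain C1 where C1: "\<And>n a b s. cmod (ux n (s + a + b) s * v n (s + a) (- s - b)) \<le> C1 * bump s"
    using twisted_bound0[OF u(3) v(1)] by metis
  obtain C2 where C2: "\<And>n a b s. cmod (u n (s + a + b) s * vx n (s + a) (- s - b)) \<le> C2 * bump s"
    using twisted_bound0[OF u(1) v(3)] by metis
  obtain C3 where C3: "\<And>n a b s. cmod (u n (s + a + b) s * vy n (s + a) (- s - b)) \<le> C3 * bump s"
    using twisted_bound0[OF u(1) v(4)] by metis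
  note m = twisted_measurable[OF u(1) v(1)] twisted_measurable[OF u(3) v(1)]
    twisted_measurable[OF u(1) v(3)] twisted_measurable[OF u(1) v(4)]
  note i = integrable_bump_bound[OF m(2) C1] integrable_bump_bound[OF m(3) C2] integrable_bump_bound[OF m(4) C3]
  have ux: "((\<lambda>x. u n (s + x + b) r) has_vector_derivative ux n (s + a + b) r) (at a)"
           "((\<lambda>x. u n (s + a + x) r) has_vector_derivative ux n (s + a + b) r) (at b)" for n a b s r
    using has_vector_derivative_shift[of "\<lambda>x. u n x r" _ "s + b" a]
      has_vector_derivative_shift[of "\<lambda>x. u n x r" _ "s + a" b] u(2)
    by (auto simp: partials_def algebra_simps)
  have vx: "((\<lambda>x. v n (s + x) r) has_vector_derivative vx n (s + a) r) (at a)" for n a s r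
    using has_vector_derivative_shift[of "\<lambda>x. v n x r" _ "s" a] v(2) by (auto simp: partials_def)
  have vy: "((\<lambda>x. v n r (- s - x)) has_vector_derivative - vy n r (- s - b)) (at b)" for n s r b
    using has_vector_derivative_reflect[of "\<lambda>x. v n r x" _ "- s" b] v(2) by (auto simp: partials_def)
  have "((\<lambda>a. twisted_convolution u v n a b) has_vector_derivative
      (LINT s|lborel. u n (s + a + b) s * vx n (s + a) (- s - b) + ux n (s + a + b) s * v n (s + a) (- s - b))) (at a)" for n a b
    unfolding twisted_convolution_def
  proof (rule has_vector_derivative_integral[where C=C and D="C2 + C1"])
    fix a s
    show "((\<lambda>a. u n (s + a + b) s * v n (s + a) (- s - b)) has_vector_derivative
       u n (s + a + b) s * vx n (s + a) (- s - b) + ux n (s + a + b) s * v n (s + a) (- s - b)) (at a)"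
      by (rule has_vector_derivative_mult[OF ux(1) vx])
    show "cmod (u n (s + a + b) s * vx n (s + a) (- s - b) + ux n (s + a + b) s * v n (s + a) (- s - b)) \<le> (C2 + C1) * bump s"
      using C1[of n s a b] C2[of n s a b] by (intro order_trans[OF norm_triangle_ineq]) (simp add: distrib_right)
  qed (use m C in auto)
  moreover have "((\<lambda>b. twisted_convolution u v n a b) has_vector_derivative
      (LINT s|lborel. u n (s + a + b) s * - vy n (s + a) (- s - b) + ux n (s + a + b) s * v n (s + a) (- s - b))) (at b)" for n a b
    unfolding twisted_convolution_def
  proof (rule has_vector_derivative_integral[where C=C and D="C3 + C1"])
    fix b s
    show "((\<lambda>b. u n (s + a + b) s * v n (s + a) (- s - b)) has_vector_derivative
       u n (s + a + b) s * - vy n (s + a) (- s - b) + ux n (s + a + b) s * v n (s + a) (- s - b)) (at b)"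
      by (rule has_vector_derivative_mult[OF ux(2) vy])
    show "cmod (u n (s + a + b) s * - vy n (s + a) (- s - b) + ux n (s + a + b) s * v n (s + a) (- s - b)) \<le> (C3 + C1) * bump s"
      using C1[of n s a b] C3[of n s a b] by (intro order_trans[OF norm_triangle_ineq]) (simp add: distrib_right)
  qed (use m C in auto)
  ultimately show ?thesis
    using i by (simp add: partials_def twisted_convolution_def)
qed

proposition rapid_twisted_convolution:
  assumes "rapid cosh_weight u" "rapid cosh_weight v"
  shows "rapid cosh_weight (twisted_convolution u v)"
proof -
  have "rapid cosh_weight u \<Longrightarrow> rapid cosh_weight v \<Longrightarrow> smooth (decays cosh_weight) k (twisted_convolution u v)" for k u v
  proof (induction k arbitrary: u v)
    case 0
    then show ?case using decays_twisted_convolution by simp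
  next
    case (Suc k)
    obtain ux uy where p: "partials u ux uy" "rapid cosh_weight ux" "rapid cosh_weight uy"
      using cosh2.rapid_partials[OF Suc.prems(1)] .
    obtain vx vy where q: "partials v vx vy" "rapid cosh_weight vx" "rapid cosh_weight vy"
      using cosh2.rapid_partials[OF Suc.prems(2)] .
    have add: "smooth (decays cosh_weight) k (\<lambda>n x y. f n x y + g n x y)"
      if "smooth (decays cosh_weight) k f" "smooth (decays cosh_weight) k g" for f g
      using that decays_add[of cosh_weight] cosh2.weight_ge_1 by (intro smooth_add) auto
    have neg: "smooth (decays cosh_weight) k (\<lambda>n x y. (-1) * f n x y)"
      if "smooth (decays cosh_weight) k f" for f
      using that cosh2.slow_const[of "-1"] by (intro cosh2.rapid_mult_smooth) (auto simp: slow_def)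
    show ?case
      using partials_twisted_convolution[OF Suc.prems(1) p(1,2) Suc.prems(2) q]
        decays_twisted_convolution[OF Suc.prems]
        add[OF Suc.IH[OF Suc.prems(1) q(2)] Suc.IH[OF p(2) Suc.prems(2)]]
        add[OF neg[OF Suc.IH[OF Suc.prems(1) q(3)]] Suc.IH[OF p(2) Suc.prems(2)]]
      by auto
  qed
  then show ?thesis using assms by (simp add: rapid_def)
qed

section \<open>Fourier inversion\<close>

lemma integrable_tensor:
  fixes p :: "'a::euclidean_space \<Rightarrow> 'c::{real_normed_field,banach,second_countable_topology}"
    and q :: "'b::euclidean_space \<Rightarrow> 'c"
  assumes p: "integrable lborel p" and q: "integrable lborel q"
  shows "integrable lborel (\<lambda>z. p (fst z) * q (snd z))"
proof -
  have [measurable]: "p \<in> borel_measurable borel" "q \<in> borel_measurable borel" using p q by auto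
  have "integrable (lborel \<Otimes>\<^sub>M lborel) (\<lambda>z. p (fst z) * q (snd z))"
    by (rule lborel_pair.Fubini_integrable) (use p q in \<open>simp_all add: norm_mult\<close>)
  then show ?thesis by (simp add: lborel_prod)
qed

lemma integrable_tensor_bound:
  fixes f :: "'a::euclidean_space \<times> 'b::euclidean_space \<Rightarrow> complex" and p :: "'a \<Rightarrow> real" and q :: "'b \<Rightarrow> real"
  assumes f: "f \<in> borel_measurable borel" and p: "integrable lborel p" and q: "integrable lborel q"
    and le: "\<And>x y. cmod (f (x, y)) \<le> p x * q y"
  shows "integrable lborel f"
  by (rule Bochner_Integration.integrable_bound[OF integrable_tensor[OF p q]])
     (use f in \<open>auto intro!: AE_I2 order_trans[OF le]\<close>)

lemma lborel_Fubini:
  fixes f :: "'a::euclidean_space \<Rightarrow> 'b::euclidean_space \<Rightarrow> complex"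
  assumes "integrable lborel (\<lambda>z. f (fst z) (snd z))"
  shows "(LINT y|lborel. LINT x|lborel. f x y) = (LINT x|lborel. LINT y|lborel. f x y)"
    and "(LINT z|lborel. f (fst z) (snd z)) = (LINT x|lborel. LINT y|lborel. f x y)"
proof -
  have i: "integrable (lborel \<Otimes>\<^sub>M lborel) (\<lambda>(x, y). f x y)"
    using assms by (simp add: lborel_prod case_prod_unfold)
  show "(LINT y|lborel. LINT x|lborel. f x y) = (LINT x|lborel. LINT y|lborel. f x y)"
    by (rule lborel_pair.Fubini_integral[OF i])
  show "(LINT z|lborel. f (fst z) (snd z)) = (LINT x|lborel. LINT y|lborel. f x y)"
    using lborel_pair.integral_fst[OF i] by (simp add: lborel_prod case_prod_unfold)
qed

lemma integral_tensor:
  fixes p :: "'a::euclidean_space \<Rightarrow> complex" and q :: "'b::euclidean_space \<Rightarrow> complex"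
  assumes p: "integrable lborel p" and q: "integrable lborel q"
  shows "(LINT z|lborel. p (fst z) * q (snd z)) = (LINT x|lborel. p x) * (LINT y|lborel. q y)"
  using lborel_Fubini(2)[of "\<lambda>x y. p x * q y"] integrable_tensor[OF assms] by simp

lemma fourier_gaussian:
  "(LINT x|lborel. std_normal_density x *\<^sub>R cis (t * x)) = complex_of_real (exp (- (t\<^sup>2) / 2))"
proof -
  have "(LINT x|lborel. std_normal_density x *\<^sub>R cis (t * x)) = char std_normal_distribution t"
    unfolding char_def by (subst integral_density) (auto simp: cis_conv_exp)
  then show ?thesis by (simp add: char_std_normal_distribution)
qed


lemma std_normal_density_integrable: "integrable lborel std_normal_density"
  using integrable_std_normal_moment[of 0] by simp

text \<open>
  Multiplied by a Gaussian of width \<open>k\<close>, the double integral converges absolutely and can be computed in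
  either order, because the Gaussian is its own Fourier transform. Both sides converge as
  \<open>k\<close> tends to infinity.
\<close>

lemma fourier_inversion_at_0:
  fixes g :: "real \<Rightarrow> complex"
  assumes cont: "continuous_on UNIV g" and C: "\<And>r. cmod (g r) \<le> C * bump r"
    and int: "integrable lborel (\<lambda>l. LINT r|lborel. cis (r * l) * g r)"
  shows "(LINT l|lborel. LINT r|lborel. cis (r * l) * g r) = 2 * pi * g 0"
proof -
  define G where "G = (\<lambda>l. LINT r|lborel. cis (r * l) * g r)"
  let ?d = std_normal_density
  have [measurable]: "g \<in> borel_measurable borel" using cont by (rule borel_measurable_continuous_onI)
  have [measurable]: "G \<in> borel_measurable borel" using int unfolding G_def by simp
  have d_le: "?d x \<le> ?d 0" for x by (simp add: std_normal_density_def divide_right_mono)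
  have d_cont: "continuous_on UNIV ?d" unfolding std_normal_density_def by (intro continuous_intros) auto
  have C0: "0 \<le> C" using C[of 0] bump_pos[of 0] norm_ge_zero[of "g 0"]
    by (metis order_trans zero_le_mult_iff not_less)
  have bump_le: "bump x \<le> 1" for x by (simp add: bump_def pos_divide_le_eq add_pos_nonneg)
  \<comment> \<open>the Gaussian regularisation of the integral, computed in the two orders of integration\<close>
  have reg: "(LINT l|lborel. ?d (l / k) *\<^sub>R G l) = sqrt (2 * pi) * (LINT y|lborel. ?d y *\<^sub>R g (y / k))"
    if k: "k > 0" for k
  proof -
    have i: "integrable lborel (\<lambda>z. ?d (fst z / k) *\<^sub>R (cis (snd z * fst z) * g (snd z)))"
    proof (rule integrable_tensor_bound[where p="\<lambda>l. ?d (l / k)" and q="\<lambda>r. C * bump r"])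
      show "integrable lborel (\<lambda>l. ?d (l / k))"
        using lborel_integrable_real_affine[OF std_normal_density_integrable, of "1 / k" 0] k by simp
      show "integrable lborel (\<lambda>r. C * bump r)" using bump_integrable by simp
      show "cmod (?d (fst (l, r) / k) *\<^sub>R (cis (snd (l, r) * fst (l, r)) * g (snd (l, r)))) \<le> ?d (l / k) * (C * bump r)" for l r
        using C[of r] by (simp add: norm_mult mult_left_mono)
      show "(\<lambda>z. ?d (fst z / k) *\<^sub>R (cis (snd z * fst z) * g (snd z))) \<in> borel_measurable borel"
        by (intro borel_measurable_continuous_onI continuous_intros continuous_on_compose2[OF cont]
            continuous_on_compose2[OF d_cont]) (use k in auto)
    qed
    have "(LINT l|lborel. ?d (l / k) *\<^sub>R G l) =
        (LINT l|lborel. LINT r|lborel. ?d (l / k) *\<^sub>R (cis (r * l) * g r))"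
      by (simp add: G_def)
    also have "\<dots> = (LINT r|lborel. LINT l|lborel. ?d (l / k) *\<^sub>R (cis (r * l) * g r))"
      using lborel_Fubini(1)[of "\<lambda>l r. ?d (l / k) *\<^sub>R (cis (r * l) * g r)"] i by simp
    also have "\<dots> = (LINT r|lborel. k *\<^sub>R (complex_of_real (exp (- ((k * r)\<^sup>2) / 2)) * g r))"
    proof (rule Bochner_Integration.integral_cong[OF refl])
      fix r
      have "(LINT l|lborel. ?d (l / k) *\<^sub>R (cis (r * l) * g r)) = (LINT l|lborel. ?d (l / k) *\<^sub>R cis (r * l)) * g r"
        by (simp flip: mult_scaleR_left)
      also have "(LINT l|lborel. ?d (l / k) *\<^sub>R cis (r * l)) = k *\<^sub>R (LINT x|lborel. ?d x *\<^sub>R cis ((k * r) * x))"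
        using lborel_integral_real_affine[of k "\<lambda>l. ?d (l / k) *\<^sub>R cis (r * l)" 0] k by (simp add: mult_ac)
      finally show "(LINT l|lborel. ?d (l / k) *\<^sub>R (cis (r * l) * g r)) = k *\<^sub>R (complex_of_real (exp (- ((k * r)\<^sup>2) / 2)) * g r)"
        unfolding fourier_gaussian by simp
    qed
    also have "\<dots> = (LINT y|lborel. complex_of_real (exp (- (y\<^sup>2) / 2)) * g (y / k))"
      using lborel_integral_real_affine[of "1 / k" "\<lambda>r. k *\<^sub>R (complex_of_real (exp (- ((k * r)\<^sup>2) / 2)) * g r)" 0] k
      by simp
    also have "\<dots> = (LINT y|lborel. sqrt (2 * pi) * (?d y *\<^sub>R g (y / k)))"
      by (intro Bochner_Integration.integral_cong refl) (simp add: std_normal_density_def scaleR_conv_of_real)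
    finally show ?thesis by (simp only: integral_mult_right_zero)
  qed
  have lim: "(\<lambda>k. f (x / real (Suc k))) \<longlonglongrightarrow> f 0" if "continuous_on UNIV f" for f :: "real \<Rightarrow> 'z::real_normed_vector" and x
  proof -
    have "(\<lambda>k. x / real (Suc k)) \<longlonglongrightarrow> 0" using LIMSEQ_Suc[OF lim_const_over_n] by simp
    moreover have "isCont f 0" using that by (simp add: continuous_on_eq_continuous_at)
    ultimately show ?thesis using isCont_tendsto_compose by blast
  qed
  have "(\<lambda>k. LINT l|lborel. ?d (l / real (Suc k)) *\<^sub>R G l) \<longlonglongrightarrow> (LINT l|lborel. ?d 0 *\<^sub>R G l)"
  proof (rule integral_dominated_convergence[where w="\<lambda>l. ?d 0 * cmod (G l)"])
    show "integrable lborel (\<lambda>l. ?d 0 * cmod (G l))" using int unfolding G_def by simp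
    show "AE l in lborel. (\<lambda>k. ?d (l / real (Suc k)) *\<^sub>R G l) \<longlonglongrightarrow> ?d 0 *\<^sub>R G l"
      by (intro AE_I2 tendsto_scaleR tendsto_const lim d_cont)
    show "AE l in lborel. norm (?d (l / real (Suc k)) *\<^sub>R G l) \<le> ?d 0 * cmod (G l)" for k
      by (intro AE_I2) (use d_le in \<open>auto intro!: mult_right_mono\<close>)
  qed measurable
  moreover have "(\<lambda>k. LINT y|lborel. ?d y *\<^sub>R g (y / real (Suc k))) \<longlonglongrightarrow> (LINT y|lborel. ?d y *\<^sub>R g 0)"
  proof (rule integral_dominated_convergence[where w="\<lambda>y. ?d y * C"])
    show "integrable lborel (\<lambda>y. ?d y * C)" using std_normal_density_integrable by simp
    show "AE y in lborel. (\<lambda>k. ?d y *\<^sub>R g (y / real (Suc k))) \<longlonglongrightarrow> ?d y *\<^sub>R g 0"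
      by (intro AE_I2 tendsto_scaleR tendsto_const lim cont)
    have "cmod (g x) \<le> C" for x
      using C[of x] mult_left_mono[OF bump_le[of x] C0] by simp
    then show "AE y in lborel. norm (?d y *\<^sub>R g (y / real (Suc k))) \<le> ?d y * C" for k
      by (intro AE_I2) (auto intro!: mult_left_mono)
  qed measurable
  then have "(\<lambda>k. sqrt (2 * pi) * (LINT y|lborel. ?d y *\<^sub>R g (y / real (Suc k)))) \<longlonglongrightarrow>
      sqrt (2 * pi) * (LINT y|lborel. ?d y *\<^sub>R g 0)" by (intro tendsto_intros)
  then have "(\<lambda>k. LINT l|lborel. ?d (l / real (Suc k)) *\<^sub>R G l) \<longlonglongrightarrow> sqrt (2 * pi) * (LINT y|lborel. ?d y *\<^sub>R g 0)"
    using reg[of "real (Suc k)" for k] by simp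
  ultimately have "(LINT l|lborel. ?d 0 *\<^sub>R G l) = sqrt (2 * pi) * (LINT y|lborel. ?d y *\<^sub>R g 0)"
    by (rule LIMSEQ_unique)
  moreover have "(LINT y|lborel. ?d y *\<^sub>R g 0) = g 0"
    using fourier_gaussian[of 0] by simp
  ultimately have "(1 / sqrt (2 * pi)) *\<^sub>R (LINT l|lborel. G l) = sqrt (2 * pi) * g 0"
    by (simp add: std_normal_density_def)
  then have "sqrt (2 * pi) *\<^sub>R ((1 / sqrt (2 * pi)) *\<^sub>R (LINT l|lborel. G l)) = sqrt (2 * pi) *\<^sub>R (sqrt (2 * pi) * g 0)"
    by simp
  then have "(LINT l|lborel. G l) = complex_of_real (sqrt (2 * pi) * sqrt (2 * pi)) * g 0"
    by (simp add: scaleR_conv_of_real del: real_sqrt_mult_self)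
  then show ?thesis by (simp add: G_def)
qed

lemma fourier_inversion:
  fixes g :: "real \<Rightarrow> complex"
  assumes cont: "continuous_on UNIV g" and C: "\<And>r. cmod (g r) \<le> C * bump r"
    and int: "integrable lborel (\<lambda>l. LINT r|lborel. cis (r * l) * g r)"
  shows "(LINT l|lborel. cis (x * l) * (LINT r|lborel. cis (r * l) * g r)) = 2 * pi * g (- x)"
proof -
  have C0: "0 \<le> C" using C[of 0] bump_pos[of 0] norm_ge_zero[of "g 0"]
    by (metis order_trans zero_le_mult_iff not_less)
  have b: "bump (r - x) \<le> (2 * (1 + x\<^sup>2)) * bump r" for r
  proof -
    have "0 \<le> (r - 2 * x)\<^sup>2 + 2 * x\<^sup>2 * (r - x)\<^sup>2 + 1" by simp
    then have "1 + r\<^sup>2 \<le> 2 * (1 + x\<^sup>2) * (1 + (r - x)\<^sup>2)" by (simp add: power2_eq_square algebra_simps)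
    then show ?thesis by (simp add: bump_def field_simps add_pos_nonneg)
  qed
  \<comment> \<open>a translation of \<open>g\<close> modulates its transform, which reduces the claim to the point \<open>0\<close>\<close>
  have tr: "(LINT r|lborel. cis (r * l) * g (r - x)) = cis (x * l) * (LINT r|lborel. cis (r * l) * g r)" for l
  proof -
    have "(LINT r|lborel. cis (r * l) * g (r - x)) = (LINT r|lborel. cis ((x + r) * l) * g r)"
      using lborel_integral_real_affine[of 1 "\<lambda>r. cis (r * l) * g (r - x)" x] by simp
    also have "\<dots> = (LINT r|lborel. cis (x * l) * (cis (r * l) * g r))"
      by (simp add: distrib_right mult.assoc flip: cis_mult)
    finally show ?thesis by simp
  qed
  have "(LINT l|lborel. LINT r|lborel. cis (r * l) * g (r - x)) = 2 * pi * g (0 - x)"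
  proof (rule fourier_inversion_at_0[where C="C * (2 * (1 + x\<^sup>2))"])
    show "continuous_on UNIV (\<lambda>r. g (r - x))"
      by (intro continuous_on_compose2[OF cont] continuous_intros) auto
    show "cmod (g (r - x)) \<le> C * (2 * (1 + x\<^sup>2)) * bump r" for r
      using order_trans[OF C[of "r - x"] mult_left_mono[OF b C0]] by (simp add: mult_ac)
    have "(\<lambda>l. cis (x * l)) \<in> borel_measurable borel"
      by (intro borel_measurable_continuous_onI continuous_intros)
    then have "integrable lborel (\<lambda>l. cis (x * l) * (LINT r|lborel. cis (r * l) * g r))"
      using borel_measurable_integrable[OF int]
      by (intro Bochner_Integration.integrable_bound[OF int]) (auto simp: norm_mult)
    then show "integrable lborel (\<lambda>l. LINT r|lborel. cis (r * l) * g (r - x))" by (simp add: tr)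
  qed
  then show ?thesis by (simp add: tr)
qed

lemma LBINT_UNIV: "(LBINT x=-\<infinity>..\<infinity>. f x) = (LINT x|lborel. f x)"
  for f :: "real \<Rightarrow> complex"
  by (simp add: interval_lebesgue_integral_def set_lebesgue_integral_def)

text \<open>
  The substitution \<open>r = sinh (2 b)\<close> leads back to the ordinary Fourier transform; its Jacobian
  \<open>2 cosh (2 b)\<close> is the denominator of the result.
\<close>

lemma fourier_inversion_sinh:
  fixes g :: "real \<Rightarrow> complex"
  assumes cont: "continuous_on UNIV g" and C: "\<And>b. cmod (g b) \<le> C / cosh (2 * b)" and "c \<noteq> 0"
    and int: "integrable lborel (\<lambda>l. LINT b|lborel. wave c b l * g b)"
  shows "(LINT l|lborel. cis (c * sinh (2 * x) * l) * (LINT b|lborel. wave c b l * g b))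
    = complex_of_real (pi / (\<bar>c\<bar> * cosh (2 * x))) * g (- x)"
proof -
  \<comment> \<open>the density of \<open>g b db\<close> in the variable \<open>r = sinh (2 b)\<close>\<close>
  define h where "h r = complex_of_real (1 / (2 * sqrt (r\<^sup>2 + 1))) * g (arsinh r / 2)" for r
  have sq: "sqrt (r\<^sup>2 + 1) > 0" for r :: real by (simp add: add_nonneg_pos)
  then have sq': "sqrt (r\<^sup>2 + 1) \<noteq> 0" for r :: real by (metis less_irrefl)
  have h_cont: "continuous_on UNIV h"
    unfolding h_def
    by (intro continuous_intros continuous_on_compose2[OF cont]) (use sq' in auto)
  have h_bound: "cmod (h r) \<le> C / 2 * bump r" for r
  proof -
    have "cmod (g (arsinh r / 2)) \<le> C / sqrt (r\<^sup>2 + 1)"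
      using C[of "arsinh r / 2"] by (simp add: cosh_arsinh_real)
    then have "1 / (2 * sqrt (r\<^sup>2 + 1)) * cmod (g (arsinh r / 2)) \<le> 1 / (2 * sqrt (r\<^sup>2 + 1)) * (C / sqrt (r\<^sup>2 + 1))"
      by (rule mult_left_mono) (use sq[of r] in simp)
    moreover have "cmod (h r) = 1 / (2 * sqrt (r\<^sup>2 + 1)) * cmod (g (arsinh r / 2))"
      using sq[of r] by (simp add: h_def norm_mult norm_divide)
    ultimately have "cmod (h r) \<le> 1 / (2 * sqrt (r\<^sup>2 + 1)) * (C / sqrt (r\<^sup>2 + 1))" by simp
    also have "\<dots> = C / (2 * (sqrt (r\<^sup>2 + 1) * sqrt (r\<^sup>2 + 1)))"
      by (simp only: times_divide_times_eq mult_1 mult.assoc)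
    also have "sqrt (r\<^sup>2 + 1) * sqrt (r\<^sup>2 + 1) = r\<^sup>2 + 1" by simp
    also have "C / (2 * (r\<^sup>2 + 1)) = C / 2 * bump r" by (simp add: bump_def add.commute)
    finally show ?thesis .
  qed
  have h_sinh: "(2 * cosh (2 * b)) *\<^sub>R h (sinh (2 * b)) = g b" for b
  proof -
    have "sqrt ((sinh (2 * b))\<^sup>2 + 1) = cosh (2 * b)" by (simp flip: cosh_square_eq)
    then show ?thesis by (simp add: h_def arsinh_sinh_real scaleR_conv_of_real flip: of_real_mult)
  qed
  define H where "H l = (LINT r|lborel. cis (r * l) * h r)" for l
  have H: "(LINT b|lborel. wave c b l * g b) = H (c * l)" for l
  proof -
    have hc: "continuous_on UNIV (\<lambda>r. cis (r * (c * l)) * h r)" by (intro continuous_intros h_cont)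
    have eq: "(2 * cosh (2 * b)) *\<^sub>R (cis (sinh (2 * b) * (c * l)) * h (sinh (2 * b))) = wave c b l * g b" for b
      by (subst h_sinh[symmetric, of b]) (simp add: mult_ac)
    have "(LBINT r=-\<infinity>..\<infinity>. cis (r * (c * l)) * h r) =
        (LBINT b=-\<infinity>..\<infinity>. (2 * cosh (2 * b)) *\<^sub>R (cis (sinh (2 * b) * (c * l)) * h (sinh (2 * b))))"
    proof (rule interval_integral_substitution_integrable)
      show "((\<lambda>b. sinh (2 * b)) has_real_derivative 2 * cosh (2 * b)) (at b)" for b :: real
        by (auto intro!: derivative_eq_intros)
      show "isCont (\<lambda>r. cis (r * (c * l)) * h r) (sinh (2 * b))" for b
        using hc by (simp add: continuous_on_eq_continuous_at)
      have "filterlim (\<lambda>x. sinh (2 * x) :: real) at_bot at_bot"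
        by (rule filterlim_compose[OF sinh_real_at_bot], rule filterlim_tendsto_pos_mult_at_bot) (auto intro: filterlim_ident)
      then show "((ereal \<circ> (\<lambda>b. sinh (2 * b)) \<circ> real_of_ereal) \<longlongrightarrow> - \<infinity>) (at_right (- \<infinity>))"
        by (simp add: ereal_tendsto_simps)
      have "filterlim (\<lambda>x. sinh (2 * x) :: real) at_top at_top"
        by (rule filterlim_compose[OF sinh_real_at_top], rule filterlim_tendsto_pos_mult_at_top) (auto intro: filterlim_ident)
      then show "((ereal \<circ> (\<lambda>b. sinh (2 * b)) \<circ> real_of_ereal) \<longlongrightarrow> \<infinity>) (at_left \<infinity>)"
        by (simp add: ereal_tendsto_simps)
      have "integrable lborel (\<lambda>r. cis (r * (c * l)) * h r)"
        using h_bound by (intro integrable_bump_bound[where C="C/2"] borel_measurable_continuous_onI hc) (simp add: norm_mult)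
      then show "set_integrable lborel (einterval (-\<infinity>) \<infinity>) (\<lambda>r. cis (r * (c * l)) * h r)"
        by (simp add: set_integrable_def)
      have "integrable lborel (\<lambda>b. wave c b l * g b)"
      proof (rule integrable_bump_bound[where C=C])
        have "0 \<le> C" using C[of 0] by (simp add: order_trans[OF norm_ge_zero])
        then have "C / cosh (2 * b) \<le> C * bump b" for b
          using mult_left_mono[OF inverse_cosh_le_bump[of b], of C] by simp
        then show "cmod (wave c b l * g b) \<le> C * bump b" for b
          using C[of b] by (simp add: norm_mult order_trans)
        show "(\<lambda>b. wave c b l * g b) \<in> borel_measurable borel"
          by (intro borel_measurable_continuous_onI continuous_intros cont)
      qed
      then show "set_integrable lborel (einterval (-\<infinity>) \<infinity>)
          (\<lambda>b. (2 * cosh (2 * b)) *\<^sub>R (cis (sinh (2 * b) * (c * l)) * h (sinh (2 * b))))"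
        unfolding eq by (simp add: set_integrable_def)
    qed (auto intro!: continuous_intros)
    then show ?thesis unfolding eq LBINT_UNIV H_def by simp
  qed
  have "integrable lborel (\<lambda>l. H (0 + c * l))" using int by (simp add: H)
  then have H_int: "integrable lborel H" using lborel_integrable_real_affine_iff[OF \<open>c \<noteq> 0\<close>] by blast
  have "(LINT m|lborel. cis (sinh (2 * x) * m) * H m) = 2 * pi * h (- sinh (2 * x))"
    unfolding H_def by (rule fourier_inversion[OF h_cont h_bound]) (use H_int in \<open>simp add: H_def[abs_def]\<close>)
  moreover have "(LINT m|lborel. cis (sinh (2 * x) * m) * H m) =
      \<bar>c\<bar> *\<^sub>R (LINT l|lborel. cis (c * sinh (2 * x) * l) * H (c * l))"
    using lborel_integral_real_affine[OF \<open>c \<noteq> 0\<close>, of "\<lambda>m. cis (sinh (2 * x) * m) * H m" 0]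
    by (simp add: mult_ac)
  moreover have "(2 * cosh (2 * x)) *\<^sub>R h (- sinh (2 * x)) = g (- x)"
    using h_sinh[of "- x"] by simp
  then have "h (- sinh (2 * x)) = g (- x) /\<^sub>R (2 * cosh (2 * x))" by (metis cosh_real_nonzero divideR_right mult_eq_0_iff zero_neq_numeral)
  ultimately have "\<bar>c\<bar> *\<^sub>R (LINT l|lborel. cis (c * sinh (2 * x) * l) * H (c * l)) = (pi / cosh (2 * x)) *\<^sub>R g (- x)"
    by (simp add: scaleR_conv_of_real divide_simps)
  then have "(LINT l|lborel. cis (c * sinh (2 * x) * l) * H (c * l)) = ((pi / cosh (2 * x)) *\<^sub>R g (- x)) /\<^sub>R \<bar>c\<bar>"
    using \<open>c \<noteq> 0\<close> by (metis abs_0_eq scaleR_left_imp_eq divideR_right scaleR_scaleR)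
  then show ?thesis unfolding H using \<open>c \<noteq> 0\<close> by (simp add: scaleR_conv_of_real divide_simps)
qed

section \<open>Schwartz functions as rapidly decaying families\<close>

lemma partial_a_derivative:
  assumes "f differentiable_on UNIV"
  shows "((\<lambda>s. f (s, l)) has_vector_derivative partial_a f (a, l)) (at a)"
proof -
  have "f differentiable (at (a, l))" using assms by (simp add: differentiable_on_def)
  moreover have "((\<lambda>s. (s, l)) has_derivative (\<lambda>h. (h, 0))) (at a)"
    by (intro has_derivative_Pair has_derivative_ident has_derivative_const)
  then have "(\<lambda>s. (s, l)) differentiable (at a)" by (rule differentiableI)
  ultimately have "(\<lambda>s. f (s, l)) differentiable (at a)"
    using differentiable_chain_at[of "\<lambda>s. (s, l)" a f] by (simp add: comp_def)
  then show ?thesis unfolding partial_a_def by (simp add: vector_derivative_works)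
qed

lemma partial_l_derivative:
  assumes "f differentiable_on UNIV"
  shows "((\<lambda>s. f (a, s)) has_vector_derivative partial_l f (a, l)) (at l)"
proof -
  have "f differentiable (at (a, l))" using assms by (simp add: differentiable_on_def)
  moreover have "((\<lambda>s. (a, s)) has_derivative (\<lambda>h. (0, h))) (at l)"
    by (intro has_derivative_Pair has_derivative_ident has_derivative_const)
  then have "(\<lambda>s. (a, s)) differentiable (at l)" by (rule differentiableI)
  ultimately have "(\<lambda>s. f (a, s)) differentiable (at l)"
    using differentiable_chain_at[of "\<lambda>s. (a, s)" l f] by (simp add: comp_def)
  then show ?thesis unfolding partial_l_def by (simp add: vector_derivative_works)
qed

lemma partial_a_eqI:
  "(\<And>a l. ((\<lambda>s. f (s, l)) has_vector_derivative g (a, l)) (at a)) \<Longrightarrow> partial_a f = g"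
  unfolding partial_a_def by (auto simp: fun_eq_iff intro!: vector_derivative_at)

lemma partial_l_eqI:
  "(\<And>a l. ((\<lambda>s. f (a, s)) has_vector_derivative g (a, l)) (at l)) \<Longrightarrow> partial_l f = g"
  unfolding partial_l_def by (auto simp: fun_eq_iff intro!: vector_derivative_at)

lemma C_infinity_partials:
  assumes "C_infinity f"
  shows "f differentiable_on UNIV" "C_infinity (partial_a f)" "C_infinity (partial_l f)" "continuous_on UNIV f"
proof -
  have *: "C_k (Suc k) f" "C_k 0 f" for k using assms unfolding C_infinity_def by blast+
  then show "f differentiable_on UNIV" "continuous_on UNIV f" by auto
  show "C_infinity (partial_a f)" "C_infinity (partial_l f)" using * by (auto simp: C_infinity_def)
qed

text \<open>
  Write \<open>f\<close> as the integral of its derivative in \<open>l\<close> from a base point, differentiate under the integral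
  in \<open>a\<close>, and then differentiate in the upper limit \<open>l\<close>. The symmetry is needed because the seminorms only see
  derivatives in which those in \<open>l\<close> are taken first.
\<close>

lemma partial_a_partial_l_commute:
  assumes "C_infinity f"
  shows "partial_l (partial_a f) = partial_a (partial_l f)"
proof (rule partial_l_eqI)
  fix a l0 :: real
  let ?fl = "partial_l f" and ?fla = "partial_a (partial_l f)"
  note f = C_infinity_partials[OF assms]
  note fl = C_infinity_partials[OF f(3)]
  have cont: "continuous_on UNIV (\<lambda>s. g (x, s))" if "continuous_on UNIV g" for g :: orbit_fun and x
    by (rule continuous_on_compose2[OF that]) (auto intro!: continuous_intros)
  define m where "m = l0 - 1"
  have int: "f (x, l) = f (x, m) + integral {m..l} (\<lambda>s. ?fl (x, s))" if "m \<le> l" for x l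
  proof -
    have "((\<lambda>s. ?fl (x, s)) has_integral f (x, l) - f (x, m)) {m..l}"
      by (rule fundamental_theorem_of_calculus[OF that])
         (auto intro: has_vector_derivative_at_within partial_l_derivative[OF f(1)])
    then show ?thesis by (simp add: integral_unique)
  qed
  have step: "partial_a f (a, l) = partial_a f (a, m) + integral {m..l} (\<lambda>s. ?fla (a, s))" if "m \<le> l" for l
  proof -
    have "((\<lambda>x. integral (cbox m l) (\<lambda>s. ?fl (x, s))) has_vector_derivative integral (cbox m l) (\<lambda>s. ?fla (a, s))) (at a within UNIV)"
    proof (rule leibniz_rule_vector_derivative[where U=UNIV])
      show "((\<lambda>x. ?fl (x, t)) has_vector_derivative ?fla (x, t)) (at x within UNIV)" for x t
        using partial_a_derivative[OF fl(1)] by simp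
      show "(\<lambda>s. ?fl (x, s)) integrable_on cbox m l" for x
        using cont[OF fl(4)] by (intro integrable_continuous) (auto intro: continuous_on_subset)
      show "continuous_on (UNIV \<times> cbox m l) (\<lambda>(x, t). ?fla (x, t))"
        using C_infinity_partials(4)[OF fl(2)] by (auto intro: continuous_on_subset)
    qed auto
    then have "((\<lambda>x. f (x, m) + integral {m..l} (\<lambda>s. ?fl (x, s))) has_vector_derivative
        partial_a f (a, m) + integral {m..l} (\<lambda>s. ?fla (a, s))) (at a)"
      by (intro has_vector_derivative_add partial_a_derivative[OF f(1)]) simp
    then have "((\<lambda>x. f (x, l)) has_vector_derivative
        partial_a f (a, m) + integral {m..l} (\<lambda>s. ?fla (a, s))) (at a)"
      using int[OF that] by simp
    then show ?thesis
      using partial_a_derivative[OF f(1), of l a] vector_derivative_unique_at by blast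
  qed
  have "((\<lambda>l. integral {m..l} (\<lambda>s. ?fla (a, s))) has_vector_derivative ?fla (a, l0)) (at l0 within {m..l0 + 1})"
    by (rule integral_has_vector_derivative)
       (use cont[OF C_infinity_partials(4)[OF fl(2)]] in \<open>auto simp: m_def intro: continuous_on_subset\<close>)
  then have "((\<lambda>l. integral {m..l} (\<lambda>s. ?fla (a, s))) has_vector_derivative ?fla (a, l0)) (at l0)"
    by (subst (asm) at_within_Icc_at) (auto simp: m_def)
  then have "((\<lambda>l. partial_a f (a, m) + integral {m..l} (\<lambda>s. ?fla (a, s))) has_vector_derivative 0 + ?fla (a, l0)) (at l0)"
    by (intro has_vector_derivative_add) auto
  then have d: "((\<lambda>l. partial_a f (a, m) + integral {m..l} (\<lambda>s. ?fla (a, s))) has_vector_derivative ?fla (a, l0)) (at l0)"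
    by simp
  show "((\<lambda>l. partial_a f (a, l)) has_vector_derivative ?fla (a, l0)) (at l0)"
  proof (rule has_vector_derivative_transform_within_open[OF d, of "{m<..}"])
    show "partial_a f (a, m) + integral {m..l} (\<lambda>s. ?fla (a, s)) = partial_a f (a, l)" if "l \<in> {m<..}" for l
      by (rule step[symmetric]) (use that in simp)
  qed (auto simp: m_def)
qed

lemma C_infinity_iterated:
  assumes "C_infinity f"
  shows "C_infinity ((partial_l ^^ n) f)" "C_infinity ((partial_a ^^ p) f)"
proof -
  show "C_infinity ((partial_l ^^ n) f)" by (induction n) (auto simp: assms C_infinity_partials)
  show "C_infinity ((partial_a ^^ p) f)" by (induction p) (auto simp: assms C_infinity_partials)
qed

lemma partial_l_iterated_partial_a:
  assumes "C_infinity f"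
  shows "partial_l ((partial_a ^^ p) f) = (partial_a ^^ p) (partial_l f)"
proof (induction p)
  case (Suc p)
  then show ?case using partial_a_partial_l_commute[OF C_infinity_iterated(2)[OF assms, of p]] by simp
qed simp

text \<open>A sequence that is bounded in the Schwartz topology.\<close>

definition bounded_family :: "(nat \<Rightarrow> orbit_fun) \<Rightarrow> bool" where
  "bounded_family F \<longleftrightarrow> (\<forall>n. F n \<in> schwartz_space) \<and> (\<forall>i. \<exists>C. \<forall>n x. schwartz_term i (F n) x \<le> C)"

lemma one_plus_power_le: "0 \<le> x \<Longrightarrow> (1 + x) ^ m \<le> 2 ^ m * (1 + (x::real) ^ m)"
proof -
  assume x: "0 \<le> x"
  show ?thesis
  proof (cases "x \<le> 1")
    case True
    then have "(1 + x) ^ m \<le> 2 ^ m" using x by (intro power_mono) auto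
    also have "\<dots> \<le> 2 ^ m * (1 + x ^ m)" using x by simp
    finally show ?thesis .
  next
    case False
    then have "(1 + x) ^ m \<le> (2 * x) ^ m" using x by (intro power_mono) auto
    also have "\<dots> \<le> 2 ^ m * (1 + x ^ m)" by (simp add: power_mult_distrib)
    finally show ?thesis .
  qed
qed

text \<open>
  The seminorms divide by \<open>cosh (2 a) ^ p\<close>, which a larger power of \<open>sinh (2 a)\<close> compensates. As
  \<open>sinh\<close> vanishes at \<open>0\<close>, the seminorms with \<open>k = 0\<close> are needed as well, and likewise those with
  \<open>q = 0\<close> for \<open>l\<close>; this gives four terms.
\<close>

proposition bounded_family_rapid:
  assumes "bounded_family F"
  shows "rapid orbit_weight (\<lambda>n a l. F n (a, l))"
proof -
  define D :: "nat \<Rightarrow> nat \<Rightarrow> fun_family" where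
    "D p n = (\<lambda>m a l. (partial_a ^^ p) ((partial_l ^^ n) (F m)) (a, l))" for p n
  have C: "C_infinity (F m)" for m using assms by (auto simp: bounded_family_def schwartz_space_def)
  have partials: "partials (D p n) (D (Suc p) n) (D p (Suc n))" for p n
  proof -
    have 1: "C_infinity ((partial_l ^^ n) (F m))" for m using C_infinity_iterated(1)[OF C] .
    have 2: "(partial_a ^^ p) ((partial_l ^^ n) (F m)) differentiable_on UNIV" for m
      using C_infinity_partials(1)[OF C_infinity_iterated(2)[OF 1]] .
    show ?thesis
      using partial_a_derivative[OF 2] partial_l_derivative[OF 2] partial_l_iterated_partial_a[OF 1]
      by (simp add: partials_def D_def)
  qed
  have dec: "decays orbit_weight (D p n)" for p n
    unfolding decays_def
  proof
    fix N
    let ?t = "\<lambda>k q. \<exists>C. \<forall>m x. schwartz_term (k, p, q, n) (F m) x \<le> C"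
    have t: "?t k q" for k q using assms by (auto simp: bounded_family_def)
    let ?q = "2 * N" and ?k = "N + p"
    obtain C00 C01 C10 C11 where
      B: "\<And>m x. schwartz_term (0, p, 0, n) (F m) x \<le> C00" "\<And>m x. schwartz_term (0, p, ?q, n) (F m) x \<le> C01"
         "\<And>m x. schwartz_term (?k, p, 0, n) (F m) x \<le> C10" "\<And>m x. schwartz_term (?k, p, ?q, n) (F m) x \<le> C11"
      using t[of 0 0] t[of 0 ?q] t[of ?k 0] t[of ?k ?q] by blast
    have "orbit_weight a l ^ N * cmod (D p n m a l) \<le> 2 ^ ?k * 2 ^ N * (C00 + C01 + C10 + C11)" for m a l
    proof -
      define c s d where "c = cosh (2 * a)" and "s = \<bar>sinh (2 * a)\<bar>" and "d = cmod (D p n m a l)"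
      have c: "c > 0" "c \<le> 1 + s" and s: "s \<ge> 0" and d: "d \<ge> 0"
        by (auto simp: c_def s_def d_def cosh_le_1_sinh)
      have expand: "((K * (1 + S)) * (L * (1 + Q))) * (x / e) = K * L * (1 / e * 1 * x + 1 / e * Q * x + S / e * 1 * x + S / e * Q * x)"
        for K S L Q x e :: real by (simp add: divide_inverse algebra_simps)
      have sterm: "schwartz_term (k, p, q, n) (F m) (a, l) = s ^ k / c ^ p * \<bar>l\<bar> ^ q * d" for k q
        by (simp add: schwartz_term_def c_def s_def d_def D_def norm_mult norm_divide norm_power)
      have "c ^ ?k \<le> 2 ^ ?k * (1 + s ^ ?k)"
        using power_mono[OF c(2), of ?k] one_plus_power_le[OF s, of ?k] c(1) by linarith
      moreover have "(1 + l\<^sup>2) ^ N \<le> 2 ^ N * (1 + \<bar>l\<bar> ^ ?q)"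
        using one_plus_power_le[of "l\<^sup>2" N] by (simp add: power_mult)
      ultimately have "c ^ ?k * (1 + l\<^sup>2) ^ N \<le> (2 ^ ?k * (1 + s ^ ?k)) * (2 ^ N * (1 + \<bar>l\<bar> ^ ?q))"
        using c s by (intro mult_mono) auto
      then have A1: "(c ^ ?k * (1 + l\<^sup>2) ^ N) * (d / c ^ p) \<le> ((2 ^ ?k * (1 + s ^ ?k)) * (2 ^ N * (1 + \<bar>l\<bar> ^ ?q))) * (d / c ^ p)"
        using c d by (intro mult_right_mono) auto
      have A2: "(c ^ ?k * (1 + l\<^sup>2) ^ N) * (d / c ^ p) = orbit_weight a l ^ N * d"
        using c by (simp add: orbit_weight_def c_def[symmetric] power_add power_mult_distrib)
      have A3: "((2 ^ ?k * (1 + s ^ ?k)) * (2 ^ N * (1 + \<bar>l\<bar> ^ ?q))) * (d / c ^ p) =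
          2 ^ ?k * 2 ^ N * (s ^ 0 / c ^ p * \<bar>l\<bar> ^ 0 * d + s ^ 0 / c ^ p * \<bar>l\<bar> ^ ?q * d
            + s ^ ?k / c ^ p * \<bar>l\<bar> ^ 0 * d + s ^ ?k / c ^ p * \<bar>l\<bar> ^ ?q * d)"
        by (simp only: power_0 expand)
      have A4: "2 ^ ?k * 2 ^ N * (s ^ 0 / c ^ p * \<bar>l\<bar> ^ 0 * d + s ^ 0 / c ^ p * \<bar>l\<bar> ^ ?q * d
            + s ^ ?k / c ^ p * \<bar>l\<bar> ^ 0 * d + s ^ ?k / c ^ p * \<bar>l\<bar> ^ ?q * d)
          \<le> 2 ^ ?k * 2 ^ N * (C00 + C01 + C10 + C11)"
        unfolding sterm[symmetric] by (intro mult_left_mono add_mono B) auto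
      have "orbit_weight a l ^ N * d \<le> 2 ^ ?k * 2 ^ N * (C00 + C01 + C10 + C11)"
        by (rule order_trans[OF ord_eq_le_trans[OF A2[symmetric] ord_le_eq_trans[OF A1 A3]] A4])
      then show ?thesis unfolding d_def .
    qed
    then show "\<exists>C. \<forall>m a l. orbit_weight a l ^ N * cmod (D p n m a l) \<le> C" by blast
  qed
  have "smooth (decays orbit_weight) k (D p n)" for k p n
  proof (induction k arbitrary: p n)
    case (Suc k)
    then show ?case using dec partials smooth.simps(2) by blast
  qed (simp add: dec)
  then have "rapid orbit_weight (D 0 0)" by (simp add: rapid_def)
  then show ?thesis by (simp add: D_def)
qed

lemma partials_partial:
  assumes "partials G Ga Gl"
  shows "partial_a (case_prod (G n)) = case_prod (Ga n)" "partial_l (case_prod (G n)) = case_prod (Gl n)"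
  using assms by (auto simp: partials_def intro!: partial_a_eqI partial_l_eqI)

lemma partials_differentiable:
  assumes "partials G Ga Gl" and cont: "continuous_on UNIV (\<lambda>p. Gl n (fst p) (snd p))"
  shows "case_prod (G n) differentiable_on UNIV"
proof -
  have "((\<lambda>(x, y). G n x y) has_derivative (\<lambda>(tx, ty). tx *\<^sub>R Ga n a l + blinfun_scaleR_left (Gl n a l) ty)) (at (a, l) within UNIV \<times> UNIV)" for a l
  proof (rule has_derivative_partialsI)
    show "((\<lambda>x. G n x l) has_derivative (\<lambda>tx. tx *\<^sub>R Ga n a l)) (at a within UNIV)"
      using assms(1) by (simp add: partials_def has_vector_derivative_def)
    show "((\<lambda>y. G n x y) has_derivative blinfun_apply (blinfun_scaleR_left (Gl n x y))) (at y within UNIV)" for x y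
      using assms(1) by (simp add: partials_def has_vector_derivative_def)
    have "continuous_on UNIV (\<lambda>p. blinfun_scaleR_left (Gl n (fst p) (snd p)))"
      by (intro continuous_intros cont)
    then show "continuous (at (a, l) within UNIV \<times> UNIV) (\<lambda>(x, y). blinfun_scaleR_left (Gl n x y))"
      by (simp add: continuous_on_eq_continuous_at case_prod_unfold)
  qed auto
  then show ?thesis unfolding differentiable_on_def differentiable_def by fastforce
qed

text \<open>
  Iterated derivatives of a rapidly decaying sequence are rapidly decaying sequences, and the continuity of the
  partial derivatives makes the functions differentiable jointly.
\<close>

proposition rapid_bounded_family:
  assumes "rapid orbit_weight G"
  shows "bounded_family (\<lambda>n. case_prod (G n))"
proof -
  have Ck: "rapid orbit_weight G \<Longrightarrow> C_k k (case_prod (G n))" for k n G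
  proof (induction k arbitrary: G)
    case 0
    then show ?case using orbit.rapid_continuous[OF 0, of n] by (simp add: case_prod_unfold)
  next
    case (Suc k)
    obtain Ga Gl where p: "partials G Ga Gl" "rapid orbit_weight Ga" "rapid orbit_weight Gl"
      using orbit.rapid_partials[OF Suc.prems] .
    show ?case
      using partials_differentiable[OF p(1) orbit.rapid_continuous[OF p(3)]] Suc.IH[OF p(2)] Suc.IH[OF p(3)]
      by (simp add: partials_partial[OF p(1)])
  qed
  have it_l: "\<exists>H. rapid orbit_weight H \<and> (\<forall>m. (partial_l ^^ n) (case_prod (G m)) = case_prod (H m))" for n
  proof (induction n)
    case (Suc n)
    then obtain H where H: "rapid orbit_weight H" "\<And>m. (partial_l ^^ n) (case_prod (G m)) = case_prod (H m)" by blast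
    obtain Ha Hl where "partials H Ha Hl" "rapid orbit_weight Ha" "rapid orbit_weight Hl"
      using orbit.rapid_partials[OF H(1)] .
    then show ?case using H(2) partials_partial(2) by auto
  qed (use assms in auto)
  have it_a: "\<exists>H. rapid orbit_weight H \<and> (\<forall>m. (partial_a ^^ p) ((partial_l ^^ n) (case_prod (G m))) = case_prod (H m))" for n p
  proof (induction p)
    case 0
    then show ?case using it_l by simp
  next
    case (Suc p)
    then obtain H where H: "rapid orbit_weight H" "\<And>m. (partial_a ^^ p) ((partial_l ^^ n) (case_prod (G m))) = case_prod (H m)" by blast
    obtain Ha Hl where "partials H Ha Hl" "rapid orbit_weight Ha" "rapid orbit_weight Hl"
      using orbit.rapid_partials[OF H(1)] .
    then show ?case using H(2) partials_partial(1) by auto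
  qed
  have bound: "\<exists>C. \<forall>m x. schwartz_term i (case_prod (G m)) x \<le> C" for i
  proof -
    obtain k p q n where i: "i = (k, p, q, n)" by (cases i)
    obtain H where H: "rapid orbit_weight H" "\<And>m. (partial_a ^^ p) ((partial_l ^^ n) (case_prod (G m))) = case_prod (H m)"
      using it_a by blast
    obtain C where C: "\<And>m a l. cosh (2 * a) ^ k * (1 + l\<^sup>2) ^ q * cmod (H m a l) \<le> C"
      using orbit_decaysE[OF H(1)] by metis
    have "schwartz_term i (case_prod (G m)) (a, l) \<le> C" for m a l
    proof -
      have 1: "\<bar>sinh (2 * a)\<bar> ^ k / cosh (2 * a) ^ p \<le> cosh (2 * a) ^ k"
      proof -
        have "\<bar>sinh (2 * a)\<bar> ^ k / cosh (2 * a) ^ p \<le> \<bar>sinh (2 * a)\<bar> ^ k / 1"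
          by (intro divide_left_mono) (auto simp: one_le_power cosh_real_ge_1)
        also have "\<dots> \<le> cosh (2 * a) ^ k"
          using sinh_le_cosh_real[of "\<bar>2 * a\<bar>"] by (simp add: power_mono del: sinh_le_cosh_real)
        finally show ?thesis .
      qed
      have "0 \<le> (\<bar>l\<bar> - 1)\<^sup>2" by simp
      then have "\<bar>l\<bar> \<le> 1 + l\<^sup>2" by (simp add: power2_diff)
      then have 2: "\<bar>l\<bar> ^ q \<le> (1 + l\<^sup>2) ^ q" by (intro power_mono) auto
      have "schwartz_term i (case_prod (G m)) (a, l) = \<bar>sinh (2 * a)\<bar> ^ k / cosh (2 * a) ^ p * \<bar>l\<bar> ^ q * cmod (H m a l)"
        by (simp add: i schwartz_term_def H(2) norm_mult norm_divide norm_power)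
      also have "\<dots> \<le> cosh (2 * a) ^ k * (1 + l\<^sup>2) ^ q * cmod (H m a l)"
        using 1 2 by (intro mult_right_mono mult_mono) auto
      finally show ?thesis using C[of a l m] by linarith
    qed
    then show ?thesis by auto
  qed
  have "bdd_above (range (schwartz_term i (case_prod (G m))))" for i m
    using bound[of i] unfolding bdd_above_def by blast
  then show ?thesis using bound Ck[OF assms] by (auto simp: bounded_family_def schwartz_space_def C_infinity_def)
qed

definition const_family :: "orbit_fun \<Rightarrow> fun_family" where
  "const_family f = (\<lambda>n a l. f (a, l))"

lemma rapid_const_family:
  assumes "f \<in> schwartz_space"
  shows "rapid orbit_weight (const_family f)"
proof -
  have "bounded_family (\<lambda>n. f)"
    using assms by (fastforce simp: bounded_family_def schwartz_space_def bdd_above_def)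
  then show ?thesis unfolding const_family_def by (rule bounded_family_rapid)
qed

lemma rapid_in_schwartz:
  assumes "rapid orbit_weight G"
  shows "case_prod (G n) \<in> schwartz_space"
  using rapid_bounded_family[OF assms] by (simp add: bounded_family_def)

section \<open>Continuity by boundedness\<close>

lemma schwartz_closed:
  assumes "f \<in> schwartz_space" "g \<in> schwartz_space"
  shows "(\<lambda>x. f x + c * g x) \<in> schwartz_space"
proof -
  have "rapid orbit_weight (\<lambda>n a l. const_family f n a l + c * const_family g n a l)"
    by (intro orbit.rapid_add orbit.rapid_cmult rapid_const_family assms)
  from rapid_in_schwartz[OF this, of 0] show ?thesis by (simp add: const_family_def case_prod_unfold)
qed

lemma schwartz_zero: "(\<lambda>x. 0) \<in> schwartz_space"
proof -
  have "smooth (decays orbit_weight) k (\<lambda>n x y. 0)" for k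
  proof (induction k)
    case (Suc k)
    have "partials (\<lambda>n x y. 0) (\<lambda>n x y. 0) (\<lambda>n x y. 0)" by (simp add: partials_def)
    then show ?case using Suc by (auto simp: decays_def)
  qed (auto simp: decays_def)
  then have "rapid orbit_weight (\<lambda>n x y. 0)" by (simp add: rapid_def)
  from rapid_in_schwartz[OF this] show ?thesis by (simp add: case_prod_unfold)
qed

lemma schwartz_scale: "f \<in> schwartz_space \<Longrightarrow> (\<lambda>x. c * f x) \<in> schwartz_space"
  using schwartz_closed[OF schwartz_zero] by simp

lemma schwartz_diff: "f \<in> schwartz_space \<Longrightarrow> g \<in> schwartz_space \<Longrightarrow> (\<lambda>x. f x - g x) \<in> schwartz_space"
  using schwartz_closed[of f g "-1"] by simp

lemma partial_linear:
  assumes "C_infinity f" "C_infinity g"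
  shows "partial_a (\<lambda>x. f x + c * g x) = (\<lambda>x. partial_a f x + c * partial_a g x)"
    and "partial_l (\<lambda>x. f x + c * g x) = (\<lambda>x. partial_l f x + c * partial_l g x)"
  using assms[THEN C_infinity_partials(1)]
  by (auto intro!: partial_a_eqI partial_l_eqI has_vector_derivative_add has_vector_derivative_mult_right
      partial_a_derivative partial_l_derivative)

lemma iterated_linear:
  assumes "C_infinity f" "C_infinity g"
  shows "(partial_a ^^ p) ((partial_l ^^ n) (\<lambda>x. f x + c * g x)) =
    (\<lambda>x. (partial_a ^^ p) ((partial_l ^^ n) f) x + c * (partial_a ^^ p) ((partial_l ^^ n) g) x)"
proof -
  have 1: "(partial_l ^^ n) (\<lambda>x. f x + c * g x) = (\<lambda>x. (partial_l ^^ n) f x + c * (partial_l ^^ n) g x)"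
    by (induction n) (use assms in \<open>auto simp: partial_linear C_infinity_iterated\<close>)
  show ?thesis unfolding 1
    by (induction p) (use assms in \<open>auto simp: partial_linear C_infinity_iterated\<close>)
qed

lemma schwartz_term_linear:
  assumes "f \<in> schwartz_space" "g \<in> schwartz_space"
  shows "schwartz_term i (\<lambda>x. f x + c * g x) x \<le> schwartz_term i f x + cmod c * schwartz_term i g x"
proof -
  obtain k p q n where i: "i = (k, p, q, n)" by (cases i)
  obtain a l where x: "x = (a, l)" by (cases x)
  have "C_infinity f" "C_infinity g" using assms by (auto simp: schwartz_space_def)
  note it = iterated_linear[OF this, of p n c]
  let ?w = "complex_of_real (sinh (2 * a) ^ k / cosh (2 * a) ^ p * l ^ q)"
  have "cmod (w * (z + c * z')) \<le> cmod (w * z) + cmod c * cmod (w * z')" for w z z'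
    unfolding distrib_left by (rule order_trans[OF norm_triangle_ineq]) (simp add: norm_mult mult_ac)
  from this[of ?w] show ?thesis unfolding i x schwartz_term_def it prod.case .
qed

lemma schwartz_term_nonneg: "0 \<le> schwartz_term i f x"
  by (cases i, cases x) (simp add: schwartz_term_def)

lemma schwartz_term_le_seminorm:
  assumes "f \<in> schwartz_space"
  shows "schwartz_term i f x \<le> schwartz_seminorm i f"
proof -
  have "\<forall>i. bdd_above (range (schwartz_term i f))" using assms unfolding schwartz_space_def mem_Collect_eq by (rule conjunct2)
  then have "bdd_above (range (schwartz_term i f))" by (rule spec)
  then show ?thesis unfolding schwartz_seminorm_def by (intro cSUP_upper) auto
qed

lemma schwartz_seminorm_leI:
  "(\<And>x. schwartz_term i f x \<le> C) \<Longrightarrow> schwartz_seminorm i f \<le> C"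
  unfolding schwartz_seminorm_def by (rule cSUP_least) auto

lemma schwartz_seminorm_nonneg: "f \<in> schwartz_space \<Longrightarrow> 0 \<le> schwartz_seminorm i f"
  using schwartz_term_le_seminorm[of f i undefined] schwartz_term_nonneg[of i f undefined] by linarith

lemma schwartz_seminorm_linear:
  assumes "f \<in> schwartz_space" "g \<in> schwartz_space"
  shows "schwartz_seminorm i (\<lambda>x. f x + c * g x) \<le> schwartz_seminorm i f + cmod c * schwartz_seminorm i g"
proof (rule schwartz_seminorm_leI)
  fix x
  show "schwartz_term i (\<lambda>x. f x + c * g x) x \<le> schwartz_seminorm i f + cmod c * schwartz_seminorm i g"
    by (rule order_trans[OF schwartz_term_linear[OF assms]])
       (intro add_mono mult_left_mono schwartz_term_le_seminorm assms norm_ge_zero)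
qed

lemma schwartz_seminorm_zero: "schwartz_seminorm i (\<lambda>x. 0) = 0"
proof -
  have z: "partial_a (\<lambda>x. 0) = (\<lambda>x. 0)" "partial_l (\<lambda>x. 0) = (\<lambda>x. 0)"
    by (auto simp: partial_a_def partial_l_def)
  have 1: "(partial_l ^^ n) (\<lambda>x. 0) = (\<lambda>x. 0)" for n by (induction n) (auto simp: z)
  have 2: "(partial_a ^^ n) (\<lambda>x. 0) = (\<lambda>x. 0)" for n by (induction n) (auto simp: z)
  have "schwartz_term i (\<lambda>x. 0) x = 0" for x
    by (cases i, cases x) (simp add: schwartz_term_def 1 2)
  then show ?thesis by (simp add: schwartz_seminorm_def)
qed

lemma schwartz_seminorm_scale_le:
  "g \<in> schwartz_space \<Longrightarrow> schwartz_seminorm i (\<lambda>x. c * g x) \<le> cmod c * schwartz_seminorm i g"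
  using schwartz_seminorm_linear[OF schwartz_zero, of g i c] by (simp add: schwartz_seminorm_zero)

lemma topspace_schwartz [simp]: "topspace schwartz_topology = schwartz_space"
  unfolding schwartz_topology_def topology_generated_by_topspace
proof (intro equalityI subsetI)
  fix f assume f: "f \<in> schwartz_space"
  let ?U = "{g \<in> schwartz_space. schwartz_seminorm (0, 0, 0, 0) (\<lambda>x. g x - f x) < 1}"
  show "f \<in> \<Union>{{g \<in> schwartz_space. schwartz_seminorm i (\<lambda>x. g x - f x) < e} | i f e. f \<in> schwartz_space \<and> e > 0}"
  proof (rule UnionI[of ?U])
    show "?U \<in> {{g \<in> schwartz_space. schwartz_seminorm i (\<lambda>x. g x - f x) < e} | i f e. f \<in> schwartz_space \<and> e > 0}"
      using f zero_less_one by blast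
    show "f \<in> ?U" using f by (simp add: schwartz_seminorm_zero)
  qed
qed auto

lemma openin_schwartz_ball:
  assumes "finite J" "f \<in> schwartz_space" "(d::real) > 0"
  shows "openin schwartz_topology {g \<in> schwartz_space. \<forall>j\<in>J. schwartz_seminorm j (\<lambda>x. g x - f x) < d}"
  using \<open>finite J\<close>
proof (induction J)
  case empty
  then show ?case using openin_topspace[of schwartz_topology] by simp
next
  case (insert i J)
  have "openin schwartz_topology {g \<in> schwartz_space. schwartz_seminorm i (\<lambda>x. g x - f x) < d}"
    unfolding schwartz_topology_def using assms by (intro topology_generated_by_Basis) blast
  from openin_Int[OF this insert.IH] show ?case by (rule back_subst) auto
qed

text \<open>
  If no finite set of seminorms dominated \<open>q\<close>, there would be functions \<open>f m\<close> on which \<open>q\<close> exceeds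
  \<open>m + 1\<close> times the sum of the first seminorms. Scaled so that \<open>q\<close> takes the value \<open>m + 1\<close>, they form a
  bounded sequence, since each seminorm is among the first ones from some \<open>m\<close> on, although \<open>q\<close> is unbounded on it.
\<close>

lemma bounded_imp_seminorm_estimate:
  assumes hom: "\<And>c f. f \<in> schwartz_space \<Longrightarrow> q (\<lambda>x. complex_of_real c * f x) = \<bar>c\<bar> * q f"
    and bdd: "\<And>F. bounded_family F \<Longrightarrow> \<exists>C. \<forall>n. q (F n) \<le> C"
  obtains J C where "finite J" "C > 0" "\<And>f. f \<in> schwartz_space \<Longrightarrow> q f \<le> C * (\<Sum>j\<in>J. schwartz_seminorm j f)"
proof (rule ccontr)
  assume neg: "\<not> thesis"
  define J :: "nat \<Rightarrow> (nat \<times> nat \<times> nat \<times> nat) set" where "J m = {..m} \<times> {..m} \<times> {..m} \<times> {..m}" for m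
  have "\<exists>f. f \<in> schwartz_space \<and> q f > real (Suc m) * (\<Sum>j\<in>J m. schwartz_seminorm j f)" for m
  proof (rule ccontr)
    assume *: "\<not> ?thesis"
    have "finite (J m)" by (simp add: J_def)
    moreover have "q f \<le> real (Suc m) * (\<Sum>j\<in>J m. schwartz_seminorm j f)" if "f \<in> schwartz_space" for f
      using * that by (meson not_less)
    ultimately show False using neg that[of "J m" "real (Suc m)"] by simp
  qed
  then obtain f where f: "\<And>m. f m \<in> schwartz_space"
      "\<And>m. q (f m) > real (Suc m) * (\<Sum>j\<in>J m. schwartz_seminorm j (f m))" by metis
  have J_nonneg: "0 \<le> (\<Sum>j\<in>J m. schwartz_seminorm j (f m))" for m
    by (intro sum_nonneg schwartz_seminorm_nonneg f)
  have qpos: "q (f m) > 0" for m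
    using f(2)[of m] mult_nonneg_nonneg[OF _ J_nonneg, of "real (Suc m)" m] by linarith
  define g where "g m = (\<lambda>x. complex_of_real (real (Suc m) / q (f m)) * f m x)" for m
  have gS: "g m \<in> schwartz_space" for m unfolding g_def by (intro schwartz_scale f)
  have gq: "q (g m) = real (Suc m)" for m
    unfolding g_def using qpos[of m] by (subst hom[OF f(1)]) simp
  have gJ: "schwartz_seminorm j (g m) \<le> 1" if "j \<in> J m" for j m
  proof -
    have "schwartz_seminorm j (g m) \<le> real (Suc m) / q (f m) * schwartz_seminorm j (f m)"
      unfolding g_def using schwartz_seminorm_scale_le[OF f(1), of j "complex_of_real (real (Suc m) / q (f m))" m] qpos[of m]
      by (simp add: norm_divide del: of_nat_Suc)
    also have "schwartz_seminorm j (f m) \<le> (\<Sum>j\<in>J m. schwartz_seminorm j (f m))"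
      using that f by (intro member_le_sum schwartz_seminorm_nonneg) (auto simp: J_def)
    then have "real (Suc m) / q (f m) * schwartz_seminorm j (f m) \<le> real (Suc m) / q (f m) * (\<Sum>j\<in>J m. schwartz_seminorm j (f m))"
      using qpos[of m] by (intro mult_left_mono) auto
    also have "\<dots> \<le> 1" using f(2)[of m] qpos[of m] by (simp add: divide_simps)
    finally show ?thesis .
  qed
  have "bounded_family g"
    unfolding bounded_family_def
  proof (intro conjI allI gS)
    fix i :: "nat \<times> nat \<times> nat \<times> nat"
    obtain k p q n where i: "i = (k, p, q, n)" by (cases i)
    define m0 where "m0 = k + p + q + n"
    have "schwartz_seminorm i (g m) \<le> (\<Sum>m<m0. schwartz_seminorm i (g m)) + 1" for m
    proof (cases "m < m0")
      case True
      then have "schwartz_seminorm i (g m) \<le> (\<Sum>m<m0. schwartz_seminorm i (g m))"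
        by (intro member_le_sum schwartz_seminorm_nonneg gS) auto
      then show ?thesis by simp
    next
      case False
      then have "schwartz_seminorm i (g m) \<le> 1" by (intro gJ) (auto simp: J_def i m0_def)
      moreover have "0 \<le> (\<Sum>m<m0. schwartz_seminorm i (g m))" by (intro sum_nonneg schwartz_seminorm_nonneg gS)
      ultimately show ?thesis by simp
    qed
    then show "\<exists>C. \<forall>m x. schwartz_term i (g m) x \<le> C"
      using schwartz_term_le_seminorm[OF gS] by (meson order_trans)
  qed
  then obtain C where "\<And>n. real (Suc n) \<le> C" using bdd gq by metis
  moreover obtain n where "C < real n" using reals_Archimedean2 by blast
  ultimately show False using less_le_not_le order_trans[of "real n" "real (Suc n)" C] by fastforce
qed

lemma bounded_imp_small_neighbourhood:
  assumes "\<And>c f. f \<in> schwartz_space \<Longrightarrow> q (\<lambda>x. complex_of_real c * f x) = \<bar>c\<bar> * q f"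
    and "\<And>F. bounded_family F \<Longrightarrow> \<exists>C. \<forall>n. q (F n) \<le> C"
    and f: "f \<in> schwartz_space" and "r > (0::real)"
  obtains U where "openin schwartz_topology U" "f \<in> U" "\<And>g. g \<in> U \<Longrightarrow> g \<in> schwartz_space \<and> q (\<lambda>x. g x - f x) < r"
proof -
  obtain J C where J: "finite J" "C > 0" "\<And>f. f \<in> schwartz_space \<Longrightarrow> q f \<le> C * (\<Sum>j\<in>J. schwartz_seminorm j f)"
    using bounded_imp_seminorm_estimate[of q, OF assms(1,2)] by blast
  define d where "d = r / (C * (real (card J) + 1))"
  have d: "d > 0" using J \<open>r > 0\<close> by (simp add: d_def)
  let ?U = "{g \<in> schwartz_space. \<forall>j\<in>J. schwartz_seminorm j (\<lambda>x. g x - f x) < d}"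
  have "q (\<lambda>x. g x - f x) < r" if g: "g \<in> ?U" for g
  proof -
    have "q (\<lambda>x. g x - f x) \<le> C * (\<Sum>j\<in>J. schwartz_seminorm j (\<lambda>x. g x - f x))"
      using g f by (intro J schwartz_diff) auto
    also have "\<dots> \<le> C * (\<Sum>j\<in>J. d)" using g J(2) by (intro mult_left_mono sum_mono) (auto intro: less_imp_le)
    also have "\<dots> = C * real (card J) * d" by simp
    also have "\<dots> < C * (real (card J) + 1) * d" using J(2) d by (simp add: algebra_simps)
    also have "\<dots> = r" using J(2) by (simp add: d_def)
    finally show ?thesis .
  qed
  then show thesis
    using openin_schwartz_ball[OF J(1) f d] f d by (intro that[of ?U]) (auto simp: schwartz_seminorm_zero)
qed

proposition continuous_functional:
  fixes T :: "orbit_fun \<Rightarrow> complex"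
  assumes add: "\<And>f g c. f \<in> schwartz_space \<Longrightarrow> g \<in> schwartz_space \<Longrightarrow> T (\<lambda>x. f x + c * g x) = T f + c * T g"
    and bdd: "\<And>F. bounded_family F \<Longrightarrow> \<exists>C. \<forall>n. cmod (T (F n)) \<le> C"
  shows "continuous_map schwartz_topology euclidean T"
  unfolding continuous_map_def
proof (intro conjI allI impI)
  have T0: "T (\<lambda>x. 0) = 0" using add[OF schwartz_zero schwartz_zero, of 1] by simp
  have hom: "cmod (T (\<lambda>x. complex_of_real c * f x)) = \<bar>c\<bar> * cmod (T f)" if "f \<in> schwartz_space" for c f
    using add[OF schwartz_zero that, of "complex_of_real c"] by (simp add: T0 norm_mult)
  fix U :: "complex set"
  assume "openin euclidean U"
  then have U: "open U" by simp
  show "openin schwartz_topology {f \<in> topspace schwartz_topology. T f \<in> U}"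
    unfolding openin_subopen[of _ "{f \<in> topspace schwartz_topology. T f \<in> U}"]
  proof
    fix f assume "f \<in> {f \<in> topspace schwartz_topology. T f \<in> U}"
    then have f: "f \<in> schwartz_space" "T f \<in> U" by auto
    obtain r where r: "r > 0" "ball (T f) r \<subseteq> U" using U f(2) openE by blast
    obtain V where V: "openin schwartz_topology V" "f \<in> V"
        "\<And>g. g \<in> V \<Longrightarrow> g \<in> schwartz_space \<and> cmod (T (\<lambda>x. g x - f x)) < r"
      using bounded_imp_small_neighbourhood[of "\<lambda>f. cmod (T f)", OF hom bdd f(1) r(1)] by blast
    have "T g \<in> U" if "g \<in> V" for g
    proof -
      have "T (\<lambda>x. g x - f x) = T g - T f" using add[of g f "-1"] V(3)[OF that] f(1) by simp
      then show ?thesis using V(3)[OF that] r(2) by (auto simp: dist_norm norm_minus_commute)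
    qed
    then show "\<exists>V. openin schwartz_topology V \<and> f \<in> V \<and> V \<subseteq> {f \<in> topspace schwartz_topology. T f \<in> U}"
      using V by auto
  qed
qed simp

proposition continuous_operator:
  assumes S: "\<And>f. f \<in> schwartz_space \<Longrightarrow> L f \<in> schwartz_space"
    and add: "\<And>f g c. f \<in> schwartz_space \<Longrightarrow> g \<in> schwartz_space \<Longrightarrow> L (\<lambda>x. f x + c * g x) = (\<lambda>x. L f x + c * L g x)"
    and bdd: "\<And>F. bounded_family F \<Longrightarrow> bounded_family (\<lambda>n. L (F n))"
  shows "continuous_map schwartz_topology schwartz_topology L"
proof -
  let ?B = "{{g \<in> schwartz_space. schwartz_seminorm i (\<lambda>x. g x - f x) < e} | i f e. f \<in> schwartz_space \<and> e > 0}"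
  have L0: "L (\<lambda>x. 0) = (\<lambda>x. 0)" using add[OF schwartz_zero schwartz_zero, of "-1"] by (simp add: fun_eq_iff)
  have Lc: "L (\<lambda>x. c * f x) = (\<lambda>x. c * L f x)" if "f \<in> schwartz_space" for c f
    using add[OF schwartz_zero that, of c] by (simp add: L0)
  have hom: "schwartz_seminorm i (L (\<lambda>x. complex_of_real c * f x)) = \<bar>c\<bar> * schwartz_seminorm i (L f)" if "f \<in> schwartz_space" for c f i
  proof (rule antisym)
    have le: "schwartz_seminorm i (\<lambda>x. complex_of_real c * L f x) \<le> \<bar>c\<bar> * schwartz_seminorm i (L f)"
      if "f \<in> schwartz_space" for c f
      using schwartz_seminorm_scale_le[OF S[OF that], of i "complex_of_real c"] by simp
    show "schwartz_seminorm i (L (\<lambda>x. complex_of_real c * f x)) \<le> \<bar>c\<bar> * schwartz_seminorm i (L f)"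
      unfolding Lc[OF that] by (rule le[OF that])
    show "\<bar>c\<bar> * schwartz_seminorm i (L f) \<le> schwartz_seminorm i (L (\<lambda>x. complex_of_real c * f x))"
    proof (cases "c = 0")
      case False
      have "schwartz_seminorm i (L f) \<le> \<bar>1 / c\<bar> * schwartz_seminorm i (L (\<lambda>x. complex_of_real c * f x))"
        using le[OF schwartz_scale[OF that, of "complex_of_real c"], of "1 / c"] False by (simp add: Lc[OF that])
      then show ?thesis using False by (simp add: field_simps)
    qed (simp add: L0 schwartz_seminorm_zero)
  qed
  have bdd': "\<exists>C. \<forall>n. schwartz_seminorm i (L (F n)) \<le> C" if "bounded_family F" for F i
    using bdd[OF that] unfolding bounded_family_def by (meson schwartz_seminorm_leI)
  show ?thesis
    unfolding schwartz_topology_def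
  proof (rule continuous_on_generated_topo, fold schwartz_topology_def)
    have "\<Union> ?B = schwartz_space"
      using topspace_schwartz unfolding schwartz_topology_def topology_generated_by_topspace .
    then show "L ` topspace schwartz_topology \<subseteq> \<Union> ?B" using S by auto
  next
    fix U assume "U \<in> ?B"
    then obtain i f0 e where U: "U = {g \<in> schwartz_space. schwartz_seminorm i (\<lambda>x. g x - f0 x) < e}"
      and f0: "f0 \<in> schwartz_space" "e > 0" by blast
    show "openin schwartz_topology (L -` U \<inter> topspace schwartz_topology)"
      unfolding openin_subopen[of _ "L -` U \<inter> topspace schwartz_topology"]
    proof
      fix f assume "f \<in> L -` U \<inter> topspace schwartz_topology"
      then have f: "f \<in> schwartz_space" "schwartz_seminorm i (\<lambda>x. L f x - f0 x) < e" by (auto simp: U)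
      define r where "r = e - schwartz_seminorm i (\<lambda>x. L f x - f0 x)"
      have r: "r > 0" using f by (simp add: r_def)
      obtain V where V: "openin schwartz_topology V" "f \<in> V"
        "\<And>g. g \<in> V \<Longrightarrow> g \<in> schwartz_space \<and> schwartz_seminorm i (L (\<lambda>x. g x - f x)) < r"
        using bounded_imp_small_neighbourhood[of "\<lambda>f. schwartz_seminorm i (L f)", OF hom bdd' f(1) r] by blast
      have "L g \<in> U" if "g \<in> V" for g
      proof -
        have g: "g \<in> schwartz_space" using V(3)[OF that] by simp
        have "L (\<lambda>x. g x - f x) = (\<lambda>x. L g x - L f x)" using add[OF g f(1), of "-1"] by simp
        then have "schwartz_seminorm i (\<lambda>x. L g x - L f x) < r" using V(3)[OF that] by simp
        moreover have "schwartz_seminorm i (\<lambda>x. L g x - f0 x) \<le>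
           schwartz_seminorm i (\<lambda>x. L f x - f0 x) + schwartz_seminorm i (\<lambda>x. L g x - L f x)"
          using schwartz_seminorm_linear[OF schwartz_diff[OF S[OF f(1)] f0(1)] schwartz_diff[OF S[OF g] S[OF f(1)]], of i 1]
          by simp
        ultimately show ?thesis using S[OF g] by (simp add: U r_def)
      qed
      then show "\<exists>V. openin schwartz_topology V \<and> f \<in> V \<and> V \<subseteq> L -` U \<inter> topspace schwartz_topology"
        using V by auto
    qed
  qed
qed

section \<open>The star product in Fourier coordinates\<close>

text \<open>One power of \<open>cosh (2 a)\<close> pays for integrability in \<open>a\<close>.\<close>

lemma trade_cosh_for_bump:
  assumes "cosh (2 * a) * x \<le> C * bump b" "0 \<le> C"
  shows "x \<le> C * (bump a * bump b)"
proof -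
  have "x \<le> (C * bump b) * (1 / cosh (2 * a))"
    using assms(1) by (simp add: pos_le_divide_eq mult_ac)
  also have "\<dots> \<le> (C * bump b) * bump a"
    using assms(2) bump_pos[of b] by (intro mult_left_mono inverse_cosh_le_bump) auto
  finally show ?thesis by (simp add: mult_ac)
qed

lemma orbit_tensor_bound:
  assumes "rapid orbit_weight f"
  obtains C where "C > 0" "\<And>n a l. cosh (2 * a) ^ N * cmod (f n a l) \<le> C * (bump a * bump l)"
proof -
  obtain C where C: "C > 0" "\<And>n a l. cosh (2 * a) ^ Suc N * cmod (f n a l) \<le> C * bump l"
    using orbit_bump_bound[OF assms] by metis
  show thesis by (rule that[OF C(1) trade_cosh_for_bump]) (use C in \<open>auto simp: mult.assoc\<close>)
qed

lemma cosh_tensor_bound: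
  assumes "rapid cosh_weight f"
  obtains C where "C > 0" "\<And>n a b. cosh (2 * a) ^ N * cmod (f n a b) \<le> C * (bump a * bump b)"
proof -
  obtain C where C: "C > 0" "\<And>n a b. cosh (2 * a) ^ Suc N * cmod (f n a b) \<le> C * bump b"
    using cosh_bump_bound[OF assms] by metis
  show thesis by (rule that[OF C(1) trade_cosh_for_bump]) (use C in \<open>auto simp: mult.assoc\<close>)
qed

lemma schwartz_continuous: "f \<in> schwartz_space \<Longrightarrow> continuous_on UNIV f"
  using C_infinity_partials(4) by (auto simp: schwartz_space_def)

lemma root_cosh_diff_le: "root_cosh (x - y) \<le> 2 * cosh (2 * x) * cosh (2 * y)"
  using root_cosh_le[of "x - y"] cosh_le_split[of "2 * (x - y)" "2 * x" "2 * y"] by simp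

lemma root_cosh_commute: "root_cosh (x - y) = root_cosh (y - x)"
  using cosh_minus[of "2 * (x - y)"] by simp

definition weighted_fourier :: "real \<Rightarrow> fun_family \<Rightarrow> fun_family" where
  "weighted_fourier c f = (\<lambda>n a b. complex_of_real (root_cosh b) * fiber_fourier c f n a b)"

lemma rapid_weighted_fourier:
  "c \<noteq> 0 \<Longrightarrow> rapid orbit_weight f \<Longrightarrow> rapid cosh_weight (weighted_fourier c f)"
  unfolding weighted_fourier_def by (intro cosh2.rapid_mult slow_root_cosh rapid_fiber_fourier)

definition star_kernel :: "real \<Rightarrow> real \<Rightarrow> real \<Rightarrow> real \<Rightarrow> real" where
  "star_kernel \<theta> a a1 a2 = cosh (2 * (a1 - a2)) *
     (P_fun \<theta> (4 / \<theta> * (a1 - a)) * P_fun \<theta> (4 / \<theta> * (a - a2)) / (P_fun \<theta> (4 / \<theta> * (a1 - a2)) * P_fun \<theta> 0))"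

lemma star_kernel_eq:
  assumes "\<theta> \<noteq> 0"
  shows "star_kernel \<theta> a a1 a2 = root_cosh (a1 - a2) * root_cosh (a1 - a) * root_cosh (a - a2)"
proof -
  have P: "P_fun \<theta> (4 / \<theta> * x) = root_cosh x" for x
    using assms by (simp add: P_fun_def)
  have "cosh (2 * (a1 - a2)) / root_cosh (a1 - a2) = root_cosh (a1 - a2)" by (rule real_div_sqrt) simp
  moreover have "P_fun \<theta> 0 = 1" by (simp add: P_fun_def)
  ultimately show ?thesis unfolding star_kernel_def P
    by (simp add: field_simps)
qed

text \<open>
  The kernel grows at most like \<open>cosh (2 a1)\<^sup>2 cosh (2 a2)\<^sup>2\<close> for fixed \<open>a\<close>, so the four-dimensional
  integral converges absolutely, and the integrals over \<open>l1\<close> and \<open>l2\<close> are fibre Fourier transforms.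
  The square roots of \<open>cosh (2 (a1 - a))\<close> and \<open>cosh (2 (a - a2))\<close> in the kernel depend only on the frequency
  variables of the two transforms and are absorbed into them.
\<close>

lemma star_product_iterated:
  assumes "\<theta> \<noteq> 0" and f: "f \<in> schwartz_space" and h: "h \<in> schwartz_space"
  defines "c \<equiv> 2 / \<theta>"
  defines "F \<equiv> \<lambda>a l a1 a2. complex_of_real (root_cosh (a1 - a2)) * cis (c * sinh (2 * (a1 - a2)) * l) *
     (weighted_fourier c (const_family f) 0 a1 (a2 - a) * weighted_fourier c (const_family h) 0 a2 (a - a1))"
  shows "star_product \<theta> f h (a, l) = complex_of_real (4 / (pi * \<theta>)\<^sup>2) * (LINT a1|lborel. LINT a2|lborel. F a l a1 a2)"
    and "integrable lborel (\<lambda>z. F a l (fst z) (snd z))"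
proof -
  have c: "c \<noteq> 0" using assms by simp
  note rf = rapid_const_family[OF f] and rh = rapid_const_family[OF h]
  note wf = rapid_weighted_fourier[OF c rf] and wh = rapid_weighted_fourier[OF c rh]
  define A where "A a1 a2 l1 = cis (c * sinh (2 * (a2 - a)) * l1) * f (a1, l1)" for a1 a2 l1
  define B where "B a1 a2 l2 = cis (c * sinh (2 * (a - a1)) * l2) * h (a2, l2)" for a1 a2 l2
  define K where "K a1 a2 = complex_of_real (star_kernel \<theta> a a1 a2) * cis (c * sinh (2 * (a1 - a2)) * l)" for a1 a2
  define J where "J a1 z = K a1 (fst z) * (A a1 (fst z) (fst (snd z)) * B a1 (fst z) (snd (snd z)))"
    for a1 and z :: "real \<times> real \<times> real"
  obtain Cf where Cf: "Cf > 0" "\<And>n a l. cosh (2 * a) ^ 2 * cmod (const_family f n a l) \<le> Cf * (bump a * bump l)"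
    using orbit_tensor_bound[OF rf] by metis
  obtain Ch where Ch: "Ch > 0" "\<And>n a l. cosh (2 * a) ^ 2 * cmod (const_family h n a l) \<le> Ch * (bump a * bump l)"
    using orbit_tensor_bound[OF rh] by metis
  define D where "D = 8 * (cosh (2 * a))\<^sup>2 * Cf * Ch"
  have bound: "cmod (J a1 (a2, l1, l2)) \<le> D * bump a1 * (bump a2 * (bump l1 * bump l2))" for a1 a2 l1 l2
  proof -
    define p q r where pqr: "p = cosh (2 * a1)" "q = cosh (2 * a2)" "r = cosh (2 * a)"
    have pos: "p > 0" "q > 0" "r > 0" by (simp_all add: pqr)
    have "cmod (K a1 a2) = root_cosh (a1 - a2) * root_cosh (a1 - a) * root_cosh (a - a2)"
      unfolding K_def star_kernel_eq[OF \<open>\<theta> \<noteq> 0\<close>] by (simp add: norm_mult)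
    also have "\<dots> \<le> (2 * p * q) * (2 * p * r) * (2 * r * q)"
      unfolding pqr by (intro mult_mono root_cosh_diff_le) auto
    finally have "cmod (K a1 a2) \<le> 8 * r\<^sup>2 * (p\<^sup>2 * q\<^sup>2)" by (simp add: power2_eq_square mult_ac)
    then have "cmod (J a1 (a2, l1, l2)) \<le> 8 * r\<^sup>2 * (p\<^sup>2 * q\<^sup>2) * (cmod (f (a1, l1)) * cmod (h (a2, l2)))"
      unfolding J_def A_def B_def by (simp add: norm_mult mult_right_mono)
    also have "\<dots> = 8 * r\<^sup>2 * ((p\<^sup>2 * cmod (f (a1, l1))) * (q\<^sup>2 * cmod (h (a2, l2))))" by (simp add: mult_ac)
    also have "\<dots> \<le> 8 * r\<^sup>2 * ((Cf * (bump a1 * bump l1)) * (Ch * (bump a2 * bump l2)))"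
      using Cf(2)[of a1 0 l1] Ch(2)[of a2 0 l2] Cf(1) bump_pos[of a1] bump_pos[of l1]
      by (intro mult_left_mono[OF mult_mono]) (auto simp: pqr const_family_def)
    finally show ?thesis by (simp add: D_def pqr mult_ac)
  qed
  have cont: "continuous_on UNIV (\<lambda>z. J (fst z) (snd z))"
    unfolding J_def K_def A_def B_def star_kernel_eq[OF \<open>\<theta> \<noteq> 0\<close>]
    by (intro continuous_intros continuous_on_compose2[OF schwartz_continuous[OF f]]
        continuous_on_compose2[OF schwartz_continuous[OF h]]) auto
  note tensor = integrable_tensor[where 'c=real, of bump bump, OF bump_integrable bump_integrable]
    integrable_tensor[where 'c=real, of bump "\<lambda>z::real\<times>real. bump (fst z) * bump (snd z)", OF bump_integrable integrable_tensor[OF bump_integrable bump_integrable]]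
  have int4: "integrable lborel (\<lambda>z. J (fst z) (snd z))"
    by (rule integrable_tensor_bound[where p="\<lambda>a1. D * bump a1" and q="\<lambda>z. bump (fst z) * (bump (fst (snd z)) * bump (snd (snd z)))"])
       (use bound bump_integrable tensor(2) cont in \<open>auto intro!: borel_measurable_continuous_onI\<close>)
  have int3: "integrable lborel (\<lambda>z. J a1 z)" for a1
  proof -
    have "continuous_on UNIV (\<lambda>z. (\<lambda>w. J (fst w) (snd w)) (a1, z))"
      by (rule continuous_on_compose2[OF cont continuous_on_Pair[OF continuous_on_const continuous_on_id]]) simp
    then have "continuous_on UNIV (\<lambda>z. J a1 z)" by simp
    moreover have "cmod (J a1 (a2, z)) \<le> (D * bump a1) * bump a2 * (bump (fst z) * bump (snd z))" for a2 z
      using bound[of a1 a2 "fst z" "snd z"] by (simp add: mult_ac)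
    ultimately show ?thesis
      using bump_integrable tensor(1)
      by (intro integrable_tensor_bound[where p="\<lambda>a2. (D * bump a1) * bump a2" and q="\<lambda>z. bump (fst z) * bump (snd z)"])
         (auto intro!: borel_measurable_continuous_onI)
  qed
  have intA: "integrable lborel (A a1 a2)" "integrable lborel (B a1 a2)" for a1 a2
    using orbit_integrable[OF rf] orbit_integrable[OF rh] by (auto simp: A_def[abs_def] B_def[abs_def] const_family_def)
  have inner: "(LINT w|lborel. J a1 (a2, w)) = F a l a1 a2" for a1 a2
  proof -
    have "(LINT w|lborel. J a1 (a2, w)) = K a1 a2 * ((LINT x|lborel. A a1 a2 x) * (LINT x|lborel. B a1 a2 x))"
      unfolding J_def using integral_tensor[OF intA] by simp
    also have "(LINT x|lborel. A a1 a2 x) = fiber_fourier c (const_family f) 0 a1 (a2 - a)"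
      by (simp add: A_def fiber_fourier_def const_family_def)
    also have "(LINT x|lborel. B a1 a2 x) = fiber_fourier c (const_family h) 0 a2 (a - a1)"
      by (simp add: B_def fiber_fourier_def const_family_def)
    finally show ?thesis
      unfolding F_def K_def weighted_fourier_def star_kernel_eq[OF \<open>\<theta> \<noteq> 0\<close>]
        root_cosh_commute[of a2 a] root_cosh_commute[of a a1]
      by (simp only: of_real_mult mult_ac)
  qed
  have "(LINT z|lborel. J (fst z) (snd z)) = (LINT a1|lborel. LINT z|lborel. J a1 z)"
    using lborel_Fubini(2)[of J] int4 by simp
  also have "\<dots> = (LINT a1|lborel. LINT a2|lborel. F a l a1 a2)"
  proof (rule Bochner_Integration.integral_cong[OF refl])
    fix a1
    show "(LINT z|lborel. J a1 z) = (LINT a2|lborel. F a l a1 a2)"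
      using lborel_Fubini(2)[of "\<lambda>x y. J a1 (x, y)"] int3[of a1] by (simp add: inner)
  qed
  finally have J_int: "(LINT z|lborel. J (fst z) (snd z)) = (LINT a1|lborel. LINT a2|lborel. F a l a1 a2)" .
  have "star_product \<theta> f h (a, l) = complex_of_real (4 / (pi * \<theta>)\<^sup>2) * (LINT z|lborel. J (fst z) (snd z))"
  proof -
    have e: "exp (2 * \<i> / complex_of_real \<theta> * complex_of_real (x + y + z)) =
        cis (c * x) * (cis (c * y) * cis (c * z))" for x y z
      by (simp add: cis_conv_exp c_def algebra_simps add_divide_distrib flip: exp_add)
    show ?thesis
      unfolding star_product_def prod.case star_kernel_def[symmetric] e
      by (intro arg_cong2[where f="(*)"] refl Bochner_Integration.integral_cong)
         (auto simp: J_def K_def A_def B_def mult_ac)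
  qed
  with J_int show "star_product \<theta> f h (a, l) = complex_of_real (4 / (pi * \<theta>)\<^sup>2) * (LINT a1|lborel. LINT a2|lborel. F a l a1 a2)"
    by simp
  obtain C1 where C1: "C1 > 0" "\<And>n a b. cosh (2 * a) ^ 2 * cosh (2 * b) ^ 0 * cmod (weighted_fourier c (const_family f) n a b) \<le> C1"
    using cosh_decaysE[OF wf] by metis
  obtain C2 where C2: "C2 > 0" "\<And>n a b. cosh (2 * a) ^ 2 * cosh (2 * b) ^ 0 * cmod (weighted_fourier c (const_family h) n a b) \<le> C2"
    using cosh_decaysE[OF wh] by metis
  show "integrable lborel (\<lambda>z. F a l (fst z) (snd z))"
  proof (rule integrable_tensor_bound[where p="\<lambda>a1. 2 * C1 * bump a1" and q="\<lambda>a2. C2 * bump a2"])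
    show "(\<lambda>z. F a l (fst z) (snd z)) \<in> borel_measurable borel"
      unfolding F_def
      by (intro borel_measurable_continuous_onI continuous_intros cosh2.rapid_continuous_slice[OF wf]
          cosh2.rapid_continuous_slice[OF wh])
    fix a1 a2 :: real
    define p q where pq: "p = cosh (2 * a1)" "q = cosh (2 * a2)"
    have pos: "p > 0" "q > 0" by (simp_all add: pq)
    let ?u = "cmod (weighted_fourier c (const_family f) 0 a1 (a2 - a))" and ?v = "cmod (weighted_fourier c (const_family h) 0 a2 (a - a1))"
    have "p\<^sup>2 * ?u \<le> C1" "q\<^sup>2 * ?v \<le> C2" using C1(2) C2(2) by (auto simp: pq)
    then have uv: "p * ?u \<le> C1 * (1 / p)" "q * ?v \<le> C2 * (1 / q)"
      using pos by (simp_all add: pos_le_divide_eq power2_eq_square mult_ac)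
    have "cmod (F a l a1 a2) = root_cosh (a1 - a2) * (?u * ?v)" by (simp add: F_def norm_mult)
    also have "\<dots> \<le> (2 * p * q) * (?u * ?v)"
      unfolding pq by (intro mult_right_mono root_cosh_diff_le) auto
    also have "\<dots> = 2 * ((p * ?u) * (q * ?v))" by (simp add: mult_ac)
    also have "\<dots> \<le> 2 * ((C1 * (1 / p)) * (C2 * (1 / q)))"
      using uv pos C1(1) by (intro mult_left_mono[OF mult_mono]) auto
    also have "\<dots> \<le> 2 * ((C1 * bump a1) * (C2 * bump a2))"
      using C1(1) C2(1) pos bump_pos[of a1] inverse_cosh_le_bump[of a1] inverse_cosh_le_bump[of a2]
      unfolding pq by (intro mult_left_mono mult_mono) auto
    finally show "cmod (F a l (fst (a1, a2)) (snd (a1, a2))) \<le> 2 * C1 * bump a1 * (C2 * bump a2)" by (simp add: mult_ac)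
  qed (use bump_integrable in auto)
qed

lemma fiber_fourier_uminus: "fiber_fourier (- c) f n a b = fiber_fourier c f n a (- b)"
  by (simp add: fiber_fourier_def)

text \<open>
  Exchanging the two integration variables reverses the sign of the phase and leaves the rest of the
  kernel unchanged.
\<close>

lemma star_product_flip:
  assumes "\<theta> \<noteq> 0" "f \<in> schwartz_space" "h \<in> schwartz_space"
  shows "star_product \<theta> h f = star_product (- \<theta>) f h"
proof
  fix x :: "real \<times> real"
  obtain a l where x: "x = (a, l)" by (cases x)
  have "(LINT a1|lborel. LINT a2|lborel. complex_of_real (root_cosh (a1 - a2)) * cis (2 / \<theta> * sinh (2 * (a1 - a2)) * l) *
     (weighted_fourier (2 / \<theta>) (const_family h) 0 a1 (a2 - a) * weighted_fourier (2 / \<theta>) (const_family f) 0 a2 (a - a1)))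
   = (LINT a2|lborel. LINT a1|lborel. complex_of_real (root_cosh (a1 - a2)) * cis (2 / \<theta> * sinh (2 * (a1 - a2)) * l) *
     (weighted_fourier (2 / \<theta>) (const_family h) 0 a1 (a2 - a) * weighted_fourier (2 / \<theta>) (const_family f) 0 a2 (a - a1)))"
    using lborel_Fubini(1)[OF star_product_iterated(2)[OF assms(1,3,2), of l a]] by simp
  also have "\<dots> = (LINT a1|lborel. LINT a2|lborel. complex_of_real (root_cosh (a1 - a2)) * cis (2 / (- \<theta>) * sinh (2 * (a1 - a2)) * l) *
     (weighted_fourier (2 / (- \<theta>)) (const_family f) 0 a1 (a2 - a) * weighted_fourier (2 / (- \<theta>)) (const_family h) 0 a2 (a - a1)))"
  proof (intro Bochner_Integration.integral_cong refl)
    fix a1 a2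
    have w: "weighted_fourier (2 / (- \<theta>)) g n x y = weighted_fourier (2 / \<theta>) g n x (- y)" for g n x y
      by (simp add: weighted_fourier_def fiber_fourier_uminus)
    have r: "root_cosh (a2 - a1) = root_cosh (a1 - a2)" by (rule root_cosh_commute)
    have s: "2 / \<theta> * sinh (2 * (a2 - a1)) * l = 2 / (- \<theta>) * sinh (2 * (a1 - a2)) * l"
      using sinh_minus[of "2 * (a1 - a2)"] by simp
    show "complex_of_real (root_cosh (a2 - a1)) * cis (2 / \<theta> * sinh (2 * (a2 - a1)) * l) *
     (weighted_fourier (2 / \<theta>) (const_family h) 0 a2 (a1 - a) * weighted_fourier (2 / \<theta>) (const_family f) 0 a1 (a - a2)) =
     complex_of_real (root_cosh (a1 - a2)) * cis (2 / (- \<theta>) * sinh (2 * (a1 - a2)) * l) *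
     (weighted_fourier (2 / (- \<theta>)) (const_family f) 0 a1 (a2 - a) * weighted_fourier (2 / (- \<theta>)) (const_family h) 0 a2 (a - a1))"
      unfolding w r s by (simp add: mult_ac)
  qed
  finally show "star_product \<theta> h f x = star_product (- \<theta>) f h x"
    using assms by (simp add: x star_product_iterated(1))
qed

lemma translate_integral: "(LINT x|lborel. g (x + t)) = (LINT x|lborel. g x)" for g :: "real \<Rightarrow> complex"
  using lborel_integral_real_affine[of 1 g t] by (simp add: add.commute)

lemma reflect_integral: "(LINT x|lborel. g (t - x)) = (LINT x|lborel. g x)" for g :: "real \<Rightarrow> complex"
  using lborel_integral_real_affine[of "-1" g t] by simp

text \<open>The substitution \<open>a2 = s + a\<close>, \<open>a1 = s + a + b\<close> makes the phase depend on \<open>b\<close> alone.\<close>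

lemma star_product_synthesis:
  assumes "\<theta> \<noteq> 0" and f: "f \<in> schwartz_space" and h: "h \<in> schwartz_space"
  defines "c \<equiv> 2 / \<theta>"
  shows "star_product \<theta> f h (a, l) = complex_of_real (4 / (pi * \<theta>)\<^sup>2) *
     fiber_synthesis c (\<lambda>n a b. complex_of_real (root_cosh b) *
       twisted_convolution (weighted_fourier c (const_family f)) (weighted_fourier c (const_family h)) n a b) 0 a l"
proof -
  have c: "c \<noteq> 0" using assms by simp
  define u v where "u = weighted_fourier c (const_family f)" and "v = weighted_fourier c (const_family h)"
  have u: "rapid cosh_weight u" and v: "rapid cosh_weight v"
    unfolding u_def v_def by (auto intro: rapid_weighted_fourier[OF c] rapid_const_family f h)
  define F where "F a1 a2 = complex_of_real (root_cosh (a1 - a2)) * cis (c * sinh (2 * (a1 - a2)) * l) *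
     (u 0 a1 (a2 - a) * v 0 a2 (a - a1))" for a1 a2
  define G where "G s b = complex_of_real (root_cosh b) * wave c b l *
     (u 0 (s + a + b) s * v 0 (s + a) (- s - b))" for s b
  have F: "integrable lborel (\<lambda>z. F (fst z) (snd z))"
    unfolding F_def u_def v_def c_def by (rule star_product_iterated(2)[OF assms(1) f h])
  obtain C where C: "C > 0" "\<And>n a b s. cosh_weight a b ^ 2 * cmod (u n (s + a + b) s * v n (s + a) (- s - b)) \<le> C * bump s"
    using twisted_bound[OF u v] by metis
  have G: "integrable lborel (\<lambda>z. G (fst z) (snd z))"
  proof (rule integrable_tensor_bound[where p="\<lambda>s. C * bump s" and q=bump])
    show "(\<lambda>z. G (fst z) (snd z)) \<in> borel_measurable borel"
      unfolding G_def
      by (intro borel_measurable_continuous_onI continuous_intros cosh2.rapid_continuous_slice[OF u]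
          cosh2.rapid_continuous_slice[OF v])
    fix s b :: real
    let ?w = "cmod (u 0 (s + a + b) s * v 0 (s + a) (- s - b))" and ?q = "cosh (2 * b)"
    have "?q\<^sup>2 * ?w \<le> cosh_weight a b ^ 2 * ?w"
      by (intro mult_right_mono power_mono cosh_weight_ge) auto
    then have q: "?q\<^sup>2 * ?w \<le> C * bump s" using C(2)[of a b 0 s] by linarith
    have "cmod (G s b) = root_cosh b * ?w" unfolding G_def by (simp add: norm_mult)
    also have "\<dots> \<le> ?q * ?w" by (intro mult_right_mono root_cosh_le) auto
    also have "\<dots> \<le> C * (bump b * bump s)"
      using q C(1) by (intro trade_cosh_for_bump) (auto simp: power2_eq_square mult.assoc)
    finally show "cmod (G (fst (s, b)) (snd (s, b))) \<le> C * bump s * bump b" by (simp add: mult_ac)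
  qed (use bump_integrable in auto)
  have FG: "F (b + (s + a)) (s + a) = G s b" for s b
  proof -
    have e: "b + (s + a) - (s + a) = b" "s + a - a = s" "a - (b + (s + a)) = - s - b" "b + (s + a) = s + a + b"
      by auto
    show ?thesis unfolding F_def G_def e(1-3) unfolding e(4) ..
  qed
  have "(LINT a1|lborel. LINT a2|lborel. F a1 a2) = (LINT a2|lborel. LINT a1|lborel. F a1 a2)"
    using lborel_Fubini(1)[OF F] by simp
  also have "\<dots> = (LINT s|lborel. LINT a1|lborel. F a1 (s + a))"
    by (rule translate_integral[symmetric])
  also have "\<dots> = (LINT s|lborel. LINT b|lborel. G s b)"
  proof (rule Bochner_Integration.integral_cong[OF refl])
    fix s
    show "(LINT a1|lborel. F a1 (s + a)) = (LINT b|lborel. G s b)"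
      unfolding FG[symmetric] by (rule translate_integral[symmetric])
  qed
  also have "\<dots> = (LINT b|lborel. LINT s|lborel. G s b)"
    using lborel_Fubini(1)[OF G] by simp
  also have "\<dots> = fiber_synthesis c (\<lambda>n a b. complex_of_real (root_cosh b) * twisted_convolution u v n a b) 0 a l"
    unfolding fiber_synthesis_def G_def twisted_convolution_def
    by (simp only: integral_mult_right_zero) (simp only: mult_ac)
  finally show ?thesis
    using star_product_iterated(1)[OF assms(1) f h, of a l] unfolding F_def u_def v_def c_def by simp
qed

lemma star_product_schwartz:
  assumes "\<theta> \<noteq> 0" and f: "f \<in> schwartz_space" and h: "h \<in> schwartz_space"
  shows "star_product \<theta> f h \<in> schwartz_space"
proof -
  define c where "c = 2 / \<theta>"
  have c: "c \<noteq> 0" using assms by (simp add: c_def)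
  have "rapid orbit_weight (\<lambda>n a l. complex_of_real (4 / (pi * \<theta>)\<^sup>2) * fiber_synthesis c (\<lambda>n a b. complex_of_real (root_cosh b) *
       twisted_convolution (weighted_fourier c (const_family f)) (weighted_fourier c (const_family h)) n a b) n a l)"
    by (intro orbit.rapid_cmult rapid_fiber_synthesis c cosh2.rapid_mult slow_root_cosh
        rapid_twisted_convolution rapid_weighted_fourier rapid_const_family f h)
  from rapid_in_schwartz[OF this, of 0] show ?thesis
    by (rule back_subst[of "\<lambda>x. x \<in> schwartz_space"])
       (auto simp: fun_eq_iff star_product_synthesis[OF assms] c_def)
qed

section \<open>Left multiplication by the star exponential\<close>

lemma partials_affine:
  assumes "partials u ux uy"
  shows "partials (\<lambda>n x y. u n (x - t) (s - y)) (\<lambda>n x y. ux n (x - t) (s - y)) (\<lambda>n x y. (-1) * uy n (x - t) (s - y))"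
proof -
  have "((\<lambda>x. u n (x - t) r) has_vector_derivative ux n (x - t) r) (at x)" for n x r
    using has_vector_derivative_shift[of "\<lambda>x. u n x r" _ "- t" x] assms
    by (auto simp: partials_def)
  moreover have "((\<lambda>y. u n r (s - y)) has_vector_derivative - uy n r (s - y)) (at y)" for n r y
    using has_vector_derivative_reflect[of "\<lambda>y. u n r y" _ s y] assms
    by (auto simp: partials_def)
  ultimately show ?thesis by (simp add: partials_def)
qed

lemma decays_affine:
  assumes "decays cosh_weight u"
  shows "decays cosh_weight (\<lambda>n x y. u n (x - t) (s - y))"
  unfolding decays_def
proof
  fix N
  obtain C where C: "C > 0" "\<And>n x y. cosh_weight x y ^ N * cmod (u n x y) \<le> C"
    using decaysE[OF assms] by metis
  define D where "D = (4 * cosh (2 * t) * cosh (2 * s)) ^ N"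
  have "cosh_weight x y ^ N * cmod (u n (x - t) (s - y)) \<le> D * C" for n x y
  proof -
    have "cosh (2 * x) \<le> 2 * cosh (2 * (x - t)) * cosh (2 * t)"
      by (rule cosh_le_split) simp
    moreover have "cosh (2 * y) \<le> 2 * cosh (2 * (s - y)) * cosh (2 * s)"
      by (rule cosh_le_split) simp
    ultimately have "cosh_weight x y \<le> (2 * cosh (2 * (x - t)) * cosh (2 * t)) * (2 * cosh (2 * (s - y)) * cosh (2 * s))"
      unfolding cosh_weight_def by (intro mult_mono) auto
    then have "cosh_weight x y ^ N \<le> ((4 * cosh (2 * t) * cosh (2 * s)) * cosh_weight (x - t) (s - y)) ^ N"
      using cosh_weight_ge(3)[of x y] by (intro power_mono) (auto simp: cosh_weight_def mult_ac)
    then have "cosh_weight x y ^ N * cmod (u n (x - t) (s - y)) \<le> D * (cosh_weight (x - t) (s - y) ^ N * cmod (u n (x - t) (s - y)))"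
      unfolding D_def power_mult_distrib mult.assoc[symmetric] by (intro mult_right_mono) auto
    also have "\<dots> \<le> D * C" using C by (intro mult_left_mono) (auto simp: D_def)
    finally show ?thesis .
  qed
  then show "\<exists>C. \<forall>n x y. cosh_weight x y ^ N * cmod (u n (x - t) (s - y)) \<le> C" by blast
qed

lemma rapid_affine:
  assumes "rapid cosh_weight u"
  shows "rapid cosh_weight (\<lambda>n x y. u n (x - t) (s - y))"
proof -
  have "rapid cosh_weight u \<Longrightarrow> smooth (decays cosh_weight) k (\<lambda>n x y. u n (x - t) (s - y))" for k u
  proof (induction k arbitrary: u)
    case 0
    then show ?case using decays_affine cosh2.rapid_decays by simp
  next
    case (Suc k)
    obtain ux uy where p: "partials u ux uy" "rapid cosh_weight ux" "rapid cosh_weight uy"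
      using cosh2.rapid_partials[OF Suc.prems] .
    have "smooth (decays cosh_weight) k (\<lambda>n x y. (-1) * uy n (x - t) (s - y))"
      using Suc.IH[OF p(3)] cosh2.slow_const[of "-1"] by (intro cosh2.rapid_mult_smooth) (auto simp: slow_def)
    then show ?case
      using partials_affine[OF p(1), of t s] Suc.IH[OF p(2)] decays_affine[OF cosh2.rapid_decays[OF Suc.prems], of t s]
      by auto
  qed
  then show ?thesis using assms by (simp add: rapid_def)
qed

definition exp_phase :: "real \<Rightarrow> real \<Rightarrow> real \<Rightarrow> real" where
  "exp_phase A B x = A * exp (- 2 * x) + B * exp (2 * x)"

text \<open>
  The logarithmic derivative in either variable is \<open>i\<close> times the derivative of the phase, a combination
  of products of exponentials of \<open>a\<close> and \<open>b\<close>.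
\<close>

lemma slow_cis_exp_phase: "slow cosh_weight (\<lambda>n a b. cis (exp_phase A B (a + b - t)))"
proof -
  define d where "d x = - 2 * A * exp (- 2 * x) + 2 * B * exp (2 * x)" for x
  let ?p = "\<lambda>(n::nat) a b. \<i> * complex_of_real (d (a + b - t))"
  have der: "(exp_phase A B has_real_derivative d x) (at x)" for x
    unfolding exp_phase_def d_def by (auto intro!: derivative_eq_intros)
  have "((\<lambda>a. a + b - t) has_real_derivative 1) (at a)" "((\<lambda>b. a + b - t) has_real_derivative 1) (at b)" for a b
    by (auto intro!: derivative_eq_intros)
  from DERIV_chain2[OF der this(1)] DERIV_chain2[OF der this(2)]
  have "((\<lambda>a. exp_phase A B (a + b - t)) has_real_derivative d (a + b - t)) (at a)"
       "((\<lambda>b. exp_phase A B (a + b - t)) has_real_derivative d (a + b - t)) (at b)" for a b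
    by simp_all
  then have "partials (\<lambda>n a b. cis (exp_phase A B (a + b - t)))
      (\<lambda>n a b. ?p n a b * cis (exp_phase A B (a + b - t))) (\<lambda>n a b. ?p n a b * cis (exp_phase A B (a + b - t)))"
    unfolding partials_def using has_vector_derivative_cis by fastforce
  moreover have "slow cosh_weight ?p"
  proof -
    have e: "exp (- 2 * (a + b - t)) = exp (2 * t) * (exp (2 * (-1) * a) * exp (2 * (-1) * b))"
        "exp (2 * (a + b - t)) = exp (- 2 * t) * (exp (2 * 1 * a) * exp (2 * 1 * b))" for a b
      unfolding exp_add[symmetric] by (rule arg_cong[of _ _ exp], simp)+
    have p: "complex_of_real (d (a + b - t)) =
        complex_of_real (- 2 * A * exp (2 * t)) * (complex_of_real (exp (2 * (-1) * a)) * complex_of_real (exp (2 * (-1) * b))) +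
        complex_of_real (2 * B * exp (- 2 * t)) * (complex_of_real (exp (2 * 1 * a)) * complex_of_real (exp (2 * 1 * b)))" for a b
      unfolding d_def e of_real_add of_real_mult mult.assoc ..
    show ?thesis
      unfolding p by (intro cosh2.slow_mult cosh2.slow_add cosh2.slow_const slow_exp) auto
  qed
  moreover have "grows cosh_weight (\<lambda>n a b. cis (exp_phase A B (a + b - t)))"
    by (rule cosh2.grows_boundI[where C=1 and N=0]) simp
  ultimately show ?thesis using cosh2.slow_log_derivative[of ?p ?p] by blast
qed

text \<open>
  Left multiplication by \<open>exponential_function c A B t\<close> below. The factor \<open>c\<^sup>2 / pi\<^sup>2\<close> is the
  constant \<open>4 / (pi \<theta>)\<^sup>2\<close> of the star product, and \<open>pi / \<bar>c\<bar>\<close> stems from the Fourier inversion,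
  whose denominator \<open>cosh (2 t)\<close> cancels against two square roots.
\<close>

definition left_multiplier :: "real \<Rightarrow> real \<Rightarrow> real \<Rightarrow> real \<Rightarrow> fun_family \<Rightarrow> fun_family" where
  "left_multiplier c A B t f = (\<lambda>n a l. complex_of_real (c\<^sup>2 / pi\<^sup>2 * (pi / \<bar>c\<bar>)) *
     fiber_synthesis c (\<lambda>n a b. (cis (exp_phase A B (a + b - t)) * complex_of_real (root_cosh b)) *
        weighted_fourier c f n (a - t) (t - b)) n a l)"

lemma rapid_left_integrand:
  assumes "c \<noteq> 0" "rapid orbit_weight f"
  shows "rapid cosh_weight (\<lambda>n a b. (cis (exp_phase A B (a + b - t)) * complex_of_real (root_cosh b)) *
        weighted_fourier c f n (a - t) (t - b))"
  by (intro cosh2.rapid_mult cosh2.slow_mult slow_cis_exp_phase slow_root_cosh rapid_affine rapid_weighted_fourier assms)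

lemma rapid_left_multiplier:
  "c \<noteq> 0 \<Longrightarrow> rapid orbit_weight f \<Longrightarrow> rapid orbit_weight (left_multiplier c A B t f)"
  unfolding left_multiplier_def
  by (intro orbit.rapid_cmult rapid_fiber_synthesis rapid_left_integrand)

lemma left_multiplier_linear:
  assumes c: "c \<noteq> 0" and f: "rapid orbit_weight f" and g: "rapid orbit_weight g"
  shows "left_multiplier c A B t (\<lambda>n a l. f n a l + k * g n a l) =
    (\<lambda>n a l. left_multiplier c A B t f n a l + k * left_multiplier c A B t g n a l)"
proof -
  define u where "u f = (\<lambda>n a b. (cis (exp_phase A B (a + b - t)) * complex_of_real (root_cosh b)) *
        weighted_fourier c f n (a - t) (t - b))" for f :: fun_family
  have "u (\<lambda>n a l. f n a l + k * g n a l) = (\<lambda>n a l. u f n a l + k * u g n a l)"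
    unfolding u_def weighted_fourier_def fiber_fourier_add[OF f g] by (simp add: algebra_simps)
  moreover have "rapid cosh_weight (u f)" "rapid cosh_weight (u g)"
    unfolding u_def by (rule rapid_left_integrand[OF c f] rapid_left_integrand[OF c g])+
  ultimately show ?thesis
    unfolding left_multiplier_def u_def[symmetric] by (simp add: fiber_synthesis_add add_divide_distrib algebra_simps)
qed

definition left_operator :: "real \<Rightarrow> real \<Rightarrow> real \<Rightarrow> real \<Rightarrow> orbit_fun \<Rightarrow> orbit_fun" where
  "left_operator c A B t f = case_prod (left_multiplier c A B t (const_family f) 0)"

lemma left_operator_continuous:
  assumes c: "c \<noteq> 0"
  shows "continuous_map schwartz_topology schwartz_topology (left_operator c A B t)"
proof (rule continuous_operator)
  show "left_operator c A B t f \<in> schwartz_space" if "f \<in> schwartz_space" for f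
    unfolding left_operator_def by (intro rapid_in_schwartz rapid_left_multiplier c rapid_const_family that)
  show "left_operator c A B t (\<lambda>x. f x + k * g x) = (\<lambda>x. left_operator c A B t f x + k * left_operator c A B t g x)"
    if "f \<in> schwartz_space" "g \<in> schwartz_space" for f g k
    using left_multiplier_linear[OF c rapid_const_family[OF that(1)] rapid_const_family[OF that(2)], of A B t k]
    by (simp add: left_operator_def const_family_def fun_eq_iff)
  show "bounded_family (\<lambda>n. left_operator c A B t (F n))" if "bounded_family F" for F
  proof -
    have "bounded_family (\<lambda>n. case_prod (left_multiplier c A B t (\<lambda>n a l. F n (a, l)) n))"
      by (intro rapid_bounded_family rapid_left_multiplier c bounded_family_rapid that)
    moreover have "left_multiplier c A B t (\<lambda>n a l. F n (a, l)) n = left_multiplier c A B t (const_family (F n)) 0" for n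
      by (simp add: left_multiplier_def fiber_synthesis_def weighted_fourier_def fiber_fourier_def const_family_def)
    ultimately show ?thesis by (simp add: left_operator_def)
  qed
qed

text \<open>
  The star exponential, with \<open>\<alpha> t / 2\<close> in the place of \<open>t\<close>, as a plane wave on each fibre
  (\<open>star_exponential_eq\<close>).
\<close>

definition exponential_function :: "real \<Rightarrow> real \<Rightarrow> real \<Rightarrow> real \<Rightarrow> orbit_fun" where
  "exponential_function c A B t = (\<lambda>(a, l). complex_of_real (root_cosh t) * cis (exp_phase A B a) * cis (c * sinh (2 * t) * l))"

lemma exponential_function_continuous: "continuous_on UNIV (exponential_function c A B t)"
  unfolding exponential_function_def exp_phase_def case_prod_unfold by (intro continuous_intros)

lemma exponential_function_norm: "cmod (exponential_function c A B t x) = root_cosh t"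
  by (cases x) (simp add: exponential_function_def norm_mult)

lemma exponential_integrable:
  assumes "h \<in> schwartz_space"
  shows "integrable lborel (\<lambda>x. exponential_function c A B t x * h x)"
proof -
  obtain C where C: "C > 0" "\<And>n a l. cosh (2 * a) ^ 0 * cmod (const_family h n a l) \<le> C * (bump a * bump l)"
    using orbit_tensor_bound[OF rapid_const_family[OF assms]] by metis
  show ?thesis
  proof (rule integrable_tensor_bound[where p="\<lambda>a. root_cosh t * C * bump a" and q=bump])
    show "(\<lambda>x. exponential_function c A B t x * h x) \<in> borel_measurable borel"
      by (intro borel_measurable_continuous_onI continuous_intros exponential_function_continuous schwartz_continuous assms)
    show "cmod (exponential_function c A B t (a, l) * h (a, l)) \<le> root_cosh t * C * bump a * bump l" for a l
      using C(2)[of a 0 l] by (simp add: norm_mult exponential_function_norm const_family_def mult_left_mono mult.assoc)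
  qed (use bump_integrable in auto)
qed

lemma exponential_distribution:
  "defines_distribution (exponential_function c A B t)"
proof -
  let ?E = "exponential_function c A B t"
  let ?T = "distribution_of ?E"
  have val: "?T h = (LINT x|lborel. ?E x * h x)" if "h \<in> schwartz_space" for h
    using that by (simp add: distribution_of_def)
  have lin: "?T (\<lambda>x. f x + k * g x) = ?T f + k * ?T g" if "f \<in> schwartz_space" "g \<in> schwartz_space" for f g k
  proof -
    have "(\<lambda>x. ?E x * (f x + k * g x)) = (\<lambda>x. ?E x * f x + k * (?E x * g x))" by (simp add: algebra_simps)
    then show ?thesis
      using that exponential_integrable[OF that(1)] exponential_integrable[OF that(2)]
      by (simp add: val schwartz_closed)
  qed
  have T0: "?T (\<lambda>x. 0) = 0" by (simp add: val schwartz_zero)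
  have "continuous_map schwartz_topology euclidean ?T"
  proof (rule continuous_functional[OF lin])
    fix F assume F: "bounded_family F"
    obtain C where C: "C > 0" "\<And>n a l. cosh (2 * a) ^ 0 * cmod (F n (a, l)) \<le> C * (bump a * bump l)"
      using orbit_tensor_bound[OF bounded_family_rapid[OF F]] by metis
    have FS: "F n \<in> schwartz_space" for n using F by (simp add: bounded_family_def)
    let ?b = "\<lambda>x::real \<times> real. root_cosh t * C * (bump (fst x) * bump (snd x))"
    have b: "integrable lborel ?b" using integrable_tensor[OF bump_integrable bump_integrable] by simp
    have "cmod (?T (F n)) \<le> (LINT x|lborel. ?b x)" for n
      unfolding val[OF FS]
    proof (rule order_trans[OF integral_norm_bound integral_mono[OF integrable_norm[OF exponential_integrable[OF FS]] b]])
      fix x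
      show "cmod (?E x * F n x) \<le> ?b x"
        using C(2)[of "fst x" n "snd x"] by (simp add: norm_mult exponential_function_norm mult_left_mono mult.assoc)
    qed
    then show "\<exists>C. \<forall>n. cmod (?T (F n)) \<le> C" by blast
  qed
  moreover have "?T \<in> extensional schwartz_space" by (simp add: distribution_of_def)
  ultimately have "?T \<in> schwartz_dual"
    using lin[of _ _ 1] lin[OF schwartz_zero] by (simp add: schwartz_dual_def T0)
  then show ?thesis using exponential_integrable by (simp add: defines_distribution_def)
qed

text \<open>Synthesis is the transpose of the fibre Fourier transform.\<close>

lemma integral_synthesis_pairing:
  assumes "rapid cosh_weight u" "h \<in> schwartz_space" "c \<noteq> 0"
  shows "(LINT x|lborel. case_prod (fiber_synthesis c u 0) x * h x) =
    (LINT a|lborel. LINT b|lborel. u 0 a b * fiber_fourier c (const_family h) 0 a b)"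
proof -
  obtain C where C: "C > 0" "\<And>n a b. cmod (u n a b) \<le> C * bump b"
    using cosh_bump_bound0[OF assms(1)] by metis
  note rh = rapid_const_family[OF assms(2)]
  obtain D where D: "D > 0" "\<And>n a l. cmod (const_family h n a l) \<le> D * bump l"
    using orbit_bump_bound0[OF rh] by metis
  obtain B1 where B1: "B1 > 0" "\<And>n a l. cosh (2 * a) ^ 0 * cmod (fiber_synthesis c u n a l) \<le> B1 * (bump a * bump l)"
    using orbit_tensor_bound[OF rapid_fiber_synthesis[OF assms(3,1)]] by metis
  obtain B2 where B2: "B2 > 0" "\<And>n a l. cmod (const_family h n a l) \<le> B2"
    using orbit.rapid_bounded[OF rh] by metis
  have int: "integrable lborel (\<lambda>z. fiber_synthesis c u 0 (fst z) (snd z) * h (fst z, snd z))"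
  proof (rule integrable_tensor_bound[where p="\<lambda>a. B1 * B2 * bump a" and q=bump])
    show "(\<lambda>z. fiber_synthesis c u 0 (fst z) (snd z) * h (fst z, snd z)) \<in> borel_measurable borel"
      using schwartz_continuous[OF assms(2)]
      by (intro borel_measurable_continuous_onI
          continuous_on_mult[OF orbit.rapid_continuous[OF rapid_fiber_synthesis[OF assms(3,1)]]]) simp
    fix a l
    have "cmod (fiber_synthesis c u 0 a l) * cmod (h (a, l)) \<le> (B1 * (bump a * bump l)) * B2"
      using B1(1) B1(2)[of a 0 l] B2(2)[of 0 a l] bump_pos[of a] bump_pos[of l] by (intro mult_mono) (auto simp: const_family_def)
    then show "cmod (fiber_synthesis c u 0 (fst (a, l)) (snd (a, l)) * h (fst (a, l), snd (a, l))) \<le> B1 * B2 * bump a * bump l"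
      by (simp add: norm_mult mult_ac)
  qed (use bump_integrable in auto)
  have "(LINT x|lborel. case_prod (fiber_synthesis c u 0) x * h x) =
     (LINT a|lborel. LINT l|lborel. fiber_synthesis c u 0 a l * h (a, l))"
    using lborel_Fubini(2)[of "\<lambda>a l. fiber_synthesis c u 0 a l * h (a, l)"] int by (simp add: case_prod_unfold)
  also have "\<dots> = (LINT a|lborel. LINT b|lborel. u 0 a b * fiber_fourier c (const_family h) 0 a b)"
  proof (rule Bochner_Integration.integral_cong[OF refl])
    fix a
    have i: "integrable lborel (\<lambda>z. cis (c * sinh (2 * snd z) * fst z) * u 0 a (snd z) * h (a, fst z))"
    proof (rule integrable_tensor_bound[where p="\<lambda>l. D * bump l" and q="\<lambda>b. C * bump b"])
      show "(\<lambda>z. cis (c * sinh (2 * snd z) * fst z) * u 0 a (snd z) * h (a, fst z)) \<in> borel_measurable borel"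
        by (intro borel_measurable_continuous_onI continuous_intros cosh2.rapid_continuous_slice[OF assms(1)]
            continuous_on_compose2[OF schwartz_continuous[OF assms(2)]]) auto
      fix l b
      have "cmod (u 0 a b) * cmod (h (a, l)) \<le> (C * bump b) * (D * bump l)"
        using C(1) C(2)[of 0 a b] D(2)[of 0 a l] bump_pos[of b] by (intro mult_mono) (auto simp: const_family_def)
      then show "cmod (cis (c * sinh (2 * snd (l, b)) * fst (l, b)) * u 0 a (snd (l, b)) * h (a, fst (l, b))) \<le> D * bump l * (C * bump b)"
        by (simp add: norm_mult mult_ac)
    qed (use bump_integrable in auto)
    have "(LINT l|lborel. fiber_synthesis c u 0 a l * h (a, l)) =
        (LINT l|lborel. LINT b|lborel. wave c b l * u 0 a b * h (a, l))"
      by (simp add: fiber_synthesis_def)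
    also have "\<dots> = (LINT b|lborel. LINT l|lborel. wave c b l * u 0 a b * h (a, l))"
      using lborel_Fubini(1)[of "\<lambda>l b. wave c b l * u 0 a b * h (a, l)"] i by simp
    also have "\<dots> = (LINT b|lborel. u 0 a b * fiber_fourier c (const_family h) 0 a b)"
    proof (rule Bochner_Integration.integral_cong[OF refl])
      fix b
      have "(LINT l|lborel. wave c b l * u 0 a b * h (a, l)) = (LINT l|lborel. u 0 a b * (wave c b l * h (a, l)))"
        by (simp only: mult_ac)
      then show "(LINT l|lborel. wave c b l * u 0 a b * h (a, l)) = u 0 a b * fiber_fourier c (const_family h) 0 a b"
        by (simp add: fiber_fourier_def const_family_def)
    qed
    finally show "(LINT l|lborel. fiber_synthesis c u 0 a l * h (a, l)) = (LINT b|lborel. u 0 a b * fiber_fourier c (const_family h) 0 a b)" .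
  qed
  finally show ?thesis .
qed

text \<open>
  Integrating first along the fibres, Fourier inversion evaluates the twisted convolution of \<open>u\<close> and \<open>v\<close> at
  \<open>b = - t\<close>. The double integral over \<open>(a, s)\<close> that is left becomes, with \<open>a + s\<close> and \<open>t - s\<close> as new
  variables, the pairing of \<open>v\<close> with a translated and reflected \<open>u\<close>.
\<close>

proposition exponential_pairing:
  assumes "\<theta> \<noteq> 0" and f: "f \<in> schwartz_space" and h: "h \<in> schwartz_space"
  defines "c \<equiv> 2 / \<theta>"
  shows "(LINT x|lborel. exponential_function c A B t x * star_product \<theta> f h x) =
    (LINT x|lborel. left_operator c A B t f x * h x)"
proof -
  have c: "c \<noteq> 0" using assms by simp
  define u v where "u = weighted_fourier c (const_family f)" and "v = weighted_fourier c (const_family h)"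
  have u: "rapid cosh_weight u" and v: "rapid cosh_weight v"
    unfolding u_def v_def by (auto intro: rapid_weighted_fourier[OF c] rapid_const_family f h)
  define W where "W = (\<lambda>n a b. complex_of_real (root_cosh b) * twisted_convolution u v n a b)"
  have W: "rapid cosh_weight W"
    unfolding W_def by (intro cosh2.rapid_mult slow_root_cosh rapid_twisted_convolution u v)
  let ?ph = "\<lambda>a. cis (exp_phase A B a)"
  define k where "k = complex_of_real (c\<^sup>2 / pi\<^sup>2)"
  have star: "star_product \<theta> f h (a, l) = k * fiber_synthesis c W 0 a l" for a l
    using star_product_synthesis[OF assms(1) f h, of a l]
    by (simp add: W_def u_def v_def c_def k_def power_mult_distrib power_divide mult_ac)
  let ?E = "exponential_function c A B t"
  have pi_c: "root_cosh t * (pi / (\<bar>c\<bar> * cosh (2 * t))) * root_cosh t = pi / \<bar>c\<bar>"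
  proof -
    have "root_cosh t * (pi / (\<bar>c\<bar> * cosh (2 * t))) * root_cosh t = (root_cosh t * root_cosh t) * (pi / (\<bar>c\<bar> * cosh (2 * t)))"
      by (simp only: mult_ac)
    also have "root_cosh t * root_cosh t = cosh (2 * t)" by simp
    finally show ?thesis by simp
  qed
  obtain C where C: "C > 0" "\<And>n a b. cosh (2 * a) ^ 0 * cosh (2 * b) ^ 1 * cmod (W n a b) \<le> C"
    using cosh_decaysE[OF W] by metis
  have fibre: "(LINT l|lborel. ?E (a, l) * star_product \<theta> f h (a, l)) =
      k * complex_of_real (pi / \<bar>c\<bar>) * (?ph a * twisted_convolution u v 0 a (- t))" for a
  proof -
    have "(LINT l|lborel. cis (c * sinh (2 * t) * l) * (LINT b|lborel. wave c b l * W 0 a b)) =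
        complex_of_real (pi / (\<bar>c\<bar> * cosh (2 * t))) * W 0 a (- t)"
    proof (rule fourier_inversion_sinh[OF _ _ c])
      show "continuous_on UNIV (\<lambda>b. W 0 a b)"
        by (rule cosh2.rapid_continuous_slice[OF W]) (intro continuous_intros)+
      show "cmod (W 0 a b) \<le> C / cosh (2 * b)" for b
        using C(2)[of a b 0] by (simp add: pos_le_divide_eq mult_ac)
      have "integrable lborel (\<lambda>l. cis (0 * l) * fiber_synthesis c W 0 a l)"
        by (rule orbit_integrable[OF rapid_fiber_synthesis[OF c W]])
      then show "integrable lborel (\<lambda>l. LINT b|lborel. wave c b l * W 0 a b)"
        by (simp add: fiber_synthesis_def)
    qed
    then have inv: "(LINT l|lborel. cis (c * sinh (2 * t) * l) * fiber_synthesis c W 0 a l) =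
        complex_of_real (pi / (\<bar>c\<bar> * cosh (2 * t))) * W 0 a (- t)"
      by (simp add: fiber_synthesis_def)
    have "(LINT l|lborel. ?E (a, l) * star_product \<theta> f h (a, l)) =
        (LINT l|lborel. (k * complex_of_real (root_cosh t) * ?ph a) * (cis (c * sinh (2 * t) * l) * fiber_synthesis c W 0 a l))"
      unfolding star exponential_function_def prod.case by (simp only: mult_ac)
    also have "\<dots> = (k * complex_of_real (root_cosh t) * ?ph a) * (complex_of_real (pi / (\<bar>c\<bar> * cosh (2 * t))) * W 0 a (- t))"
      by (simp only: integral_mult_right_zero inv)
    also have "W 0 a (- t) = complex_of_real (root_cosh t) * twisted_convolution u v 0 a (- t)"
      by (simp add: W_def)
    also have "(k * complex_of_real (root_cosh t) * ?ph a) * (complex_of_real (pi / (\<bar>c\<bar> * cosh (2 * t))) *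
        (complex_of_real (root_cosh t) * twisted_convolution u v 0 a (- t))) =
        k * complex_of_real (root_cosh t * (pi / (\<bar>c\<bar> * cosh (2 * t))) * root_cosh t) * (?ph a * twisted_convolution u v 0 a (- t))"
      by (simp only: of_real_mult mult_ac)
    finally show ?thesis unfolding pi_c .
  qed
  have ES: "integrable lborel (\<lambda>z. ?E (fst z, snd z) * star_product \<theta> f h (fst z, snd z))"
    using exponential_integrable[OF star_product_schwartz[OF assms(1) f h], of c A B t] by simp
  have lhs: "(LINT x|lborel. ?E x * star_product \<theta> f h x) =
      k * complex_of_real (pi / \<bar>c\<bar>) * (LINT a|lborel. ?ph a * twisted_convolution u v 0 a (- t))"
    using lborel_Fubini(2)[OF ES] by (simp add: fibre)
  \<comment> \<open>the integrand before, between and after the substitutions of \<open>a - s\<close> for \<open>a\<close> and of \<open>t - b\<close> for \<open>s\<close>\<close>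
  define G where "G a s = ?ph a * (u 0 (s + a - t) s * v 0 (s + a) (t - s))" for a s
  define Q where "Q s a = ?ph (a - s) * (u 0 (a - t) s * v 0 a (t - s))" for s a
  define R where "R b a = ?ph (a + b - t) * (u 0 (a - t) (t - b) * v 0 a b)" for b a
  have ph_cont: "continuous_on UNIV ?ph" unfolding exp_phase_def by (intro continuous_intros)
  obtain C1 where C1: "C1 > 0" "\<And>n a b s. cosh_weight a b ^ 1 * cmod (u n (s + a + b) s * v n (s + a) (- s - b)) \<le> C1 * bump s"
    using twisted_bound[OF u v] by metis
  have G: "integrable lborel (\<lambda>z. G (fst z) (snd z))"
  proof (rule integrable_tensor_bound[where p=bump and q="\<lambda>s. C1 * bump s"])
    show "(\<lambda>z. G (fst z) (snd z)) \<in> borel_measurable borel"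
      unfolding G_def
      by (intro borel_measurable_continuous_onI continuous_intros continuous_on_compose2[OF ph_cont]
          cosh2.rapid_continuous_slice[OF u] cosh2.rapid_continuous_slice[OF v]) auto
    fix a s
    let ?w = "cmod (u 0 (s + a - t) s * v 0 (s + a) (t - s))"
    have "cosh (2 * a) * ?w \<le> cosh_weight a (- t) * ?w"
      by (intro mult_right_mono cosh_weight_ge) auto
    also have "\<dots> \<le> C1 * bump s" using C1(2)[of a "- t" 0 s] by simp
    finally have "?w \<le> C1 * (bump a * bump s)" using C1(1) by (intro trade_cosh_for_bump) auto
    then show "cmod (G (fst (a, s)) (snd (a, s))) \<le> bump a * (C1 * bump s)"
      by (simp add: G_def norm_mult mult_ac)
  qed (use bump_integrable in auto)
  obtain C2 where C2: "C2 > 0" "\<And>n a b. cmod (u n a b) \<le> C2" using cosh2.rapid_bounded[OF u] by metis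
  obtain C3 where C3: "C3 > 0" "\<And>n a b. cosh (2 * a) ^ 0 * cmod (v n a b) \<le> C3 * (bump a * bump b)"
    using cosh_tensor_bound[OF v] by metis
  have R: "integrable lborel (\<lambda>z. R (fst z) (snd z))"
  proof (rule integrable_tensor_bound[where p="\<lambda>b. C2 * C3 * bump b" and q=bump])
    show "(\<lambda>z. R (fst z) (snd z)) \<in> borel_measurable borel"
      unfolding R_def
      by (intro borel_measurable_continuous_onI continuous_intros continuous_on_compose2[OF ph_cont]
          cosh2.rapid_continuous_slice[OF u] cosh2.rapid_continuous_slice[OF v]) auto
    fix b a
    have "cmod (u 0 (a - t) (t - b)) * cmod (v 0 a b) \<le> C2 * (C3 * (bump a * bump b))"
      using C2 C3(2)[of a 0 b] by (intro mult_mono) auto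
    then show "cmod (R (fst (b, a)) (snd (b, a))) \<le> C2 * C3 * bump b * bump a"
      by (simp add: R_def norm_mult mult_ac)
  qed (use bump_integrable in auto)
  have "(LINT a|lborel. ?ph a * twisted_convolution u v 0 a (- t)) = (LINT a|lborel. LINT s|lborel. G a s)"
    by (simp add: twisted_convolution_def G_def)
  also have "\<dots> = (LINT s|lborel. LINT a|lborel. G a s)"
    using lborel_Fubini(1)[OF G] by simp
  also have "\<dots> = (LINT s|lborel. LINT a|lborel. Q s a)"
  proof (rule Bochner_Integration.integral_cong[OF refl])
    fix s
    have "G a s = Q s (a + s)" for a by (simp add: G_def Q_def add.commute)
    then show "(LINT a|lborel. G a s) = (LINT a|lborel. Q s a)" by (simp add: translate_integral)
  qed
  also have "\<dots> = (LINT b|lborel. LINT a|lborel. Q (t - b) a)" by (rule reflect_integral[symmetric])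
  also have "\<dots> = (LINT b|lborel. LINT a|lborel. R b a)"
    by (intro Bochner_Integration.integral_cong refl) (simp add: Q_def R_def algebra_simps)
  also have "\<dots> = (LINT a|lborel. LINT b|lborel. R b a)"
    using lborel_Fubini(1)[OF R] by simp
  finally have swap: "(LINT a|lborel. ?ph a * twisted_convolution u v 0 a (- t)) = (LINT a|lborel. LINT b|lborel. R b a)" .
  let ?u = "\<lambda>n a b. (cis (exp_phase A B (a + b - t)) * complex_of_real (root_cosh b)) * weighted_fourier c (const_family f) n (a - t) (t - b)"
  have "(LINT x|lborel. left_operator c A B t f x * h x) =
      k * complex_of_real (pi / \<bar>c\<bar>) * (LINT x|lborel. case_prod (fiber_synthesis c ?u 0) x * h x)"
  proof -
    have "left_operator c A B t f x * h x = (k * complex_of_real (pi / \<bar>c\<bar>)) * (case_prod (fiber_synthesis c ?u 0) x * h x)" for x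
      by (cases x) (simp only: left_operator_def left_multiplier_def prod.case k_def of_real_mult mult_ac)
    then show ?thesis by (simp only: integral_mult_right_zero)
  qed
  also have "(LINT x|lborel. case_prod (fiber_synthesis c ?u 0) x * h x) =
      (LINT a|lborel. LINT b|lborel. ?u 0 a b * fiber_fourier c (const_family h) 0 a b)"
    by (rule integral_synthesis_pairing[OF rapid_left_integrand[OF c rapid_const_family[OF f]] h c])
  also have "\<dots> = (LINT a|lborel. LINT b|lborel. R b a)"
    unfolding R_def u_def v_def weighted_fourier_def[of c "const_family h"] by (simp only: mult_ac)
  finally show ?thesis unfolding lhs swap ..
qed

lemma star_exponential_eq:
  assumes "\<theta> \<noteq> 0"
  shows "star_exponential \<theta> t (\<alpha>, \<beta>, \<gamma>) =
    exponential_function (2 / \<theta>) (sinh_quot \<alpha> t * \<beta> / \<theta>) (- sinh_quot \<alpha> t * \<gamma> / \<theta>) (\<alpha> * t / 2)"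
proof -
  have "exp (\<i> / complex_of_real \<theta> * complex_of_real (2 * l * sinh (\<alpha> * t) + sinh_quot \<alpha> t * (\<beta> * exp (- 2 * a) - \<gamma> * exp (2 * a)))) =
    cis (exp_phase (sinh_quot \<alpha> t * \<beta> / \<theta>) (- sinh_quot \<alpha> t * \<gamma> / \<theta>) a) * cis (2 / \<theta> * sinh (\<alpha> * t) * l)" for a l
    using assms unfolding cis_mult unfolding cis_conv_exp exp_phase_def
    by (intro arg_cong[of _ _ exp]) (simp add: field_simps)
  then show ?thesis
    by (simp add: star_exponential_def exponential_function_def fun_eq_iff mult.assoc)
qed

text \<open>The exponent depends on \<open>\<theta>\<close> and \<open>t\<close> only through \<open>1 / \<theta>\<close> times an odd function of \<open>t\<close>.\<close>

lemma star_exponential_flip: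
  "star_exponential (- \<theta>) (- t) X = star_exponential \<theta> t X"
proof -
  obtain \<alpha> \<beta> \<gamma> where X: "X = (\<alpha>, \<beta>, \<gamma>)" by (cases X)
  have s: "sinh_quot \<alpha> (- t) = - sinh_quot \<alpha> t" by (simp add: sinh_quot_def)
  have "\<i> / complex_of_real (- \<theta>) * complex_of_real (2 * l * sinh (\<alpha> * - t) + sinh_quot \<alpha> (- t) * r) =
     \<i> / complex_of_real \<theta> * complex_of_real (2 * l * sinh (\<alpha> * t) + sinh_quot \<alpha> t * r)" for l r
  proof -
    have "2 * l * sinh (\<alpha> * - t) + sinh_quot \<alpha> (- t) * r = - (2 * l * sinh (\<alpha> * t) + sinh_quot \<alpha> t * r)"
      by (simp add: s)
    then show ?thesis by (simp only: of_real_minus divide_minus_right minus_mult_minus)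
  qed
  then show ?thesis by (simp only: X star_exponential_def prod.case cosh_minus mult_minus_right)
qed

lemma star_exponential_left:
  assumes "\<theta> \<noteq> 0"
  shows "defines_distribution (star_exponential \<theta> t X)"
    and "\<exists>L. continuous_map schwartz_topology schwartz_topology L \<and>
      (\<forall>f\<in>schwartz_space. dist_star \<theta> (distribution_of (star_exponential \<theta> t X)) f = distribution_of (L f))"
proof -
  obtain \<alpha> \<beta> \<gamma> where X: "X = (\<alpha>, \<beta>, \<gamma>)" by (cases X)
  obtain A B \<tau> where E: "star_exponential \<theta> t X = exponential_function (2 / \<theta>) A B \<tau>"
    unfolding X using star_exponential_eq[OF assms] by blast
  show "defines_distribution (star_exponential \<theta> t X)" unfolding E by (rule exponential_distribution)
  have "dist_star \<theta> (distribution_of (star_exponential \<theta> t X)) f = distribution_of (left_operator (2 / \<theta>) A B \<tau> f)"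
    if "f \<in> schwartz_space" for f
    unfolding dist_star_def distribution_of_def E
    by (intro restrict_ext) (use star_product_schwartz[OF assms that] exponential_pairing[OF assms that] in simp)
  moreover have "continuous_map schwartz_topology schwartz_topology (left_operator (2 / \<theta>) A B \<tau>)"
    using assms by (intro left_operator_continuous) simp
  ultimately show "\<exists>L. continuous_map schwartz_topology schwartz_topology L \<and>
      (\<forall>f\<in>schwartz_space. dist_star \<theta> (distribution_of (star_exponential \<theta> t X)) f = distribution_of (L f))"
    by blast
qed

theorem theorem4p2:
  fixes \<theta> t \<alpha> \<beta> \<gamma> :: real
  assumes "\<theta> \<noteq> 0"
  shows "defines_distribution
           (star_exponential \<theta> t (\<alpha> *\<^sub>R lie_H + \<beta> *\<^sub>R lie_E + \<gamma> *\<^sub>R lie_F)) \<and>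
         distribution_of
           (star_exponential \<theta> t (\<alpha> *\<^sub>R lie_H + \<beta> *\<^sub>R lie_E + \<gamma> *\<^sub>R lie_F))
           \<in> multiplier_algebra \<theta>"
proof -
  define X where "X = \<alpha> *\<^sub>R lie_H + \<beta> *\<^sub>R lie_E + \<gamma> *\<^sub>R lie_F"
  let ?T = "distribution_of (star_exponential \<theta> t X)"
  have dist: "defines_distribution (star_exponential \<theta> t X)" by (rule star_exponential_left(1)[OF assms])
  \<comment> \<open>right multiplication for \<open>(\<theta>, t)\<close> is left multiplication for \<open>(- \<theta>, - t)\<close>\<close>
  have "- \<theta> \<noteq> 0" using assms by simp
  from star_exponential_left(2)[OF this, of "- t" X]
  obtain R where R: "continuous_map schwartz_topology schwartz_topology R"
    "\<And>f. f \<in> schwartz_space \<Longrightarrow> dist_star (- \<theta>) ?T f = distribution_of (R f)"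
    unfolding star_exponential_flip by blast
  have "star_dist \<theta> f ?T = distribution_of (R f)" if "f \<in> schwartz_space" for f
  proof -
    have "star_dist \<theta> f ?T = dist_star (- \<theta>) ?T f"
      unfolding star_dist_def dist_star_def
      by (intro restrict_ext) (use star_product_flip[OF assms that] in simp)
    then show ?thesis using R(2)[OF that] by simp
  qed
  then have "?T \<in> multiplier_algebra \<theta>"
    using dist R(1) star_exponential_left(2)[OF assms, of t X]
    unfolding multiplier_algebra_def defines_distribution_def by blast
  then show ?thesis using dist unfolding X_def by simp
qed

end
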